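(* Let $y_0\in H^3(\Omega)\cap H^1_0(\Omega)$, and let $u\in\hat U$ and, for $\tau>0$, $u_\tau\in\hat U$, where $\bar u\in H^1(\Omega)$ (the common initial value of the elements of $\hat U$) is such that $y_1:=\Delta y_0+\bar u\in H^1_0(\Omega)$. Let $y_\tau$ be the weak solution of the Cattaneo equation with delay $\tau$, right-hand side $u_\tau$ and initial data $y_0,y_1$, and let $y$ be the weak solution of the heat equation with right-hand side $u$ and initial datum $y_0$. Furthermore, let $u_\tau\to u$ in $H^1(0,T;H^1(\Omega))$ as $\tau\to0$. Then $$y_\tau\to y\quad\text{in } L^2(0,T;H^1_0(\Omega))\quad\text{as }\tau\to0.$$ Moreover, if there exists a constant $\tilde C>0$ independent of $\tau$ such that $\|u_\tau-u\|_{L^2(0,T;L^2(\Omega))}\le\tau\tilde C$ for all sufficiently small $\tau$, then there exists $C>0$ independent of $\tau$ such that $\|y_\tau-y\|_{L^2(0,T;H^1_0(\Omega))}\le C\tau$ (for all sufficiently small $\tau$), i.e., the states converge linearly.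
   Context: $\Omega\subset\mathbb{R}^d$ is a bounded Lipschitz domain with boundary $\partial\Omega$, and $T>0$ is fixed. A prime denotes the (weak) time derivative. $(\cdot,\cdot)$ is the $L^2(\Omega)$ scalar product, $\langle\cdot,\cdot\rangle$ is the duality pairing between $H^{-1}(\Omega)$ and $H^1_0(\Omega)$, and $a[y,v]:=(\nabla y,\nabla v)$ for $y,v\in H^1_0(\Omega)$. Admissible set: for fixed $0<M<\infty$ and $\bar u\in H^1(\Omega)$, $$\hat U := \{u\in H^1(0,T;H^1(\Omega)) : \|u\|_{H^1(0,T;H^1(\Omega))}\le M \text{ and } u(0)=\bar u\},$$ where $u(0)$ is well defined since $H^1(0,T;H^1(\Omega))\hookrightarrow C([0,T];H^1(\Omega))$. Cattaneo equation (delay $\tau>0$): $\tau y_\tau''+y_\tau'-\Delta y_\tau=u_\tau$ in $(0,T)\times\Omega$, $y_\tau=0$ on $(0,T)\times\partial\Omega$, $y_\tau(0)=y_0$, $y_\tau'(0)=y_1$. Its weak solution is the unique $y_\tau\in Y(0,T):=\{v\in L^2(0,T;H^1_0(\Omega)) : v'\in L^2(0,T;L^2(\Omega)),\ v''\in L^2(0,T;H^{-1}(\Omega))\}$ satisfying the initial conditions and $$\int_0^T \tau\langle y_\tau'',v\rangle+(y_\tau',v)+a[y_\tau,v]\,dt=\int_0^T(u_\tau,v)\,dt\quad\text{for all } v\in L^2(0,T;H^1_0(\Omega)).$$ Heat equation: $y'-\Delta y=u$ in $(0,T)\times\Omega$, $y=0$ on $(0,T)\times\partial\Omega$, $y(0)=y_0$.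 Its weak solution is the unique $y\in W(0,T):=\{v\in L^2(0,T;H^1_0(\Omega)) : v'\in L^2(0,T;L^2(\Omega))\}$ satisfying $y(0)=y_0$ and $$\int_0^T (y',v)+a[y,v]\,dt=\int_0^T(u,v)\,dt\quad\text{for all } v\in L^2(0,T;H^1_0(\Omega)).$$ *)

theory Defs
  imports "HOL-Analysis.Analysis"
begin

text \<open>
  Functions on \<open>\<Omega>\<close> are represented by functions on the whole type that matter only
  up to null sets inside \<open>\<Omega>\<close>: the spaces below consist of representatives, and their
  ``norms'' are seminorms whose null elements are the representatives of zero.
\<close>

text \<open>
  Near every boundary point \<open>p\<close>, \<open>\<Omega>\<close> is the set lying above the graph of a Lipschitz
  function over a hyperplane \<open>e\<^sup>\<bottom>\<close>. The point \<open>x - (x \<bullet> e) *\<^sub>R e\<close> is the orthogonal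
  projection of \<open>x\<close> to that hyperplane. That \<open>frontier \<Omega>\<close> is locally the graph itself is
  a consequence.
\<close>

definition bounded_lipschitz_domain :: "'a::euclidean_space set \<Rightarrow> bool" where
  "bounded_lipschitz_domain \<Omega> \<longleftrightarrow>
     \<Omega> \<noteq> {} \<and> open \<Omega> \<and> connected \<Omega> \<and> bounded \<Omega> \<and>
     (\<forall>p\<in>frontier \<Omega>. \<exists>e L (\<gamma> :: 'a \<Rightarrow> real) U.
        norm e = 1 \<and> L-lipschitz_on UNIV \<gamma> \<and> open U \<and> p \<in> U \<and>
        \<Omega> \<inter> U = {x \<in> U. x \<bullet> e > \<gamma> (x - (x \<bullet> e) *\<^sub>R e)})"

primrec C_k :: "nat \<Rightarrow> ('a::euclidean_space \<Rightarrow> real) \<Rightarrow> bool" where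
  "C_k 0 f \<longleftrightarrow> continuous_on UNIV f"
| "C_k (Suc k) f \<longleftrightarrow> (\<forall>x. f differentiable (at x)) \<and>
     (\<forall>b\<in>Basis. C_k k (\<lambda>x. frechet_derivative f (at x) b))"

definition test_functions :: "'a::euclidean_space set \<Rightarrow> ('a \<Rightarrow> real) set" where
  "test_functions \<Omega> = {\<phi>. (\<forall>k. C_k k \<phi>) \<and>
     compact (closure {x. \<phi> x \<noteq> 0}) \<and> closure {x. \<phi> x \<noteq> 0} \<subseteq> \<Omega>}"

definition L2 :: "'a::euclidean_space set \<Rightarrow> ('a \<Rightarrow> real) set" where
  "L2 \<Omega> = {f \<in> borel_measurable (lebesgue_on \<Omega>). integrable (lebesgue_on \<Omega>) (\<lambda>x. (f x)\<^sup>2)}"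

definition L2_inner :: "'a::euclidean_space set \<Rightarrow> ('a \<Rightarrow> real) \<Rightarrow> ('a \<Rightarrow> real) \<Rightarrow> real" where
  "L2_inner \<Omega> f g = (\<integral>x. f x * g x \<partial>lebesgue_on \<Omega>)"

definition L2_norm :: "'a::euclidean_space set \<Rightarrow> ('a \<Rightarrow> real) \<Rightarrow> real" where
  "L2_norm \<Omega> f = sqrt (L2_inner \<Omega> f f)"

definition is_weak_pderiv ::
  "'a::euclidean_space set \<Rightarrow> 'a \<Rightarrow> ('a \<Rightarrow> real) \<Rightarrow> ('a \<Rightarrow> real) \<Rightarrow> bool" where
  "is_weak_pderiv \<Omega> b f g \<longleftrightarrow>
     (\<forall>\<phi>\<in>test_functions \<Omega>.
        (\<integral>x. f x * frechet_derivative \<phi> (at x) b \<partial>lebesgue_on \<Omega>)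
        = - (\<integral>x. g x * \<phi> x \<partial>lebesgue_on \<Omega>))"

text \<open>Only meaningful if a square-integrable weak derivative exists; determined up to a null set.\<close>

definition weak_pderiv :: "'a::euclidean_space set \<Rightarrow> 'a \<Rightarrow> ('a \<Rightarrow> real) \<Rightarrow> 'a \<Rightarrow> real" where
  "weak_pderiv \<Omega> b f = (SOME g. g \<in> L2 \<Omega> \<and> is_weak_pderiv \<Omega> b f g)"

definition weak_grad :: "'a::euclidean_space set \<Rightarrow> ('a \<Rightarrow> real) \<Rightarrow> 'a \<Rightarrow> 'a" where
  "weak_grad \<Omega> f x = (\<Sum>b\<in>Basis. weak_pderiv \<Omega> b f x *\<^sub>R b)"

definition weak_laplacian :: "'a::euclidean_space set \<Rightarrow> ('a \<Rightarrow> real) \<Rightarrow> 'a \<Rightarrow> real" where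
  "weak_laplacian \<Omega> f x = (\<Sum>b\<in>Basis. weak_pderiv \<Omega> b (weak_pderiv \<Omega> b f) x)"

primrec sobolev_H :: "nat \<Rightarrow> 'a::euclidean_space set \<Rightarrow> ('a \<Rightarrow> real) set" where
  "sobolev_H 0 \<Omega> = L2 \<Omega>"
| "sobolev_H (Suc k) \<Omega> =
     {f \<in> L2 \<Omega>. \<forall>b\<in>Basis. \<exists>g\<in>sobolev_H k \<Omega>. is_weak_pderiv \<Omega> b f g}"

definition form_a :: "'a::euclidean_space set \<Rightarrow> ('a \<Rightarrow> real) \<Rightarrow> ('a \<Rightarrow> real) \<Rightarrow> real" where
  "form_a \<Omega> f g = (\<integral>x. weak_grad \<Omega> f x \<bullet> weak_grad \<Omega> g x \<partial>lebesgue_on \<Omega>)"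

definition H1_norm :: "'a::euclidean_space set \<Rightarrow> ('a \<Rightarrow> real) \<Rightarrow> real" where
  "H1_norm \<Omega> f = sqrt (L2_inner \<Omega> f f + form_a \<Omega> f f)"

definition H10 :: "'a::euclidean_space set \<Rightarrow> ('a \<Rightarrow> real) set" where
  "H10 \<Omega> = {f \<in> sobolev_H 1 \<Omega>. \<exists>\<phi>. (\<forall>n. \<phi> n \<in> test_functions \<Omega>) \<and>
     (\<lambda>n::nat. H1_norm \<Omega> (\<lambda>x. f x - \<phi> n x)) \<longlonglongrightarrow> 0}"

text \<open>
  Elements of \<open>H\<^sup>-\<^sup>1\<close> are functionals of which only the restriction to \<open>H10 \<Omega>\<close> matters. The
  duality pairing of \<open>F\<close> and \<open>v\<close> is the application \<open>F v\<close>. Boundedness makes \<open>F v\<close>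
  independent of the representative \<open>v\<close>.
\<close>

definition Hm1 :: "'a::euclidean_space set \<Rightarrow> (('a \<Rightarrow> real) \<Rightarrow> real) set" where
  "Hm1 \<Omega> = {F.
     (\<forall>v\<in>H10 \<Omega>. \<forall>w\<in>H10 \<Omega>. F (\<lambda>x. v x + w x) = F v + F w) \<and>
     (\<forall>c. \<forall>v\<in>H10 \<Omega>. F (\<lambda>x. c * v x) = c * F v) \<and>
     (\<exists>K. \<forall>v\<in>H10 \<Omega>. \<bar>F v\<bar> \<le> K * H1_norm \<Omega> v)}"

definition Hm1_norm :: "'a::euclidean_space set \<Rightarrow> (('a \<Rightarrow> real) \<Rightarrow> real) \<Rightarrow> real" where
  "Hm1_norm \<Omega> F = (SUP v\<in>{v \<in> H10 \<Omega>. H1_norm \<Omega> v \<le> 1}. \<bar>F v\<bar>)"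

text \<open>
  The embedding \<open>f \<mapsto> (f, \<cdot>)\<close> of \<open>L2\<close> into \<open>H\<^sup>-\<^sup>1\<close> is \<open>L2_inner \<Omega>\<close>, partially applied.
\<close>

text \<open>
  The library's Bochner integral needs the value space to be a type, which is not possible
  for spaces depending on \<open>\<Omega>\<close>. Here the value space is a seminormed space of real functions
  on an arbitrary type, with pointwise operations. That covers the spaces above including
  \<open>H\<^sup>-\<^sup>1\<close>. The definitions follow the library's \<open>has_bochner_integral\<close>.
\<close>

record 'x fun_space =
  elems :: "('x \<Rightarrow> real) set"
  nrm :: "('x \<Rightarrow> real) \<Rightarrow> real"

definition L2_space :: "'a::euclidean_space set \<Rightarrow> 'a fun_space" where
  "L2_space \<Omega> = \<lparr> elems = L2 \<Omega>, nrm = L2_norm \<Omega> \<rparr>"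

definition H1_space :: "'a::euclidean_space set \<Rightarrow> 'a fun_space" where
  "H1_space \<Omega> = \<lparr> elems = sobolev_H 1 \<Omega>, nrm = H1_norm \<Omega> \<rparr>"

definition H10_space :: "'a::euclidean_space set \<Rightarrow> 'a fun_space" where
  "H10_space \<Omega> = \<lparr> elems = H10 \<Omega>, nrm = H1_norm \<Omega> \<rparr>"

definition Hm1_space :: "'a::euclidean_space set \<Rightarrow> ('a \<Rightarrow> real) fun_space" where
  "Hm1_space \<Omega> = \<lparr> elems = Hm1 \<Omega>, nrm = Hm1_norm \<Omega> \<rparr>"

abbreviation time_measure :: "real \<Rightarrow> real measure" where
  "time_measure T \<equiv> lebesgue_on {0<..<T}"

definition simple_valued :: "real \<Rightarrow> 'x fun_space \<Rightarrow> (real \<Rightarrow> 'x \<Rightarrow> real) \<Rightarrow> bool" where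
  "simple_valued T X s \<longleftrightarrow>
     simple_function (time_measure T) s \<and> (\<forall>t\<in>{0<..<T}. s t \<in> elems X)"

definition simple_integral :: "real \<Rightarrow> (real \<Rightarrow> 'x \<Rightarrow> real) \<Rightarrow> 'x \<Rightarrow> real" where
  "simple_integral T s =
     (\<lambda>x. \<Sum>g\<in>s ` {0<..<T}. measure lebesgue {t \<in> {0<..<T}. s t = g} * g x)"

definition strongly_measurable :: "real \<Rightarrow> 'x fun_space \<Rightarrow> (real \<Rightarrow> 'x \<Rightarrow> real) \<Rightarrow> bool" where
  "strongly_measurable T X f \<longleftrightarrow>
     (AE t in time_measure T. f t \<in> elems X) \<and>
     (\<exists>s. (\<forall>n. simple_valued T X (s n)) \<and>
        (AE t in time_measure T. (\<lambda>n::nat. nrm X (\<lambda>x. f t x - s n t x)) \<longlonglongrightarrow> 0))"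

definition has_integral_in ::
  "real \<Rightarrow> 'x fun_space \<Rightarrow> (real \<Rightarrow> 'x \<Rightarrow> real) \<Rightarrow> ('x \<Rightarrow> real) \<Rightarrow> bool" where
  "has_integral_in T X f I \<longleftrightarrow>
     strongly_measurable T X f \<and> I \<in> elems X \<and>
     (\<exists>s. (\<forall>n. simple_valued T X (s n)) \<and>
        (\<lambda>n::nat. \<integral>\<^sup>+t. ennreal (nrm X (\<lambda>x. f t x - s n t x)) \<partial>time_measure T) \<longlonglongrightarrow> 0 \<and>
        (\<lambda>n. nrm X (\<lambda>x. simple_integral T (s n) x - I x)) \<longlonglongrightarrow> 0)"

definition L2_Bochner :: "real \<Rightarrow> 'x fun_space \<Rightarrow> (real \<Rightarrow> 'x \<Rightarrow> real) set" where
  "L2_Bochner T X = {f. strongly_measurable T X f \<and>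
     integrable (time_measure T) (\<lambda>t. (nrm X (f t))\<^sup>2)}"

definition L2_Bochner_norm :: "real \<Rightarrow> 'x fun_space \<Rightarrow> (real \<Rightarrow> 'x \<Rightarrow> real) \<Rightarrow> real" where
  "L2_Bochner_norm T X f = sqrt (\<integral>t. (nrm X (f t))\<^sup>2 \<partial>time_measure T)"

definition is_time_deriv ::
  "real \<Rightarrow> 'x fun_space \<Rightarrow> (real \<Rightarrow> 'x \<Rightarrow> real) \<Rightarrow> (real \<Rightarrow> 'x \<Rightarrow> real) \<Rightarrow> bool" where
  "is_time_deriv T X v w \<longleftrightarrow>
     v \<in> L2_Bochner T X \<and> w \<in> L2_Bochner T X \<and>
     (\<forall>\<phi>\<in>test_functions {0<..<T}. \<exists>I.
        has_integral_in T X (\<lambda>t x. deriv \<phi> t * v t x) I \<and>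
        has_integral_in T X (\<lambda>t x. \<phi> t * w t x) (\<lambda>x. - I x))"

definition time_deriv ::
  "real \<Rightarrow> 'x fun_space \<Rightarrow> (real \<Rightarrow> 'x \<Rightarrow> real) \<Rightarrow> real \<Rightarrow> 'x \<Rightarrow> real" where
  "time_deriv T X v = (SOME w. is_time_deriv T X v w)"

definition H1_Bochner :: "real \<Rightarrow> 'x fun_space \<Rightarrow> (real \<Rightarrow> 'x \<Rightarrow> real) set" where
  "H1_Bochner T X = {v \<in> L2_Bochner T X. \<exists>w. is_time_deriv T X v w}"

definition H1_Bochner_norm :: "real \<Rightarrow> 'x fun_space \<Rightarrow> (real \<Rightarrow> 'x \<Rightarrow> real) \<Rightarrow> real" where
  "H1_Bochner_norm T X v =
     sqrt ((L2_Bochner_norm T X v)\<^sup>2 + (L2_Bochner_norm T X (time_deriv T X v))\<^sup>2)"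

text \<open>
  \<open>v(0) = v0\<close>, where \<open>v\<close> is only given almost everywhere: the initial value is that of the
  representative of \<open>v\<close> in \<open>C([0,T];X)\<close>.
\<close>

definition has_initial_value ::
  "real \<Rightarrow> 'x fun_space \<Rightarrow> (real \<Rightarrow> 'x \<Rightarrow> real) \<Rightarrow> ('x \<Rightarrow> real) \<Rightarrow> bool" where
  "has_initial_value T X v v0 \<longleftrightarrow>
     (\<exists>w. (\<forall>t\<in>{0..T}. w t \<in> elems X \<and>
             ((\<lambda>s. nrm X (\<lambda>x. w s x - w t x)) \<longlongrightarrow> 0) (at t within {0..T})) \<and>
          (AE t in time_measure T. nrm X (\<lambda>x. v t x - w t x) = 0) \<and>
          nrm X (\<lambda>x. w 0 x - v0 x) = 0)"

definition U_hat ::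
  "'a::euclidean_space set \<Rightarrow> real \<Rightarrow> real \<Rightarrow> ('a \<Rightarrow> real) \<Rightarrow> (real \<Rightarrow> 'a \<Rightarrow> real) set" where
  "U_hat \<Omega> T M ubar =
     {u \<in> H1_Bochner T (H1_space \<Omega>). H1_Bochner_norm T (H1_space \<Omega>) u \<le> M \<and>
        has_initial_value T (H1_space \<Omega>) u ubar}"

text \<open>
  \<open>dy\<close> and \<open>ddy\<close> are \<open>y'\<close> and \<open>y''\<close>. The initial conditions are understood
  in the spaces \<open>C([0,T];L\<^sup>2)\<close> and \<open>C([0,T];H\<^sup>-\<^sup>1)\<close>, into which \<open>y\<close> and \<open>y'\<close> embed.
\<close>

definition cattaneo_weak_solution ::
  "'a::euclidean_space set \<Rightarrow> real \<Rightarrow> real \<Rightarrow> (real \<Rightarrow> 'a \<Rightarrow> real) \<Rightarrow> ('a \<Rightarrow> real) \<Rightarrow> ('a \<Rightarrow> real)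
     \<Rightarrow> (real \<Rightarrow> 'a \<Rightarrow> real) \<Rightarrow> bool" where
  "cattaneo_weak_solution \<Omega> T \<tau> u y0 y1 y \<longleftrightarrow>
     y \<in> L2_Bochner T (H10_space \<Omega>) \<and>
     (\<exists>dy ddy.
        is_time_deriv T (L2_space \<Omega>) y dy \<and>
        is_time_deriv T (Hm1_space \<Omega>) (\<lambda>t. L2_inner \<Omega> (dy t)) ddy \<and>
        has_initial_value T (L2_space \<Omega>) y y0 \<and>
        has_initial_value T (Hm1_space \<Omega>) (\<lambda>t. L2_inner \<Omega> (dy t)) (L2_inner \<Omega> y1) \<and>
        (\<forall>v\<in>L2_Bochner T (H10_space \<Omega>).
           (\<integral>t. \<tau> * ddy t (v t) + L2_inner \<Omega> (dy t) (v t) + form_a \<Omega> (y t) (v t) \<partial>time_measure T)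
           = (\<integral>t. L2_inner \<Omega> (u t) (v t) \<partial>time_measure T)))"

definition heat_weak_solution ::
  "'a::euclidean_space set \<Rightarrow> real \<Rightarrow> (real \<Rightarrow> 'a \<Rightarrow> real) \<Rightarrow> ('a \<Rightarrow> real)
     \<Rightarrow> (real \<Rightarrow> 'a \<Rightarrow> real) \<Rightarrow> bool" where
  "heat_weak_solution \<Omega> T u y0 y \<longleftrightarrow>
     y \<in> L2_Bochner T (H10_space \<Omega>) \<and>
     (\<exists>dy.
        is_time_deriv T (L2_space \<Omega>) y dy \<and>
        has_initial_value T (L2_space \<Omega>) y y0 \<and>
        (\<forall>v\<in>L2_Bochner T (H10_space \<Omega>).
           (\<integral>t. L2_inner \<Omega> (dy t) (v t) + form_a \<Omega> (y t) (v t) \<partial>time_measure T)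
           = (\<integral>t. L2_inner \<Omega> (u t) (v t) \<partial>time_measure T)))"

end

theory Submission
  imports Defs
begin

text \<open>
  Write \<open>A\<close> for the operator of the form \<open>form_a\<close>, \<open>V\<close> for \<open>H10 \<Omega>\<close> and \<open>H\<close> for \<open>L2 \<Omega>\<close>. The
  difference \<open>\<zeta> = y\<^sub>\<tau> - y\<close> of the states solves the damped wave equation
  \<open>\<tau> \<zeta>'' + \<zeta>' + A \<zeta> = (u\<^sub>\<tau> - u) - \<tau> y''\<close> with \<open>\<zeta>(0) = 0\<close> and \<open>\<zeta>'(0) = 0\<close>, since the
  condition \<open>y1 = \<Delta> y0 + ubar\<close> says that \<open>y1\<close> is the initial slope \<open>y'(0)\<close> of the heat equation.
  Testing with \<open>\<zeta>'\<close>, the damping absorbs the right-hand side, and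
  \<open>\<parallel>\<zeta>(t)\<parallel>\<^sub>V \<le> C (\<parallel>u\<^sub>\<tau> - u\<parallel> + \<tau> \<parallel>y''\<parallel>)\<close> with norms of \<open>L\<^sup>2(0,T;H)\<close> and with \<open>C\<close> independent
  of \<open>\<tau>\<close>. Finally \<open>y''\<close> lies in \<open>L\<^sup>2(0,T;H)\<close>: the function \<open>y'\<close> solves the heat equation with
  right-hand side \<open>u'\<close> and initial value \<open>y1 \<in> V\<close>, and this can be tested with \<open>y''\<close>. Both claims
  follow (\<open>state_error_estimate\<close>).

  The test functions \<open>\<zeta>'\<close> and \<open>y''\<close> are not \<open>V\<close>-valued, so the estimates are made for mollified
  functions. The kernel only looks back in time, so that the terminal time causes no trouble. At
  the initial time all functions are extended by 0, after \<open>y0 + t y1\<close> has been subtracted; that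
  the weak equations survive this extension is what the initial conditions mean
  (\<open>weak_deriv_initial\<close>). Neither vector-valued integrals nor the completeness of \<open>V\<close> is used: the
  functions are approximated in \<open>L\<^sup>1(0,T;V)\<close> by simple functions, whose mollifications are finite
  sums of elements of \<open>V\<close> with smooth coefficients. They satisfy the mollified equations up to a
  residual that vanishes with the \<open>L\<^sup>1\<close> distance for a fixed kernel. So the two energy estimates
  (\<open>second_derivative_energy\<close>, \<open>damped_wave_energy\<close>) are calculus with real functions, and the
  bounds are uniform in the kernel width \<open>h\<close>, which finally tends to 0 (\<open>state_le_bound\<close>).

  On the side of \<open>\<Omega>\<close>, the form \<open>form_a\<close> must be shown to be bilinear although \<open>weak_pderiv\<close> is an
  arbitrary choice; this needs the uniqueness of weak derivatives (\<open>fundamental_lemma\<close>). Test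
  functions must be recognized as members of \<open>H\<^sup>1\<close> (\<open>integral_derivative_zero\<close>), without which
  \<open>H10 \<Omega>\<close> is not even known to be a vector space.
\<close>

section \<open>Smooth functions\<close>

definition smooth :: "('a::euclidean_space \<Rightarrow> real) \<Rightarrow> bool" where
  "smooth f \<longleftrightarrow> (\<forall>k. C_k k f)"

lemma C_k_Suc_I:
  assumes "\<And>x. (f has_derivative f' x) (at x)" "\<And>b. b \<in> Basis \<Longrightarrow> C_k k (\<lambda>x. f' x b)"
  shows "C_k (Suc k) f"
proof -
  have "frechet_derivative f (at x) = f' x" for x
    using frechet_derivative_at[OF assms(1)[of x]] by simp
  with assms show ?thesis by (auto simp: differentiable_def)
qed

lemma C_k_has_derivative:
  assumes "C_k (Suc k) f"
  shows "(f has_derivative frechet_derivative f (at x)) (at x)"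
  using assms by (simp add: frechet_derivative_works)

lemma C_k_continuous:
  assumes "C_k k f" shows "continuous_on UNIV f"
  using assms
  by (cases k) (auto intro!: differentiable_imp_continuous_on simp: differentiable_on_def)

lemma C_k_Suc_D: "C_k (Suc k) f \<Longrightarrow> C_k k f"
proof (induction k arbitrary: f)
  case 0
  then show ?case using C_k_continuous[OF 0] by simp
next
  case (Suc k)
  then show ?case unfolding C_k.simps(2)[of "Suc k"] C_k.simps(2)[of k] by blast
qed

lemma C_k_const: "C_k k (\<lambda>x. c)"
proof (induction k arbitrary: c)
  case (Suc k)
  show ?case by (rule C_k_Suc_I[where f' = "\<lambda>x h. 0"]) (auto intro: Suc)
qed simp

lemma C_k_add: "C_k k f \<Longrightarrow> C_k k g \<Longrightarrow> C_k k (\<lambda>x. f x + g x)"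
proof (induction k arbitrary: f g)
  case (Suc k)
  show ?case
    by (rule C_k_Suc_I[OF has_derivative_add[OF C_k_has_derivative[OF Suc.prems(1)]
            C_k_has_derivative[OF Suc.prems(2)]]])
       (use Suc in auto)
qed (auto intro: continuous_intros)

lemma C_k_mult: "C_k k f \<Longrightarrow> C_k k g \<Longrightarrow> C_k k (\<lambda>x. f x * g x)"
proof (induction k arbitrary: f g)
  case (Suc k)
  show ?case
  proof (rule C_k_Suc_I[OF has_derivative_mult[OF C_k_has_derivative[OF Suc.prems(1)]
            C_k_has_derivative[OF Suc.prems(2)]]])
    fix b :: 'a assume b: "b \<in> Basis"
    show "C_k k (\<lambda>x. f x * frechet_derivative g (at x) b + frechet_derivative f (at x) b * g x)"
      by (intro C_k_add Suc.IH C_k_Suc_D[OF Suc.prems(1)] C_k_Suc_D[OF Suc.prems(2)])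
         (use Suc.prems b in auto)
  qed
qed (auto intro: continuous_intros)

lemma C_k_prod: "finite I \<Longrightarrow> (\<And>i. i \<in> I \<Longrightarrow> C_k k (f i)) \<Longrightarrow> C_k k (\<lambda>x. \<Prod>i\<in>I. f i x)"
  by (induction I rule: finite_induct) (auto intro: C_k_const C_k_mult)

lemma C_k_real_Suc:
  fixes f :: "real \<Rightarrow> real"
  shows "C_k (Suc k) f \<longleftrightarrow> (\<forall>x. (f has_real_derivative deriv f x) (at x)) \<and> C_k k (deriv f)"
proof -
  have *: "f differentiable at x \<longleftrightarrow> (f has_real_derivative deriv f x) (at x)" for x
    by (metis DERIV_deriv_iff_real_differentiable)
  have 1: "frechet_derivative f (at x) 1 = deriv f x" if "f differentiable at x" for x
    using that * frechet_derivative_at[of f "(*) (deriv f x)" x]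
    by (auto simp: has_field_derivative_def dest: sym fun_cong[of _ _ 1])
  show ?thesis
  proof (cases "\<forall>x. f differentiable at x")
    case True
    then have "(\<lambda>x. frechet_derivative f (at x) 1) = deriv f" using 1 by blast
    with True show ?thesis using * by simp
  next
    case False
    then show ?thesis using * by auto
  qed
qed

lemma C_k_real_Suc_I:
  fixes f :: "real \<Rightarrow> real"
  assumes "\<And>x. (f has_real_derivative f' x) (at x)" "C_k k f'"
  shows "C_k (Suc k) f"
proof -
  have "deriv f = f'" using assms(1) DERIV_imp_deriv by blast
  then show ?thesis using assms by (simp only: C_k_real_Suc) auto
qed

lemma C_k_inverse:
  fixes f :: "real \<Rightarrow> real"
  shows "C_k k f \<Longrightarrow> (\<And>x. f x \<noteq> 0) \<Longrightarrow> C_k k (\<lambda>x. inverse (f x))"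
proof (induction k arbitrary: f)
  case (Suc k)
  have d: "(f has_real_derivative deriv f x) (at x)" for x using Suc.prems C_k_real_Suc by blast
  show ?case
  proof (rule C_k_real_Suc_I)
    show "((\<lambda>x. inverse (f x)) has_real_derivative ((-1) * deriv f x) * (inverse (f x) * inverse (f x))) (at x)" for x
      using DERIV_inverse_fun[OF d Suc.prems(2), of x] by (simp add: algebra_simps numeral_2_eq_2)
    show "C_k k (\<lambda>x. ((-1) * deriv f x) * (inverse (f x) * inverse (f x)))"
      using Suc.prems by (intro C_k_mult C_k_const Suc.IH C_k_Suc_D[OF Suc.prems(1)]) (auto simp only: C_k_real_Suc)
  qed
qed (auto intro: continuous_intros)

lemma C_k_compose_inner:
  fixes \<psi> :: "real \<Rightarrow> real" and b :: "'a::euclidean_space"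
  shows "C_k k \<psi> \<Longrightarrow> C_k k (\<lambda>x. \<psi> (x \<bullet> b + c))"
proof (induction k arbitrary: \<psi>)
  case 0
  then show ?case by (auto intro!: continuous_on_compose2[of UNIV \<psi>] continuous_intros)
next
  case (Suc k)
  have d: "(\<psi> has_real_derivative deriv \<psi> x) (at x)" for x using Suc.prems C_k_real_Suc by blast
  show ?case
  proof (rule C_k_Suc_I)
    show "((\<lambda>x. \<psi> (x \<bullet> b + c)) has_derivative (\<lambda>h. deriv \<psi> (x \<bullet> b + c) * (h \<bullet> b))) (at x)" for x
      by (rule has_derivative_eq_rhs[OF has_derivative_compose[of "\<lambda>x. x \<bullet> b + c", OF _ d[unfolded has_field_derivative_def]]])
         (auto intro!: derivative_eq_intros)
    show "C_k k (\<lambda>x. deriv \<psi> (x \<bullet> b + c) * (e \<bullet> b))" for e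
      using Suc.prems by (intro C_k_mult C_k_const Suc.IH) (auto simp only: C_k_real_Suc)
  qed
qed

lemma smooth_const: "smooth (\<lambda>x. c)"
  and smooth_add: "smooth f \<Longrightarrow> smooth g \<Longrightarrow> smooth (\<lambda>x. f x + g x)"
  and smooth_mult: "smooth f \<Longrightarrow> smooth g \<Longrightarrow> smooth (\<lambda>x. f x * g x)"
  and smooth_prod: "finite I \<Longrightarrow> (\<And>i. i \<in> I \<Longrightarrow> smooth (F i)) \<Longrightarrow> smooth (\<lambda>x. \<Prod>i\<in>I. F i x)"
  and smooth_continuous: "smooth f \<Longrightarrow> continuous_on UNIV f"
  and smooth_compose_inner: "smooth \<psi> \<Longrightarrow> smooth (\<lambda>x. \<psi> (x \<bullet> b + c))"
  by (auto simp: smooth_def intro: C_k_const C_k_add C_k_mult C_k_prod C_k_compose_inner C_k_continuous)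

lemma smooth_affine:
  fixes \<psi> :: "real \<Rightarrow> real"
  assumes "smooth \<psi>" shows "smooth (\<lambda>x::real. \<psi> (a * x + c))"
  using smooth_compose_inner[OF assms, of a c] by (simp add: mult.commute)

lemma smooth_deriv:
  fixes f :: "real \<Rightarrow> real"
  assumes "smooth f"
  shows "(f has_real_derivative deriv f x) (at x)" "smooth (deriv f)"
  using assms C_k_real_Suc unfolding smooth_def by blast+

lemma smooth_has_derivative:
  assumes "smooth f"
  shows "(f has_derivative frechet_derivative f (at x)) (at x)"
    and "b \<in> Basis \<Longrightarrow> smooth (\<lambda>x. frechet_derivative f (at x) b)"
  using assms C_k_has_derivative unfolding smooth_def by (blast, metis C_k.simps(2))

subsection \<open>A smooth step\<close>

text \<open>For \<open>n = 0\<close> this is the standard function that is smooth but not analytic at 0. The factor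
  \<open>x\<^sup>-\<^sup>n\<close> makes the family closed under differentiation up to linear combinations.\<close>

definition flat_exp :: "nat \<Rightarrow> real \<Rightarrow> real" where
  "flat_exp n x = (if x > 0 then inverse x ^ n * exp (- inverse x) else 0)"

lemma flat_exp_tendsto_0: "((\<lambda>x. flat_exp n x) \<longlongrightarrow> 0) (at_right 0)"
proof -
  have "((\<lambda>x::real. inverse x ^ n / exp (inverse x)) \<longlongrightarrow> 0) (at_right 0)"
    by (rule filterlim_compose[OF tendsto_power_div_exp_0 filterlim_inverse_at_top_right])
  then show ?thesis
    by (rule Lim_transform_eventually)
       (auto simp: eventually_at_right_less flat_exp_def exp_minus field_simps eventually_at_filter)
qed

lemma flat_exp_deriv:
  "(flat_exp n has_real_derivative (- real n) * flat_exp (Suc n) x + flat_exp (n + 2) x) (at x)"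
proof -
  consider "x < 0" | "x = 0" | "x > 0" by linarith
  then show ?thesis
  proof cases
    case 1
    have "((\<lambda>x::real. 0) has_real_derivative 0) (at x)" by simp
    then have "(flat_exp n has_real_derivative 0) (at x)"
      by (rule DERIV_cong_ev[OF refl _ refl, THEN iffD1, rotated])
         (use 1 in \<open>auto simp: flat_exp_def eventually_nhds intro!: exI[of _ "{..<0}"]\<close>)
    then show ?thesis using 1 by (simp add: flat_exp_def)
  next
    case 2
    have "((\<lambda>h. flat_exp n h / h) \<longlongrightarrow> 0) (at 0)"
    proof (rule filterlim_split_at_real)
      show "((\<lambda>h. flat_exp n h / h) \<longlongrightarrow> 0) (at_left 0)"
        by (rule Lim_transform_eventually[of "\<lambda>_. 0"]) (auto simp: flat_exp_def eventually_at_filter)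
      show "((\<lambda>h. flat_exp n h / h) \<longlongrightarrow> 0) (at_right 0)"
        by (rule Lim_transform_eventually[OF flat_exp_tendsto_0[of "Suc n"]])
           (auto simp: flat_exp_def eventually_at_filter field_simps)
    qed
    then have "(flat_exp n has_real_derivative 0) (at 0)"
      by (simp add: DERIV_def flat_exp_def)
    then show ?thesis using 2 by (simp add: flat_exp_def)
  next
    case 3
    have "((\<lambda>x. inverse x ^ n * exp (- inverse x)) has_real_derivative
        (- real n) * flat_exp (Suc n) x + flat_exp (n + 2) x) (at x)"
      using 3
      by (auto intro!: derivative_eq_intros simp: flat_exp_def algebra_simps power2_eq_square)
         (cases n; simp add: algebra_simps power2_eq_square)
    then show ?thesis
      by (rule DERIV_cong_ev[OF refl _ refl, THEN iffD1, rotated])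
         (use 3 in \<open>auto simp: flat_exp_def eventually_nhds intro!: exI[of _ "{0<..}"]\<close>)
  qed
qed

lemma smooth_flat_exp: "smooth (flat_exp n)"
proof -
  have "C_k k (flat_exp n)" for k
  proof (induction k arbitrary: n)
    case 0
    have "isCont (flat_exp n) x" for x by (rule DERIV_isCont[OF flat_exp_deriv])
    then show ?case by (simp add: continuous_at_imp_continuous_on)
  next
    case (Suc k)
    show ?case by (rule C_k_real_Suc_I[OF flat_exp_deriv]) (intro C_k_add C_k_mult C_k_const Suc)
  qed
  then show ?thesis by (simp add: smooth_def)
qed

lemma flat_exp_nonneg: "flat_exp n x \<ge> 0" by (simp add: flat_exp_def)

definition smooth_step :: "real \<Rightarrow> real" where
  "smooth_step x = flat_exp 0 x * inverse (flat_exp 0 x + flat_exp 0 (1 - x))"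

lemma smooth_step_denom: "flat_exp 0 x + flat_exp 0 (1 - x) > 0"
  by (auto simp: flat_exp_def add_pos_pos)

lemma smooth_smooth_step: "smooth smooth_step"
proof -
  have "smooth (\<lambda>x. flat_exp 0 (1 - x))" using smooth_affine[OF smooth_flat_exp, of 0 "-1" 1] by simp
  then have "smooth (\<lambda>x. flat_exp 0 x + flat_exp 0 (1 - x))"
    by (intro smooth_add smooth_flat_exp)
  then have "smooth (\<lambda>x. inverse (flat_exp 0 x + flat_exp 0 (1 - x)))"
    unfolding smooth_def by (intro allI C_k_inverse) (use smooth_step_denom in \<open>auto simp: less_imp_neq[symmetric, OF smooth_step_denom]\<close>)
  then show ?thesis
    unfolding smooth_step_def[abs_def] by (intro smooth_mult smooth_flat_exp)
qed

lemma smooth_step_0: "x \<le> 0 \<Longrightarrow> smooth_step x = 0"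
  and smooth_step_1: "x \<ge> 1 \<Longrightarrow> smooth_step x = 1"
  by (auto simp: smooth_step_def flat_exp_def)

lemma smooth_step_range: "0 \<le> smooth_step x" "smooth_step x \<le> 1"
proof -
  have "smooth_step x = flat_exp 0 x / (flat_exp 0 x + flat_exp 0 (1 - x))"
    by (simp add: smooth_step_def field_simps)
  then show "0 \<le> smooth_step x" "smooth_step x \<le> 1"
    using smooth_step_denom[of x] flat_exp_nonneg[of 0 x] flat_exp_nonneg[of 0 "1 - x"]
    by (auto simp only: divide_nonneg_pos divide_le_eq_1_pos)
qed

lemma deriv_smooth_step_nonneg: "deriv smooth_step x \<ge> 0"
proof -
  let ?f = "\<lambda>x. flat_exp 0 x" let ?f' = "\<lambda>x. flat_exp 2 x"
  let ?d = "?f x + ?f (1 - x)"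
  have d: "(flat_exp 0 has_real_derivative ?f' x) (at x)" for x using flat_exp_deriv[of 0 x] by (simp add: numeral_2_eq_2)
  have d1: "((\<lambda>x. ?f (1 - x)) has_real_derivative - ?f' (1 - x)) (at x)"
  proof -
    have "((\<lambda>x::real. 1 - x) has_real_derivative -1) (at x)" by (auto intro!: derivative_eq_intros)
    from DERIV_chain2[OF d this] show ?thesis by simp
  qed
  have "(smooth_step has_real_derivative (?f' x * ?d - ?f x * (?f' x - ?f' (1 - x))) / (?d * ?d)) (at x)"
    unfolding smooth_step_def[abs_def] divide_inverse[symmetric]
    using smooth_step_denom[of x]
      DERIV_divide[OF d[of x] DERIV_add[OF d[of x] d1]] by (simp add: algebra_simps)
  then have "deriv smooth_step x = (?f' x * ?d - ?f x * (?f' x - ?f' (1 - x))) / (?d * ?d)"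
    by (rule DERIV_imp_deriv)
  also have "\<dots> = (?f' x * ?f (1 - x) + ?f x * ?f' (1 - x)) / (?d * ?d)"
    by (simp add: algebra_simps)
  also have "\<dots> \<ge> 0" by (intro divide_nonneg_nonneg add_nonneg_nonneg mult_nonneg_nonneg flat_exp_nonneg)
  finally show ?thesis .
qed

section \<open>Semi-inner product spaces of functions\<close>

definition form_norm :: "(('x \<Rightarrow> real) \<Rightarrow> ('x \<Rightarrow> real) \<Rightarrow> real) \<Rightarrow> ('x \<Rightarrow> real) \<Rightarrow> real" where
  "form_norm B f = sqrt (B f f)"

text \<open>The value spaces depend on \<open>\<Omega>\<close> and consist of representatives. So they are carrier sets
  with pointwise operations, and nonzero elements of norm 0 are admitted.\<close>

locale semi_inner =
  fixes X :: "('x \<Rightarrow> real) set" and B :: "('x \<Rightarrow> real) \<Rightarrow> ('x \<Rightarrow> real) \<Rightarrow> real"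
  assumes zero_in: "(\<lambda>x. 0) \<in> X"
    and add_in: "f \<in> X \<Longrightarrow> g \<in> X \<Longrightarrow> (\<lambda>x. f x + g x) \<in> X"
    and scale_in: "f \<in> X \<Longrightarrow> (\<lambda>x. c * f x) \<in> X"
    and sym: "f \<in> X \<Longrightarrow> g \<in> X \<Longrightarrow> B f g = B g f"
    and add_left: "f \<in> X \<Longrightarrow> g \<in> X \<Longrightarrow> h \<in> X \<Longrightarrow> B (\<lambda>x. f x + g x) h = B f h + B g h"
    and scale_left: "f \<in> X \<Longrightarrow> h \<in> X \<Longrightarrow> B (\<lambda>x. c * f x) h = c * B f h"
    and nonneg: "f \<in> X \<Longrightarrow> B f f \<ge> 0"
begin

lemma add_right: "f \<in> X \<Longrightarrow> g \<in> X \<Longrightarrow> h \<in> X \<Longrightarrow> B h (\<lambda>x. f x + g x) = B h f + B h g"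
  using add_left[of f g h] sym add_in by metis

lemma scale_right: "f \<in> X \<Longrightarrow> h \<in> X \<Longrightarrow> B h (\<lambda>x. c * f x) = c * B h f"
  using scale_left[of f h c] sym scale_in by metis

lemma diff_in: "f \<in> X \<Longrightarrow> g \<in> X \<Longrightarrow> (\<lambda>x. f x - g x) \<in> X"
  using add_in[OF _ scale_in[of g "-1"], of f] by simp

lemma diff_left: "f \<in> X \<Longrightarrow> g \<in> X \<Longrightarrow> h \<in> X \<Longrightarrow> B (\<lambda>x. f x - g x) h = B f h - B g h"
  using add_left[OF _ scale_in[of g "-1"], of f h] scale_left[of g h "-1"] by simp

lemma diff_right: "f \<in> X \<Longrightarrow> g \<in> X \<Longrightarrow> h \<in> X \<Longrightarrow> B h (\<lambda>x. f x - g x) = B h f - B h g"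
  using diff_left[of f g h] sym diff_in by metis

lemma zero_left: "h \<in> X \<Longrightarrow> B (\<lambda>x. 0) h = 0"
  using scale_left[OF zero_in, of h 0] by simp

lemma sum_in: "finite S \<Longrightarrow> (\<And>i. i \<in> S \<Longrightarrow> F i \<in> X) \<Longrightarrow> (\<lambda>x. \<Sum>i\<in>S. c i * F i x) \<in> X"
  by (induction S rule: finite_induct) (auto intro!: zero_in add_in scale_in)

lemma sum_left:
  "finite S \<Longrightarrow> (\<And>i. i \<in> S \<Longrightarrow> F i \<in> X) \<Longrightarrow> h \<in> X \<Longrightarrow>
     B (\<lambda>x. \<Sum>i\<in>S. c i * F i x) h = (\<Sum>i\<in>S. c i * B (F i) h)"
  by (induction S rule: finite_induct) (auto simp: zero_left add_left scale_left scale_in sum_in)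

lemma norm_nonneg: "f \<in> X \<Longrightarrow> form_norm B f \<ge> 0"
  by (simp add: form_norm_def nonneg)

lemma norm_power2: "f \<in> X \<Longrightarrow> (form_norm B f)\<^sup>2 = B f f"
  by (simp add: form_norm_def nonneg)

text \<open>\<open>B(f + t g, f + t g)\<close> is nonnegative for every \<open>t\<close>; the minimizing \<open>t\<close> gives the claim. If
  \<open>B g g = 0\<close>, this is an affine function of \<open>t\<close> and must be constant.\<close>

lemma cauchy_schwarz:
  assumes f: "f \<in> X" and g: "g \<in> X"
  shows "\<bar>B f g\<bar> \<le> form_norm B f * form_norm B g"
proof -
  have q: "0 \<le> B f f + 2 * t * B f g + t\<^sup>2 * B g g" for t
  proof -
    have "0 \<le> B (\<lambda>x. f x + t * g x) (\<lambda>x. f x + t * g x)"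
      by (intro nonneg add_in scale_in f g)
    then show ?thesis
      using f g by (simp add: add_left add_right scale_left scale_right scale_in add_in sym[of g f]
          power2_eq_square algebra_simps)
  qed
  have "(B f g)\<^sup>2 \<le> B f f * B g g"
  proof (cases "B g g = 0")
    case True
    have "B f g = 0"
    proof (rule ccontr)
      assume n: "B f g \<noteq> 0"
      have "0 \<le> B f f + 2 * (- (B f f + 1) / (2 * B f g)) * B f g"
        using q[of "- (B f f + 1) / (2 * B f g)"] True by simp
      also have "2 * (- (B f f + 1) / (2 * B f g)) * B f g = - (B f f + 1)"
        using n by (simp add: field_simps)
      finally show False by simp
    qed
    then show ?thesis using True by simp
  next
    case False
    then have p: "B g g > 0" using nonneg[OF g] by simp
    have "0 \<le> (B f f + 2 * (- B f g / B g g) * B f g + (- B f g / B g g)\<^sup>2 * B g g) * B g g"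
      using q[of "- B f g / B g g"] p by (intro mult_nonneg_nonneg) auto
    also have "\<dots> = B f f * B g g - (B f g)\<^sup>2"
      using p by (simp add: field_simps power2_eq_square)
    finally show ?thesis by simp
  qed
  then have "sqrt ((B f g)\<^sup>2) \<le> sqrt (B f f * B g g)" by (rule real_sqrt_le_mono)
  then show ?thesis by (simp add: form_norm_def real_sqrt_mult)
qed

lemma norm_triangle:
  assumes f: "f \<in> X" and g: "g \<in> X"
  shows "form_norm B (\<lambda>x. f x + g x) \<le> form_norm B f + form_norm B g"
proof (rule power2_le_imp_le)
  have "(form_norm B (\<lambda>x. f x + g x))\<^sup>2 = B f f + 2 * B f g + B g g"
    using f g by (simp add: norm_power2 add_in add_left add_right sym[of g f])
  also have "\<dots> \<le> (form_norm B f + form_norm B g)\<^sup>2"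
    using cauchy_schwarz[OF f g] by (simp add: power2_sum norm_power2 f g)
  finally show "(form_norm B (\<lambda>x. f x + g x))\<^sup>2 \<le> (form_norm B f + form_norm B g)\<^sup>2" .
qed (simp add: norm_nonneg f g)

lemma norm_scale: "f \<in> X \<Longrightarrow> form_norm B (\<lambda>x. c * f x) = \<bar>c\<bar> * form_norm B f"
  by (simp add: form_norm_def scale_left scale_right scale_in real_sqrt_mult flip: mult.assoc)

lemma norm_zero: "form_norm B (\<lambda>x. 0) = 0"
  by (simp add: form_norm_def zero_left zero_in)

lemma norm_diff_commute:
  assumes "f \<in> X" "g \<in> X"
  shows "form_norm B (\<lambda>x. f x - g x) = form_norm B (\<lambda>x. g x - f x)"
  using norm_scale[OF diff_in[OF assms], of "-1"] by simp

lemma norm_diff_triangle: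
  assumes "f \<in> X" "g \<in> X" "h \<in> X"
  shows "form_norm B (\<lambda>x. f x - h x) \<le> form_norm B (\<lambda>x. f x - g x) + form_norm B (\<lambda>x. g x - h x)"
  using norm_triangle[OF diff_in[OF assms(1,2)] diff_in[OF assms(2,3)]] by simp

lemma norm_diff_le:
  assumes "f \<in> X" "g \<in> X"
  shows "form_norm B f \<le> form_norm B g + form_norm B (\<lambda>x. f x - g x)"
  using norm_triangle[OF assms(2) diff_in[OF assms]] by simp

lemma norm_sum:
  "finite S \<Longrightarrow> (\<And>i. i \<in> S \<Longrightarrow> F i \<in> X) \<Longrightarrow>
     form_norm B (\<lambda>x. \<Sum>i\<in>S. c i * F i x) \<le> (\<Sum>i\<in>S. \<bar>c i\<bar> * form_norm B (F i))"
proof (induction S rule: finite_induct)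
  case (insert i S)
  have "form_norm B (\<lambda>x. c i * F i x + (\<Sum>i\<in>S. c i * F i x))
      \<le> form_norm B (\<lambda>x. c i * F i x) + form_norm B (\<lambda>x. \<Sum>i\<in>S. c i * F i x)"
    using insert.prems insert.hyps by (intro norm_triangle scale_in sum_in) auto
  also have "\<dots> \<le> \<bar>c i\<bar> * form_norm B (F i) + (\<Sum>i\<in>S. \<bar>c i\<bar> * form_norm B (F i))"
    using insert by (simp add: norm_scale)
  finally show ?case using insert.hyps by simp
qed (simp add: norm_zero)

lemma subspace:
  assumes "Y \<subseteq> X" "(\<lambda>x. 0) \<in> Y" "\<And>f g. f \<in> Y \<Longrightarrow> g \<in> Y \<Longrightarrow> (\<lambda>x. f x + g x) \<in> Y"
    "\<And>f c. f \<in> Y \<Longrightarrow> (\<lambda>x. c * f x) \<in> Y"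
  shows "semi_inner Y B"
  by standard
    (auto intro: assms(2-4) sym add_left scale_left nonneg subsetD[OF assms(1)])

end

lemma semi_inner_sum:
  assumes "semi_inner X A" "semi_inner X B"
  shows "semi_inner X (\<lambda>f g. A f g + B f g)"
proof -
  interpret A: semi_inner X A by fact
  interpret B: semi_inner X B by fact
  show ?thesis
    by standard (auto simp: A.sym B.sym A.add_left B.add_left A.scale_left B.scale_left algebra_simps
        A.nonneg B.nonneg intro: A.zero_in A.add_in A.scale_in)
qed

section \<open>Square-integrable functions\<close>

lemma L2_mult_integrable:
  assumes "f \<in> L2 \<Omega>" "g \<in> L2 \<Omega>"
  shows "integrable (lebesgue_on \<Omega>) (\<lambda>x. f x * g x)"
proof (rule Bochner_Integration.integrable_bound)
  show "integrable (lebesgue_on \<Omega>) (\<lambda>x. (f x)\<^sup>2 + (g x)\<^sup>2)" using assms by (auto simp: L2_def)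
  show "(\<lambda>x. f x * g x) \<in> borel_measurable (lebesgue_on \<Omega>)" using assms by (auto simp: L2_def)
  have "\<bar>a * b\<bar> \<le> a\<^sup>2 + b\<^sup>2" for a b :: real
  proof -
    have "2 * \<bar>a * b\<bar> \<le> a\<^sup>2 + b\<^sup>2" using sum_squares_bound[of "\<bar>a\<bar>" "\<bar>b\<bar>"] by (simp add: abs_mult mult.assoc)
    then show ?thesis using abs_ge_zero[of "a * b"] by linarith
  qed
  then show "AE x in lebesgue_on \<Omega>. norm (f x * g x) \<le> norm ((f x)\<^sup>2 + (g x)\<^sup>2)"
    by (intro AE_I2) simp
qed

lemma semi_inner_L2: "semi_inner (L2 \<Omega>) (L2_inner \<Omega>)"
proof
  fix f g h :: "'a \<Rightarrow> real" and c :: real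
  show "(\<lambda>x. 0) \<in> L2 \<Omega>" by (simp add: L2_def)
  show "(\<lambda>x. c * f x) \<in> L2 \<Omega>" if "f \<in> L2 \<Omega>" using that by (auto simp: L2_def power_mult_distrib)
  show "(\<lambda>x. f x + g x) \<in> L2 \<Omega>" if "f \<in> L2 \<Omega>" "g \<in> L2 \<Omega>"
    using that L2_mult_integrable[OF that] by (auto simp: L2_def power2_sum mult.assoc)
  show "L2_inner \<Omega> f g = L2_inner \<Omega> g f" by (simp add: L2_inner_def mult.commute)
  show "L2_inner \<Omega> (\<lambda>x. f x + g x) h = L2_inner \<Omega> f h + L2_inner \<Omega> g h"
    if "f \<in> L2 \<Omega>" "g \<in> L2 \<Omega>" "h \<in> L2 \<Omega>"
    using that by (simp add: L2_inner_def L2_mult_integrable distrib_right)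
  show "L2_inner \<Omega> (\<lambda>x. c * f x) h = c * L2_inner \<Omega> f h" by (simp add: L2_inner_def mult.assoc)
  show "L2_inner \<Omega> f f \<ge> 0" by (simp add: L2_inner_def integral_nonneg_AE)
qed

lemma L2_inner_cong_AE:
  assumes "f \<in> L2 \<Omega>" "g \<in> L2 \<Omega>" "f' \<in> L2 \<Omega>" "g' \<in> L2 \<Omega>"
    "AE x in lebesgue_on \<Omega>. f x = f' x" "AE x in lebesgue_on \<Omega>. g x = g' x"
  shows "L2_inner \<Omega> f g = L2_inner \<Omega> f' g'"
  unfolding L2_inner_def
  using assms by (intro integral_cong_AE) (auto simp: L2_def)

section \<open>Test functions\<close>

text \<open>Test functions approximating the indicator of a box from below.\<close>

definition box_step :: "'a::euclidean_space \<Rightarrow> 'a \<Rightarrow> nat \<Rightarrow> 'a \<Rightarrow> real" where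
  "box_step a d n x = (\<Prod>b\<in>Basis. smooth_step (real n * (x \<bullet> b - a \<bullet> b)) * smooth_step (real n * (d \<bullet> b - x \<bullet> b)))"

lemma smooth_box_step: "smooth (box_step a d n)"
proof -
  have "smooth (\<lambda>x. smooth_step (real n * (x \<bullet> b - a \<bullet> b)) * smooth_step (real n * (d \<bullet> b - x \<bullet> b)))" for b
    using smooth_mult[OF smooth_compose_inner[OF smooth_smooth_step, of "real n *\<^sub>R b" "- real n * (a \<bullet> b)"]
        smooth_compose_inner[OF smooth_smooth_step, of "- real n *\<^sub>R b" "real n * (d \<bullet> b)"]]
    by (simp add: algebra_simps)
  then show ?thesis unfolding box_step_def[abs_def] by (intro smooth_prod) auto
qed

lemma box_step_zero: "x \<notin> box a d \<Longrightarrow> box_step a d n x = 0"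
proof -
  assume "x \<notin> box a d"
  then obtain b where b: "b \<in> Basis" "x \<bullet> b \<le> a \<bullet> b \<or> d \<bullet> b \<le> x \<bullet> b"
    by (auto simp: mem_box not_less)
  then have "smooth_step (real n * (x \<bullet> b - a \<bullet> b)) * smooth_step (real n * (d \<bullet> b - x \<bullet> b)) = 0"
    by (auto intro!: smooth_step_0 mult_nonneg_nonpos)
  with b(1) show ?thesis unfolding box_step_def by (intro prod_zero) auto
qed

lemma box_step_range: "0 \<le> box_step a d n x" "box_step a d n x \<le> 1"
  unfolding box_step_def using smooth_step_range
  by (auto intro!: prod_nonneg prod_le_1 mult_nonneg_nonneg mult_le_one)

lemma box_step_tendsto: "(\<lambda>n. box_step a d n x) \<longlonglongrightarrow> indicator (box a d) x"
proof (cases "x \<in> box a d")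
  case True
  have ev: "eventually (\<lambda>n. smooth_step (real n * t) = 1) sequentially" if "t > 0" for t
  proof -
    obtain N where N: "1 / t \<le> real N" using real_arch_simple by blast
    show ?thesis
      using eventually_ge_at_top[of N]
    proof eventually_elim
      case (elim n)
      then have "1 / t \<le> real n" using N by simp
      then show ?case using that by (intro smooth_step_1) (simp add: field_simps)
    qed
  qed
  have "eventually (\<lambda>n. \<forall>b\<in>Basis. smooth_step (real n * (x \<bullet> b - a \<bullet> b)) * smooth_step (real n * (d \<bullet> b - x \<bullet> b)) = 1) sequentially"
  proof (intro eventually_ball_finite finite_Basis ballI)
    fix b :: 'a assume "b \<in> Basis"
    then have "x \<bullet> b - a \<bullet> b > 0" "d \<bullet> b - x \<bullet> b > 0" using True by (auto simp: mem_box)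
    from ev[OF this(1)] ev[OF this(2)]
    show "eventually (\<lambda>n. smooth_step (real n * (x \<bullet> b - a \<bullet> b)) * smooth_step (real n * (d \<bullet> b - x \<bullet> b)) = 1) sequentially"
      by eventually_elim simp
  qed
  then have "eventually (\<lambda>n. box_step a d n x = 1) sequentially"
    by eventually_elim (simp add: box_step_def)
  then show ?thesis using True by (auto intro: tendsto_eventually)
qed (simp add: box_step_zero)

lemma test_functionsI:
  assumes "smooth \<phi>" "compact K" "K \<subseteq> \<Omega>" "\<And>x. x \<notin> K \<Longrightarrow> \<phi> x = 0"
  shows "\<phi> \<in> test_functions \<Omega>"
proof -
  have "closure {x. \<phi> x \<noteq> 0} \<subseteq> K"
    using assms(2,4) by (intro closure_minimal compact_imp_closed) auto
  moreover from this have "compact (closure {x. \<phi> x \<noteq> 0})"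
    using assms(2) by (meson bounded_subset closed_closure compact_eq_bounded_closed)
  ultimately show ?thesis using assms by (auto simp: test_functions_def smooth_def)
qed

lemma test_functionsE:
  assumes "\<phi> \<in> test_functions \<Omega>"
  obtains K where "smooth \<phi>" "compact K" "K \<subseteq> \<Omega>" "\<And>x. x \<notin> K \<Longrightarrow> \<phi> x = 0"
proof (rule that)
  show "smooth \<phi>" "compact (closure {x. \<phi> x \<noteq> 0})" "closure {x. \<phi> x \<noteq> 0} \<subseteq> \<Omega>"
    using assms unfolding test_functions_def smooth_def by blast+
  show "\<phi> x = 0" if "x \<notin> closure {x. \<phi> x \<noteq> 0}" for x
    using that closure_subset[of "{x. \<phi> x \<noteq> 0}"] by blast
qed

lemma box_step_test:
  assumes "cbox a d \<subseteq> \<Omega>" shows "box_step a d n \<in> test_functions \<Omega>"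
  by (rule test_functionsI[OF smooth_box_step compact_cbox assms])
     (use box_step_zero box_subset_cbox in blast)

lemma test_functions_add:
  assumes "\<phi> \<in> test_functions \<Omega>" "\<psi> \<in> test_functions \<Omega>"
  shows "(\<lambda>x. \<phi> x + \<psi> x) \<in> test_functions \<Omega>"
proof -
  obtain K where K: "smooth \<phi>" "compact K" "K \<subseteq> \<Omega>" "\<And>x. x \<notin> K \<Longrightarrow> \<phi> x = 0"
    using test_functionsE[OF assms(1)] by blast
  obtain L where L: "smooth \<psi>" "compact L" "L \<subseteq> \<Omega>" "\<And>x. x \<notin> L \<Longrightarrow> \<psi> x = 0"
    using test_functionsE[OF assms(2)] by blast
  show ?thesis
    by (rule test_functionsI[of _ "K \<union> L"]) (use K L in \<open>auto intro: smooth_add compact_Un\<close>)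
qed

lemma test_functions_mult:
  assumes "\<phi> \<in> test_functions \<Omega>" "smooth \<psi>"
  shows "(\<lambda>x. \<phi> x * \<psi> x) \<in> test_functions \<Omega>"
  using assms(1) by (rule test_functionsE) (auto intro!: test_functionsI smooth_mult assms(2))

lemma test_functions_scale:
  "\<phi> \<in> test_functions \<Omega> \<Longrightarrow> (\<lambda>x. c * \<phi> x) \<in> test_functions \<Omega>"
  using test_functions_mult[OF _ smooth_const[of c], of \<phi> \<Omega>] by (simp add: mult.commute)

lemma test_functions_zero: "(\<lambda>x. 0) \<in> test_functions \<Omega>"
  by (rule test_functionsI[of _ "{}"]) (auto intro: smooth_const)

lemma frechet_derivative_zero_outside:
  assumes "smooth \<phi>" "compact K" "\<And>x. x \<notin> K \<Longrightarrow> \<phi> x = 0" "x \<notin> K"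
  shows "frechet_derivative \<phi> (at x) = (\<lambda>h. 0)"
proof -
  have "open (- K)" using assms(2) by (simp add: compact_imp_closed open_Compl)
  have "(\<phi> has_derivative (\<lambda>h. 0)) (at x)"
    by (rule has_derivative_transform_within_open[of "\<lambda>x. 0" _ _ _ "- K"])
       (use assms \<open>open (- K)\<close> in auto)
  then show ?thesis by (rule frechet_derivative_at[symmetric])
qed

lemma test_functions_derivative:
  assumes "\<phi> \<in> test_functions \<Omega>" "b \<in> Basis"
  shows "(\<lambda>x. frechet_derivative \<phi> (at x) b) \<in> test_functions \<Omega>"
proof -
  obtain K where K: "smooth \<phi>" "compact K" "K \<subseteq> \<Omega>" "\<And>x. x \<notin> K \<Longrightarrow> \<phi> x = 0"
    using test_functionsE[OF assms(1)] by blast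
  show ?thesis
    by (rule test_functionsI[OF smooth_has_derivative(2)[OF K(1) assms(2)] K(2,3)])
       (simp add: frechet_derivative_zero_outside[OF K(1,2,4)])
qed

lemma test_functions_bounded:
  assumes "\<phi> \<in> test_functions \<Omega>"
  obtains C where "C \<ge> 0" "\<And>x. \<bar>\<phi> x\<bar> \<le> C"
proof -
  obtain K where K: "smooth \<phi>" "compact K" "K \<subseteq> \<Omega>" "\<And>x. x \<notin> K \<Longrightarrow> \<phi> x = 0"
    using test_functionsE[OF assms(1)] by blast
  have "bounded (\<phi> ` K)"
    using K by (intro compact_imp_bounded compact_continuous_image continuous_on_subset[OF smooth_continuous]) auto
  then obtain C where "\<And>x. x \<in> K \<Longrightarrow> \<bar>\<phi> x\<bar> \<le> C" by (auto simp: bounded_iff)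
  then have "\<bar>\<phi> x\<bar> \<le> max 0 C" for x using K(4)[of x] by (cases "x \<in> K") (auto simp: le_max_iff_disj)
  then show ?thesis using that[of "max 0 C"] by simp
qed

lemma smooth_measurable: "smooth \<phi> \<Longrightarrow> \<phi> \<in> borel_measurable (lebesgue_on \<Omega>)"
  by (intro measurable_restrict_space1 measurable_completion) (simp add: borel_measurable_continuous_onI smooth_continuous)

lemma test_functions_L2:
  assumes "\<phi> \<in> test_functions \<Omega>" "open \<Omega>"
  shows "\<phi> \<in> L2 \<Omega>"
proof -
  obtain K where K: "smooth \<phi>" "compact K" "K \<subseteq> \<Omega>" "\<And>x. x \<notin> K \<Longrightarrow> \<phi> x = 0"
    using test_functionsE[OF assms(1)] by blast
  obtain C where C: "C \<ge> 0" "\<And>x. \<bar>\<phi> x\<bar> \<le> C" using test_functions_bounded[OF assms(1)] by blast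
  have "integrable (lebesgue_on \<Omega>) (\<lambda>x. C\<^sup>2 * indicator K x :: real)"
    using K assms(2) emeasure_bounded_finite[OF compact_imp_bounded[OF K(2)]]
    by (intro integrable_mult_right integrable_real_indicator)
      (auto simp: sets_restrict_space_iff emeasure_restrict_space compact_imp_closed)
  then have "integrable (lebesgue_on \<Omega>) (\<lambda>x. (\<phi> x)\<^sup>2)"
  proof (rule Bochner_Integration.integrable_bound)
    have "(\<phi> x)\<^sup>2 \<le> C\<^sup>2" for x using power_mono[OF C(2)[of x], of 2] by simp
    then show "AE x in lebesgue_on \<Omega>. norm ((\<phi> x)\<^sup>2) \<le> norm (C\<^sup>2 * indicator K x)"
      using K(4) by (intro AE_I2) (auto simp: indicator_def)
  qed (use smooth_measurable[OF K(1)] in measurable)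
  then show ?thesis using K(1) by (simp add: L2_def smooth_measurable)
qed

section \<open>Sobolev spaces\<close>

text \<open>The integral of \<open>\<theta>\<close> does not change under translation, so the integrals of the difference
  quotients of \<open>\<theta>\<close> vanish, and the integral of the derivative is their limit.\<close>

lemma integral_derivative_zero:
  fixes \<theta> :: "'a::euclidean_space \<Rightarrow> real"
  assumes "\<theta> \<in> test_functions \<Omega>" "open \<Omega>" "b \<in> Basis"
  shows "(\<integral>x. frechet_derivative \<theta> (at x) b \<partial>lebesgue_on \<Omega>) = 0"
proof -
  obtain K where K: "smooth \<theta>" "compact K" "K \<subseteq> \<Omega>" "\<And>x. x \<notin> K \<Longrightarrow> \<theta> x = 0"
    using test_functionsE[OF assms(1)] by blast
  let ?d = "\<lambda>x. frechet_derivative \<theta> (at x) b"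
  obtain L where L: "L \<ge> 0" "\<And>x. \<bar>?d x\<bar> \<le> L"
    using test_functions_bounded[OF test_functions_derivative[OF assms(1,3)]] by blast
  obtain R where R: "R > 0" "\<And>x. x \<in> K \<Longrightarrow> norm x \<le> R"
    using compact_imp_bounded[OF K(2)] by (auto simp: bounded_pos)
  have cont: "continuous_on UNIV \<theta>" "continuous_on UNIV ?d"
    using K(1) assms(3) by (auto intro: smooth_continuous smooth_has_derivative)
  define q where "q n x = real (Suc n) * (\<theta> (x + (1 / real (Suc n)) *\<^sub>R b) - \<theta> x)" for n x
  have line: "((\<lambda>t. \<theta> (x + t *\<^sub>R b)) has_real_derivative ?d (x + t *\<^sub>R b)) (at t)" for x t
  proof -
    have "((\<lambda>t. \<theta> (x + t *\<^sub>R b)) has_derivative (\<lambda>h. frechet_derivative \<theta> (at (x + t *\<^sub>R b)) (h *\<^sub>R b))) (at t)"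
      by (rule has_derivative_compose[OF _ smooth_has_derivative(1)[OF K(1)]])
         (auto intro!: derivative_eq_intros)
    moreover have "frechet_derivative \<theta> (at (x + t *\<^sub>R b)) (h *\<^sub>R b) = ?d (x + t *\<^sub>R b) * h" for h
      using linear_cmul[OF has_derivative_linear[OF smooth_has_derivative(1)[OF K(1)]]] by simp
    ultimately show ?thesis by (simp add: has_field_derivative_def mult_commute_abs)
  qed
  have q_lim: "(\<lambda>n. q n x) \<longlonglongrightarrow> ?d x" for x
  proof -
    have "((\<lambda>h. (\<theta> (x + h *\<^sub>R b) - \<theta> x) / h) \<longlongrightarrow> ?d x) (at 0)"
      using line[of x 0] by (simp add: DERIV_def)
    moreover have "filterlim (\<lambda>n. 1 / real (Suc n)) (at 0) sequentially"
      using LIMSEQ_inverse_real_of_nat by (auto simp: filterlim_at inverse_eq_divide)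
    ultimately show ?thesis
      unfolding q_def by (rule filterlim_compose[THEN filterlim_cong[THEN iffD1, rotated -1]]) (auto simp: field_simps)
  qed
  have q_bound: "\<bar>q n x\<bar> \<le> L * indicator (cball 0 (R + 1)) x" for n x
  proof (cases "norm x \<le> R + 1")
    case True
    let ?h = "1 / real (Suc n)"
    obtain z where "\<theta> (x + ?h *\<^sub>R b) - \<theta> (x + 0 *\<^sub>R b) = (?h - 0) * ?d (x + z *\<^sub>R b)"
      using MVT2[of 0 ?h "\<lambda>t. \<theta> (x + t *\<^sub>R b)" "\<lambda>t. ?d (x + t *\<^sub>R b)"] line by auto
    then have "q n x = ?d (x + z *\<^sub>R b)" by (simp add: q_def)
    then show ?thesis using L True by simp
  next
    case False
    have "norm (x + (1 / real (Suc n)) *\<^sub>R b) \<ge> norm x - norm ((1 / real (Suc n)) *\<^sub>R b)"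
      by (metis norm_diff_ineq)
    moreover have "norm ((1 / real (Suc n)) *\<^sub>R b) \<le> 1" using assms(3) by simp
    ultimately have "norm (x + (1 / real (Suc n)) *\<^sub>R b) > R" using False by linarith
    then have "x \<notin> K" "x + (1 / real (Suc n)) *\<^sub>R b \<notin> K" using R False by (force, fastforce)
    then show ?thesis using False L K(4) by (simp add: q_def)
  qed
  have int_\<theta>: "integrable lborel \<theta>"
  proof -
    have "integrable lborel (\<lambda>x. indicator K x *\<^sub>R \<theta> x)"
      using borel_integrable_compact[OF K(2) continuous_on_subset[OF cont(1)]] by simp
    moreover have "(\<lambda>x. indicator K x *\<^sub>R \<theta> x) = \<theta>"
      by (rule ext) (use K(4) in \<open>auto simp: indicator_def\<close>)
    ultimately show ?thesis by simp
  qed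
  have q0: "(\<integral>x. q n x \<partial>lborel) = 0" for n
  proof -
    let ?c = "(1 / real (Suc n)) *\<^sub>R b"
    have m: "(+) ?c \<in> lborel \<rightarrow>\<^sub>M borel" by simp
    have \<theta>m: "\<theta> \<in> borel_measurable borel" using cont(1) by (simp add: borel_measurable_continuous_onI)
    have "integrable (distr lborel borel ((+) ?c)) \<theta>" using int_\<theta> by (simp add: lborel_distr_plus)
    then have i: "integrable lborel (\<lambda>x. \<theta> (?c + x))" by (rule integrable_distr_eq[OF m \<theta>m, THEN iffD1])
    have "(\<integral>x. \<theta> (?c + x) \<partial>lborel) = (\<integral>x. \<theta> x \<partial>distr lborel borel ((+) ?c))"
      by (rule integral_distr[OF m \<theta>m, symmetric])
    then have "(\<integral>x. \<theta> (?c + x) \<partial>lborel) = (\<integral>x. \<theta> x \<partial>lborel)" by (simp add: lborel_distr_plus)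
    then have "(\<integral>x. real (Suc n) * (\<theta> (?c + x) - \<theta> x) \<partial>lborel) = 0"
      using i int_\<theta> by (simp only: integral_mult_right_zero Bochner_Integration.integral_diff) simp
    then show ?thesis unfolding q_def by (simp only: add.commute[of _ ?c])
  qed
  have "(\<lambda>n. \<integral>x. q n x \<partial>lborel) \<longlonglongrightarrow> (\<integral>x. ?d x \<partial>lborel)"
  proof (rule integral_dominated_convergence)
    show "integrable lborel (\<lambda>x. L * indicator (cball 0 (R + 1)) x :: real)"
      using emeasure_bounded_finite[OF bounded_cball] by (intro integrable_mult_right integrable_real_indicator) auto
    show "?d \<in> borel_measurable lborel" using cont(2) by (simp add: borel_measurable_continuous_onI)
    show "q n \<in> borel_measurable lborel" for n
      unfolding q_def[abs_def]
      by (simp, intro borel_measurable_continuous_onI continuous_intros continuous_on_compose2[OF cont(1)] cont(1)) auto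
  qed (use q_lim q_bound in auto)
  then have "(\<integral>x. ?d x \<partial>lborel) = 0" by (simp only: q0 LIMSEQ_const_iff)
  moreover have "(\<integral>x. ?d x \<partial>lebesgue_on \<Omega>) = (\<integral>x. ?d x \<partial>lborel)"
  proof -
    have "(\<integral>x. ?d x \<partial>lebesgue_on \<Omega>) = (\<integral>x. indicator \<Omega> x *\<^sub>R ?d x \<partial>lebesgue)"
      using assms(2) by (subst integral_restrict_space) auto
    also have "\<dots> = (\<integral>x. ?d x \<partial>lebesgue)"
    proof (rule Bochner_Integration.integral_cong[OF refl])
      fix x
      show "indicator \<Omega> x *\<^sub>R ?d x = ?d x"
      proof (cases "x \<in> \<Omega>")
        case False
        then have "x \<notin> K" using K(3) by blast
        then show ?thesis by (simp add: frechet_derivative_zero_outside[OF K(1,2,4)])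
      qed simp
    qed
    also have "\<dots> = (\<integral>x. ?d x \<partial>lborel)"
      using cont(2) by (intro integral_completion) (simp add: borel_measurable_continuous_onI)
    finally show ?thesis .
  qed
  ultimately show ?thesis by simp
qed

text \<open>Integration by parts: the sum of the two integrands is the derivative of \<open>\<phi> \<psi>\<close>.\<close>

lemma test_function_weak_pderiv:
  assumes "\<phi> \<in> test_functions \<Omega>" "open \<Omega>" "b \<in> Basis"
  shows "is_weak_pderiv \<Omega> b \<phi> (\<lambda>x. frechet_derivative \<phi> (at x) b)"
  unfolding is_weak_pderiv_def
proof
  fix \<psi> assume \<psi>: "\<psi> \<in> test_functions \<Omega>"
  let ?p = "\<lambda>x. frechet_derivative \<phi> (at x) b" and ?s = "\<lambda>x. frechet_derivative \<psi> (at x) b"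
  have s: "smooth \<phi>" "smooth \<psi>" using assms(1) \<psi> by (auto elim: test_functionsE)
  have prod: "frechet_derivative (\<lambda>x. \<phi> x * \<psi> x) (at x) b = \<phi> x * ?s x + ?p x * \<psi> x" for x
    using frechet_derivative_at[OF has_derivative_mult[OF smooth_has_derivative(1)[OF s(1)]
          smooth_has_derivative(1)[OF s(2)]], of x, symmetric] by simp
  have T: "(\<lambda>x. \<phi> x * \<psi> x) \<in> test_functions \<Omega>" by (rule test_functions_mult[OF assms(1) s(2)])
  have "(\<integral>x. \<phi> x * ?s x + ?p x * \<psi> x \<partial>lebesgue_on \<Omega>) = 0"
    using integral_derivative_zero[OF T assms(2,3)] by (simp only: prod)
  moreover have "integrable (lebesgue_on \<Omega>) (\<lambda>x. \<phi> x * ?s x)" "integrable (lebesgue_on \<Omega>) (\<lambda>x. ?p x * \<psi> x)"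
    using assms \<psi> by (auto intro!: L2_mult_integrable test_functions_L2 test_functions_derivative)
  ultimately show "(\<integral>x. \<phi> x * ?s x \<partial>lebesgue_on \<Omega>) = - (\<integral>x. ?p x * \<psi> x \<partial>lebesgue_on \<Omega>)"
    by simp
qed

text \<open>The fundamental lemma of the calculus of variations. Test functions approximate the
  indicators of boxes, and these generate the Borel sets.\<close>

lemma fundamental_lemma:
  fixes g :: "'a::euclidean_space \<Rightarrow> real"
  assumes \<Omega>: "open \<Omega>" and g: "integrable (lebesgue_on \<Omega>) g"
    and 0: "\<And>\<phi>. \<phi> \<in> test_functions \<Omega> \<Longrightarrow> (\<integral>x. g x * \<phi> x \<partial>lebesgue_on \<Omega>) = 0"
  shows "AE x in lebesgue_on \<Omega>. g x = 0"
proof -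
  have \<Omega>m: "\<Omega> \<inter> space lebesgue \<in> sets lebesgue" using \<Omega> by auto
  define G where "G x = indicator \<Omega> x * g x" for x
  have G: "integrable lebesgue G"
    using g integrable_restrict_space[OF \<Omega>m, of g] by (simp add: G_def[abs_def])
  then have Gm [measurable]: "G \<in> borel_measurable lebesgue" by simp
  have box: "(\<integral>x. indicator (box a d) x * G x \<partial>lebesgue) = 0" if "cbox a d \<subseteq> \<Omega>" for a d
  proof -
    have "(\<lambda>n. \<integral>x. box_step a d n x * G x \<partial>lebesgue) \<longlonglongrightarrow> (\<integral>x. indicator (box a d) x * G x \<partial>lebesgue)"
    proof (rule integral_dominated_convergence)
      show "integrable lebesgue (\<lambda>x. \<bar>G x\<bar>)" using G by simp
      show "AE x in lebesgue. (\<lambda>n. box_step a d n x * G x) \<longlonglongrightarrow> indicator (box a d) x * G x"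
        by (intro AE_I2 tendsto_mult box_step_tendsto tendsto_const)
      show "AE x in lebesgue. norm (box_step a d n x * G x) \<le> \<bar>G x\<bar>" for n
        using box_step_range[of a d n] by (intro AE_I2) (auto simp: abs_mult mult_left_le_one_le)
      have "box_step a d n \<in> borel_measurable lebesgue" for n
        using smooth_measurable[OF smooth_box_step, of a d n UNIV] by (simp add: lebesgue_on_UNIV_eq)
      then show "(\<lambda>x. box_step a d n x * G x) \<in> borel_measurable lebesgue" for n by measurable
      show "(\<lambda>x. indicator (box a d) x * G x) \<in> borel_measurable lebesgue"
        by (rule borel_measurable_times[OF borel_measurable_indicator Gm]) auto
    qed
    moreover have "(\<integral>x. box_step a d n x * G x \<partial>lebesgue) = 0" for n
    proof -
      have "(\<integral>x. box_step a d n x * G x \<partial>lebesgue) = (\<integral>x. indicator \<Omega> x *\<^sub>R (g x * box_step a d n x) \<partial>lebesgue)"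
        by (intro Bochner_Integration.integral_cong) (auto simp: G_def)
      also have "\<dots> = (\<integral>x. g x * box_step a d n x \<partial>lebesgue_on \<Omega>)"
        by (rule integral_restrict_space[OF \<Omega>m, symmetric])
      finally show ?thesis using 0[OF box_step_test[OF that]] by simp
    qed
    ultimately show ?thesis by (simp add: LIMSEQ_const_iff)
  qed
  have AE_box: "AE x in lebesgue. x \<in> box c d \<longrightarrow> g x = 0" if cd: "cbox c d \<subseteq> \<Omega>" for c d
  proof -
    define F where "F x = indicator (box c d) x * G x" for x
    have F: "integrable lebesgue F"
      using integrable_mult_indicator[OF _ G, of "box c d"] by (simp add: F_def[abs_def])
    have Fm [measurable]: "F \<in> borel_measurable lebesgue" using F by simp
    have iF: "integrable lebesgue (\<lambda>x. indicator A x * F x)" if "A \<in> sets lebesgue" for A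
      using integrable_mult_indicator[OF that F] by simp
    have borel: "(\<integral>x. indicator A x * F x \<partial>lebesgue) = 0" if A: "A \<in> sets borel" for A
    proof -
      have "Int_stable (range (\<lambda>(a, b). box a b :: 'a set))"
        by (auto simp: Int_stable_def box_Int_box)
      moreover have "(range (\<lambda>(a, b). box a b :: 'a set)) \<subseteq> Pow UNIV" by auto
      moreover have "A \<in> sigma_sets UNIV (range (\<lambda>(a, b). box a b))"
        using A unfolding borel_eq_box by simp
      ultimately show ?thesis
      proof (induction rule: sigma_sets_induct_disjoint)
        case (basic A)
        then obtain a b where A: "A = box a b" by auto
        obtain e f where ef: "box a b \<inter> box c d = box e f"
          using box_Int_box by blast
        have "(\<integral>x. indicator A x * F x \<partial>lebesgue) = (\<integral>x. indicator (box e f) x * G x \<partial>lebesgue)"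
          unfolding A F_def ef[symmetric] by (intro Bochner_Integration.integral_cong) (auto simp: indicator_def)
        also have "\<dots> = 0"
        proof (cases "box e f = {}")
          case False
          then have "cbox e f = closure (box e f)" by (simp add: closure_box)
          also have "\<dots> \<subseteq> closure (box c d)" using ef by (intro closure_mono) blast
          also have "\<dots> \<subseteq> cbox c d" by (intro closure_minimal box_subset_cbox closed_cbox)
          finally show ?thesis using box cd by blast
        qed simp
        finally show ?case .
      next
        case empty
        then show ?case by simp
      next
        case (compl A)
        then have A: "A \<in> sets lebesgue" by (auto simp: borel_eq_box)
        have "(\<integral>x. F x \<partial>lebesgue) = 0" unfolding F_def by (rule box[OF cd])
        moreover have "(\<integral>x. indicator (UNIV - A) x * F x \<partial>lebesgue)
            = (\<integral>x. F x - indicator A x * F x \<partial>lebesgue)"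
          by (intro Bochner_Integration.integral_cong) (auto simp: indicator_def)
        ultimately show ?case using F iF[OF A] compl.IH by simp
      next
        case (union D)
        then have "D i \<in> sets borel" for i by (simp add: borel_eq_box subset_eq)
        then have D: "D i \<in> sets lebesgue" for i by simp
        have "(\<lambda>n. \<integral>x. (\<Sum>i<n. indicator (D i) x * F x) \<partial>lebesgue) \<longlonglongrightarrow> (\<integral>x. indicator (\<Union>(range D)) x * F x \<partial>lebesgue)"
        proof (rule integral_dominated_convergence)
          show "integrable lebesgue (\<lambda>x. \<bar>F x\<bar>)" using F by simp
          have eq: "(\<Sum>i<n. indicator (D i) x * F x) = indicator (\<Union>i<n. D i) x * F x" for n x
          proof -
            have "disjoint_family_on D {..<n}" using union(1) by (auto simp: disjoint_family_on_def)
            then have "indicator (\<Union>i<n. D i) x = (\<Sum>i<n. indicator (D i) x :: real)"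
              by (intro indicator_UN_disjoint) auto
            then show ?thesis by (simp add: sum_distrib_right)
          qed
          show "AE x in lebesgue. (\<lambda>n. \<Sum>i<n. indicator (D i) x * F x) \<longlonglongrightarrow> indicator (\<Union>(range D)) x * F x"
            unfolding eq by (intro AE_I2 tendsto_mult tendsto_const LIMSEQ_indicator_UN)
          show "AE x in lebesgue. norm (\<Sum>i<n. indicator (D i) x * F x) \<le> \<bar>F x\<bar>" for n
            unfolding eq by (intro AE_I2) (auto simp: indicator_def)
          show "(\<lambda>x. indicator (\<Union>(range D)) x * F x) \<in> borel_measurable lebesgue"
            using D by measurable
          show "(\<lambda>x. \<Sum>i<n. indicator (D i) x * F x) \<in> borel_measurable lebesgue" for n
            using D by measurable
        qed
        moreover have "(\<integral>x. (\<Sum>i<n. indicator (D i) x * F x) \<partial>lebesgue) = 0" for n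
          by (subst Bochner_Integration.integral_sum) (use iF[OF D] union.IH in auto)
        ultimately show ?case by (simp add: LIMSEQ_const_iff)
      qed
    qed
    have null: "(\<integral>x. indicator A x * F x \<partial>lebesgue) = 0" if A: "A \<in> sets lebesgue" for A
    proof -
      have "(\<integral>x. indicator A x * F x \<partial>lebesgue) = (\<integral>x. indicator (main_part lborel A) x * F x \<partial>lebesgue)"
      proof (rule integral_cong_AE)
        have "AE x in lebesgue. x \<in> A \<longleftrightarrow> x \<in> main_part lborel A"
        proof -
          obtain N where N: "null_part lborel A \<subseteq> N" "N \<in> null_sets lborel"
            using null_part[OF A] by blast
          then have "AE x in lebesgue. x \<notin> N" by (intro AE_completion AE_not_in)
          then show ?thesis by eventually_elim (use N main_part_null_part_Un[OF A] in blast)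
        qed
        then show "AE x in lebesgue. indicator A x * F x = indicator (main_part lborel A) x * F x"
          by eventually_elim (auto simp: indicator_def)
        have "main_part lborel A \<in> sets lebesgue" using main_part_sets[OF A] by auto
        then show "(\<lambda>x. indicator (main_part lborel A) x * F x) \<in> borel_measurable lebesgue" by measurable
        show "(\<lambda>x. indicator A x * F x) \<in> borel_measurable lebesgue" using A by measurable
      qed
      then show ?thesis using borel main_part_sets[OF A] by simp
    qed
    have Cm: "box c d \<inter> space lebesgue \<in> sets lebesgue" by auto
    interpret finite_measure "lebesgue_on (box c d)" by (rule finite_measure_lebesgue_on) simp
    have "integrable lebesgue (\<lambda>x. indicator (box c d) x *\<^sub>R F x)" using iF[of "box c d"] by simp
    then have "integrable (lebesgue_on (box c d)) F"
      using integrable_restrict_space[OF Cm, of F] by blast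
    then have "AE x in lebesgue_on (box c d). F x = 0"
    proof (rule density_zero)
      fix A assume A: "A \<in> sets (lebesgue_on (box c d))"
      then have A': "A \<in> sets lebesgue" "A \<subseteq> box c d" by (auto simp: sets_restrict_space_iff)
      have "set_lebesgue_integral (lebesgue_on (box c d)) A F
          = (\<integral>x. indicator (box c d) x *\<^sub>R (indicator A x *\<^sub>R F x) \<partial>lebesgue)"
        unfolding set_lebesgue_integral_def by (rule integral_restrict_space[OF Cm])
      also have "\<dots> = (\<integral>x. indicator A x * F x \<partial>lebesgue)"
        using A'(2) by (intro Bochner_Integration.integral_cong) (auto simp: indicator_def)
      finally show "set_lebesgue_integral (lebesgue_on (box c d)) A F = 0" using null[OF A'(1)] by simp
    qed
    then have "AE x in lebesgue. x \<in> box c d \<longrightarrow> F x = 0" using Cm by (simp add: AE_restrict_space_iff)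
    then show ?thesis
      by eventually_elim (use cd box_subset_cbox[of c d] in \<open>auto simp: F_def G_def indicator_def split: if_splits\<close>)
  qed
  \<comment> \<open>\<open>\<Omega>\<close> is a countable union of closed boxes, and the faces of a box form a null set.\<close>
  obtain \<D> where \<D>: "countable \<D>" "\<D> \<subseteq> Pow \<Omega>" "\<And>X. X \<in> \<D> \<Longrightarrow> \<exists>a b. X = cbox a b" "\<Union>\<D> = \<Omega>"
    using open_countable_Union_open_cbox[OF \<Omega>] by blast
  have "AE x in lebesgue. x \<in> X \<longrightarrow> g x = 0" if XD: "X \<in> \<D>" for X
  proof -
    obtain a b where X: "X = cbox a b" using \<D>(3)[OF XD] by blast
    have "cbox a b - box a b \<in> null_sets lebesgue"
      using negligible_frontier_interval negligible_iff_null_sets by blast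
    then have "AE x in lebesgue. x \<notin> cbox a b - box a b" by (rule AE_not_in)
    moreover have "AE x in lebesgue. x \<in> box a b \<longrightarrow> g x = 0"
      using XD \<D>(2) X by (intro AE_box) auto
    ultimately show ?thesis unfolding X by eventually_elim auto
  qed
  then have "AE x in lebesgue. \<forall>X\<in>\<D>. x \<in> X \<longrightarrow> g x = 0"
    unfolding AE_ball_countable[OF \<D>(1)] by blast
  then have "AE x in lebesgue. x \<in> \<Omega> \<longrightarrow> g x = 0"
    by eventually_elim (use \<D>(4) in blast)
  then show ?thesis using \<Omega>m by (simp add: AE_restrict_space_iff)
qed

definition h1_inner :: "'a::euclidean_space set \<Rightarrow> ('a \<Rightarrow> real) \<Rightarrow> ('a \<Rightarrow> real) \<Rightarrow> real" where
  "h1_inner \<Omega> f g = L2_inner \<Omega> f g + form_a \<Omega> f g"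

lemma H1_norm_eq: "H1_norm \<Omega> = form_norm (h1_inner \<Omega>)"
  and L2_norm_eq: "L2_norm \<Omega> = form_norm (L2_inner \<Omega>)"
  by (auto simp: H1_norm_def L2_norm_def form_norm_def h1_inner_def)

lemma sobolev_H_subset_L2: "sobolev_H k \<Omega> \<subseteq> L2 \<Omega>"
  by (cases k) auto

text \<open>Otherwise the simplifier turns \<open>sobolev_H 1 \<Omega>\<close> into its definition.\<close>

declare One_nat_def [simp del] sobolev_H.simps(2) [simp del]

locale bounded_open =
  fixes \<Omega> :: "'a::euclidean_space set"
  assumes open_\<Omega>: "open \<Omega>" and bounded_\<Omega>: "bounded \<Omega>"
begin

sublocale L2: semi_inner "L2 \<Omega>" "L2_inner \<Omega>" by (rule semi_inner_L2)

lemma L2_integrable: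
  assumes "f \<in> L2 \<Omega>" shows "integrable (lebesgue_on \<Omega>) f"
proof -
  interpret finite_measure "lebesgue_on \<Omega>"
    using open_\<Omega> bounded_\<Omega> by (intro finite_measure_lebesgue_on) (simp add: lmeasurable_open)
  have "(\<lambda>x. 1) \<in> L2 \<Omega>" by (simp add: L2_def)
  from L2_mult_integrable[OF assms this] show ?thesis by simp
qed

lemma test_L2: "\<phi> \<in> test_functions \<Omega> \<Longrightarrow> \<phi> \<in> L2 \<Omega>"
  using test_functions_L2 open_\<Omega> by blast

text \<open>Hence the choice made by \<open>weak_pderiv\<close> does not matter up to null sets, and \<open>weak_pderiv\<close> is
  linear almost everywhere.\<close>

lemma weak_pderiv_unique:
  assumes "g \<in> L2 \<Omega>" "g' \<in> L2 \<Omega>" "is_weak_pderiv \<Omega> b f g" "is_weak_pderiv \<Omega> b f g'"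
  shows "AE x in lebesgue_on \<Omega>. g x = g' x"
proof -
  have "AE x in lebesgue_on \<Omega>. g x - g' x = 0"
  proof (rule fundamental_lemma[OF open_\<Omega> L2_integrable[OF L2.diff_in[OF assms(1,2)]]])
    fix \<phi> assume \<phi>: "\<phi> \<in> test_functions \<Omega>"
    have "L2_inner \<Omega> g \<phi> = L2_inner \<Omega> g' \<phi>"
      using assms(3,4) \<phi> by (simp add: is_weak_pderiv_def L2_inner_def)
    then show "(\<integral>x. (g x - g' x) * \<phi> x \<partial>lebesgue_on \<Omega>) = 0"
      using L2.diff_left[OF assms(1,2) test_L2[OF \<phi>]] by (simp add: L2_inner_def)
  qed
  then show ?thesis by eventually_elim simp
qed

lemma weak_pderiv_spec:
  assumes "\<exists>g\<in>L2 \<Omega>. is_weak_pderiv \<Omega> b f g"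
  shows "weak_pderiv \<Omega> b f \<in> L2 \<Omega>" "is_weak_pderiv \<Omega> b f (weak_pderiv \<Omega> b f)"
proof -
  have "\<exists>g. g \<in> L2 \<Omega> \<and> is_weak_pderiv \<Omega> b f g" using assms by blast
  from someI_ex[OF this] show "weak_pderiv \<Omega> b f \<in> L2 \<Omega>" "is_weak_pderiv \<Omega> b f (weak_pderiv \<Omega> b f)"
    unfolding weak_pderiv_def by blast+
qed

lemma weak_pderiv_AE:
  assumes "g \<in> L2 \<Omega>" "is_weak_pderiv \<Omega> b f g"
  shows "AE x in lebesgue_on \<Omega>. weak_pderiv \<Omega> b f x = g x"
  using weak_pderiv_unique[OF _ assms(1) _ assms(2)] weak_pderiv_spec assms by blast

lemma sobolev_H_Suc_weak_pderiv:
  assumes "f \<in> sobolev_H (Suc k) \<Omega>" "b \<in> Basis"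
  shows "weak_pderiv \<Omega> b f \<in> L2 \<Omega>" "is_weak_pderiv \<Omega> b f (weak_pderiv \<Omega> b f)"
proof -
  have "\<exists>g\<in>L2 \<Omega>. is_weak_pderiv \<Omega> b f g"
    using assms sobolev_H_subset_L2[of k \<Omega>] unfolding sobolev_H.simps(2) by blast
  from weak_pderiv_spec[OF this]
  show "weak_pderiv \<Omega> b f \<in> L2 \<Omega>" "is_weak_pderiv \<Omega> b f (weak_pderiv \<Omega> b f)" by auto
qed

lemma sobolev_1: "sobolev_H 1 \<Omega> = {f \<in> L2 \<Omega>. \<forall>b\<in>Basis. \<exists>g\<in>L2 \<Omega>. is_weak_pderiv \<Omega> b f g}"
  by (simp add: One_nat_def sobolev_H.simps(2))

lemma sobolev_1I:
  "f \<in> L2 \<Omega> \<Longrightarrow> (\<And>b. b \<in> Basis \<Longrightarrow> g b \<in> L2 \<Omega>) \<Longrightarrow> (\<And>b. b \<in> Basis \<Longrightarrow> is_weak_pderiv \<Omega> b f (g b)) \<Longrightarrow>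
    f \<in> sobolev_H 1 \<Omega>"
  unfolding sobolev_1 by blast

lemma sobolev_1D:
  assumes "f \<in> sobolev_H 1 \<Omega>"
  shows "f \<in> L2 \<Omega>"
    "b \<in> Basis \<Longrightarrow> weak_pderiv \<Omega> b f \<in> L2 \<Omega>" "b \<in> Basis \<Longrightarrow> is_weak_pderiv \<Omega> b f (weak_pderiv \<Omega> b f)"
  using assms sobolev_H_Suc_weak_pderiv[of f 0 b] sobolev_1 by (auto simp: One_nat_def)

lemma is_weak_pderiv_iff:
  "is_weak_pderiv \<Omega> b f g \<longleftrightarrow>
    (\<forall>\<phi>\<in>test_functions \<Omega>. L2_inner \<Omega> f (\<lambda>x. frechet_derivative \<phi> (at x) b) = - L2_inner \<Omega> g \<phi>)"
  by (simp add: is_weak_pderiv_def L2_inner_def)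

lemma is_weak_pderiv_add:
  assumes "f \<in> L2 \<Omega>" "g \<in> L2 \<Omega>" "f' \<in> L2 \<Omega>" "g' \<in> L2 \<Omega>" "b \<in> Basis"
    "is_weak_pderiv \<Omega> b f g" "is_weak_pderiv \<Omega> b f' g'"
  shows "is_weak_pderiv \<Omega> b (\<lambda>x. f x + f' x) (\<lambda>x. g x + g' x)"
  using assms test_L2 test_functions_derivative[of _ \<Omega> b]
  by (simp add: is_weak_pderiv_iff L2.add_left)

lemma is_weak_pderiv_scale:
  assumes "f \<in> L2 \<Omega>" "g \<in> L2 \<Omega>" "b \<in> Basis" "is_weak_pderiv \<Omega> b f g"
  shows "is_weak_pderiv \<Omega> b (\<lambda>x. c * f x) (\<lambda>x. c * g x)"
  using assms test_L2 test_functions_derivative[of _ \<Omega> b]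
  by (simp add: is_weak_pderiv_iff L2.scale_left)

lemma sobolev_1_add:
  assumes "f \<in> sobolev_H 1 \<Omega>" "g \<in> sobolev_H 1 \<Omega>"
  shows "(\<lambda>x. f x + g x) \<in> sobolev_H 1 \<Omega>"
    and "b \<in> Basis \<Longrightarrow> AE x in lebesgue_on \<Omega>.
      weak_pderiv \<Omega> b (\<lambda>x. f x + g x) x = weak_pderiv \<Omega> b f x + weak_pderiv \<Omega> b g x"
proof -
  have *: "is_weak_pderiv \<Omega> b (\<lambda>x. f x + g x) (\<lambda>x. weak_pderiv \<Omega> b f x + weak_pderiv \<Omega> b g x)"
    if "b \<in> Basis" for b
    using sobolev_1D[OF assms(1)] sobolev_1D[OF assms(2)] that by (intro is_weak_pderiv_add) auto
  show "(\<lambda>x. f x + g x) \<in> sobolev_H 1 \<Omega>"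
    by (rule sobolev_1I[OF _ _ *]) (use sobolev_1D assms in \<open>auto intro!: L2.add_in\<close>)
  show "AE x in lebesgue_on \<Omega>. weak_pderiv \<Omega> b (\<lambda>x. f x + g x) x = weak_pderiv \<Omega> b f x + weak_pderiv \<Omega> b g x"
    if "b \<in> Basis" for b
    by (rule weak_pderiv_AE[OF _ *[OF that]]) (use sobolev_1D assms that in \<open>auto intro!: L2.add_in\<close>)
qed

lemma sobolev_1_scale:
  assumes "f \<in> sobolev_H 1 \<Omega>"
  shows "(\<lambda>x. c * f x) \<in> sobolev_H 1 \<Omega>"
    and "b \<in> Basis \<Longrightarrow> AE x in lebesgue_on \<Omega>. weak_pderiv \<Omega> b (\<lambda>x. c * f x) x = c * weak_pderiv \<Omega> b f x"
proof -
  have *: "is_weak_pderiv \<Omega> b (\<lambda>x. c * f x) (\<lambda>x. c * weak_pderiv \<Omega> b f x)" if "b \<in> Basis" for b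
    using sobolev_1D[OF assms(1)] that by (intro is_weak_pderiv_scale) auto
  show "(\<lambda>x. c * f x) \<in> sobolev_H 1 \<Omega>"
    by (rule sobolev_1I[OF _ _ *]) (use sobolev_1D assms in \<open>auto intro!: L2.scale_in\<close>)
  show "AE x in lebesgue_on \<Omega>. weak_pderiv \<Omega> b (\<lambda>x. c * f x) x = c * weak_pderiv \<Omega> b f x"
    if "b \<in> Basis" for b
    by (rule weak_pderiv_AE[OF _ *[OF that]]) (use sobolev_1D assms that in \<open>auto intro!: L2.scale_in\<close>)
qed

lemma form_a_eq:
  assumes "f \<in> sobolev_H 1 \<Omega>" "g \<in> sobolev_H 1 \<Omega>"
  shows "form_a \<Omega> f g = (\<Sum>b\<in>Basis. L2_inner \<Omega> (weak_pderiv \<Omega> b f) (weak_pderiv \<Omega> b g))"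
proof -
  have "weak_grad \<Omega> f x \<bullet> weak_grad \<Omega> g x = (\<Sum>b\<in>Basis. weak_pderiv \<Omega> b f x * weak_pderiv \<Omega> b g x)" for x
    unfolding weak_grad_def by (subst euclidean_inner) (simp add: inner_sum_left_Basis)
  then show ?thesis
    unfolding form_a_def L2_inner_def
    using assms by (simp add: Bochner_Integration.integral_sum L2_mult_integrable sobolev_1D)
qed

sublocale a: semi_inner "sobolev_H 1 \<Omega>" "form_a \<Omega>"
proof
  fix f g h :: "'a \<Rightarrow> real" and c :: real
  show "(\<lambda>x. 0) \<in> sobolev_H 1 \<Omega>"
    by (rule sobolev_1I[of _ "\<lambda>b x. 0"]) (auto simp: is_weak_pderiv_def L2.zero_in)
  assume f: "f \<in> sobolev_H 1 \<Omega>"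
  show "form_a \<Omega> f f \<ge> 0" using f by (simp add: form_a_eq sum_nonneg L2.nonneg sobolev_1D)
  show "(\<lambda>x. c * f x) \<in> sobolev_H 1 \<Omega>" by (rule sobolev_1_scale[OF f])
  { assume h: "h \<in> sobolev_H 1 \<Omega>"
    show "form_a \<Omega> f h = form_a \<Omega> h f" by (simp add: form_a_def inner_commute)
    have "L2_inner \<Omega> (weak_pderiv \<Omega> b (\<lambda>x. c * f x)) (weak_pderiv \<Omega> b h)
        = c * L2_inner \<Omega> (weak_pderiv \<Omega> b f) (weak_pderiv \<Omega> b h)" if b: "b \<in> Basis" for b
      using L2_inner_cong_AE[of "weak_pderiv \<Omega> b (\<lambda>x. c * f x)" \<Omega> "weak_pderiv \<Omega> b h"
          "\<lambda>x. c * weak_pderiv \<Omega> b f x" "weak_pderiv \<Omega> b h"] sobolev_1_scale(2)[OF f b] f h b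
      by (simp add: sobolev_1D sobolev_1_scale L2.scale_in L2.scale_left)
    then show "form_a \<Omega> (\<lambda>x. c * f x) h = c * form_a \<Omega> f h"
      using f h by (simp add: form_a_eq sobolev_1_scale sum_distrib_left)
    assume g: "g \<in> sobolev_H 1 \<Omega>"
    have "L2_inner \<Omega> (weak_pderiv \<Omega> b (\<lambda>x. f x + g x)) (weak_pderiv \<Omega> b h)
        = L2_inner \<Omega> (weak_pderiv \<Omega> b f) (weak_pderiv \<Omega> b h) + L2_inner \<Omega> (weak_pderiv \<Omega> b g) (weak_pderiv \<Omega> b h)"
      if b: "b \<in> Basis" for b
      using L2_inner_cong_AE[of "weak_pderiv \<Omega> b (\<lambda>x. f x + g x)" \<Omega> "weak_pderiv \<Omega> b h"
          "\<lambda>x. weak_pderiv \<Omega> b f x + weak_pderiv \<Omega> b g x" "weak_pderiv \<Omega> b h"] sobolev_1_add(2)[OF f g b] f g h b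
      by (simp add: sobolev_1D sobolev_1_add L2.add_in L2.add_left)
    then show "form_a \<Omega> (\<lambda>x. f x + g x) h = form_a \<Omega> f h + form_a \<Omega> g h"
      using f g h by (simp add: form_a_eq sobolev_1_add sum.distrib)
  }
  assume g: "g \<in> sobolev_H 1 \<Omega>"
  show "(\<lambda>x. f x + g x) \<in> sobolev_H 1 \<Omega>" by (rule sobolev_1_add[OF f g])
qed

sublocale h1: semi_inner "sobolev_H 1 \<Omega>" "h1_inner \<Omega>"
proof -
  have "semi_inner (sobolev_H 1 \<Omega>) (L2_inner \<Omega>)"
    by (rule L2.subspace[OF sobolev_H_subset_L2 a.zero_in a.add_in a.scale_in])
  from semi_inner_sum[OF this a.semi_inner_axioms]
  show "semi_inner (sobolev_H 1 \<Omega>) (h1_inner \<Omega>)" by (simp add: h1_inner_def[abs_def])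
qed

lemma test_sobolev_1:
  assumes "\<phi> \<in> test_functions \<Omega>"
  shows "\<phi> \<in> sobolev_H 1 \<Omega>"
    and "b \<in> Basis \<Longrightarrow> AE x in lebesgue_on \<Omega>. weak_pderiv \<Omega> b \<phi> x = frechet_derivative \<phi> (at x) b"
proof -
  show "\<phi> \<in> sobolev_H 1 \<Omega>"
    by (rule sobolev_1I[OF test_L2[OF assms] test_L2[OF test_functions_derivative[OF assms]]
          test_function_weak_pderiv[OF assms open_\<Omega>]])
  show "AE x in lebesgue_on \<Omega>. weak_pderiv \<Omega> b \<phi> x = frechet_derivative \<phi> (at x) b" if "b \<in> Basis"
    by (rule weak_pderiv_AE[OF test_L2[OF test_functions_derivative[OF assms that]]
          test_function_weak_pderiv[OF assms open_\<Omega> that]])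
qed

lemma H10_subset: "H10 \<Omega> \<subseteq> sobolev_H 1 \<Omega>" by (auto simp: H10_def)

lemma H10_L2: "v \<in> H10 \<Omega> \<Longrightarrow> v \<in> L2 \<Omega>"
  using H10_subset sobolev_1D(1) by blast

lemma H10_zero: "(\<lambda>x. 0) \<in> H10 \<Omega>"
  unfolding H10_def using a.zero_in test_functions_zero[of \<Omega>] h1.norm_zero
  by (auto simp: H1_norm_eq intro!: exI[of _ "\<lambda>n x. 0"])

lemma H10_add:
  assumes "f \<in> H10 \<Omega>" "g \<in> H10 \<Omega>"
  shows "(\<lambda>x. f x + g x) \<in> H10 \<Omega>"
proof -
  obtain \<phi> \<psi> where \<phi>: "\<And>n. \<phi> n \<in> test_functions \<Omega>" "(\<lambda>n. H1_norm \<Omega> (\<lambda>x. f x - \<phi> n x)) \<longlonglongrightarrow> 0"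
    and \<psi>: "\<And>n. \<psi> n \<in> test_functions \<Omega>" "(\<lambda>n. H1_norm \<Omega> (\<lambda>x. g x - \<psi> n x)) \<longlonglongrightarrow> 0"
    using assms by (auto simp: H10_def)
  have f: "f \<in> sobolev_H 1 \<Omega>" and g: "g \<in> sobolev_H 1 \<Omega>" using assms H10_subset by blast+
  note t = test_sobolev_1(1)[OF \<phi>(1)] test_sobolev_1(1)[OF \<psi>(1)]
  have "(\<lambda>n. H1_norm \<Omega> (\<lambda>x. (f x + g x) - (\<phi> n x + \<psi> n x))) \<longlonglongrightarrow> 0"
  proof (rule tendsto_sandwich[OF _ _ tendsto_const])
    show "(\<lambda>n. H1_norm \<Omega> (\<lambda>x. f x - \<phi> n x) + H1_norm \<Omega> (\<lambda>x. g x - \<psi> n x)) \<longlonglongrightarrow> 0"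
      using tendsto_add[OF \<phi>(2) \<psi>(2)] by simp
    show "eventually (\<lambda>n. 0 \<le> H1_norm \<Omega> (\<lambda>x. (f x + g x) - (\<phi> n x + \<psi> n x))) sequentially"
      unfolding H1_norm_eq by (intro always_eventually allI h1.norm_nonneg h1.diff_in h1.add_in f g t)
    have "H1_norm \<Omega> (\<lambda>x. (f x + g x) - (\<phi> n x + \<psi> n x)) \<le> H1_norm \<Omega> (\<lambda>x. f x - \<phi> n x) + H1_norm \<Omega> (\<lambda>x. g x - \<psi> n x)" for n
      using h1.norm_triangle[OF h1.diff_in[OF f t(1)] h1.diff_in[OF g t(2)], of n n]
      unfolding H1_norm_eq by (simp add: algebra_simps)
    then show "eventually (\<lambda>n. H1_norm \<Omega> (\<lambda>x. (f x + g x) - (\<phi> n x + \<psi> n x))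
        \<le> H1_norm \<Omega> (\<lambda>x. f x - \<phi> n x) + H1_norm \<Omega> (\<lambda>x. g x - \<psi> n x)) sequentially" by simp
  qed
  then show ?thesis
    using a.add_in[OF f g] test_functions_add[OF \<phi>(1) \<psi>(1)]
    unfolding H10_def by (auto intro!: exI[of _ "\<lambda>n x. \<phi> n x + \<psi> n x"])
qed

lemma H10_scale:
  assumes "f \<in> H10 \<Omega>"
  shows "(\<lambda>x. c * f x) \<in> H10 \<Omega>"
proof -
  obtain \<phi> where \<phi>: "\<And>n. \<phi> n \<in> test_functions \<Omega>" "(\<lambda>n. H1_norm \<Omega> (\<lambda>x. f x - \<phi> n x)) \<longlonglongrightarrow> 0"
    using assms by (auto simp: H10_def)
  have f: "f \<in> sobolev_H 1 \<Omega>" using assms H10_subset by blast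
  have "H1_norm \<Omega> (\<lambda>x. c * f x - c * \<phi> n x) = \<bar>c\<bar> * H1_norm \<Omega> (\<lambda>x. f x - \<phi> n x)" for n
    using h1.norm_scale[OF h1.diff_in[OF f test_sobolev_1(1)[OF \<phi>(1)]], of c n]
    unfolding H1_norm_eq by (simp add: algebra_simps)
  then have "(\<lambda>n. H1_norm \<Omega> (\<lambda>x. c * f x - c * \<phi> n x)) \<longlonglongrightarrow> 0"
    using tendsto_mult_left[OF \<phi>(2), of "\<bar>c\<bar>"] by simp
  then show ?thesis
    using a.scale_in[OF f, of c] test_functions_scale[OF \<phi>(1)]
    unfolding H10_def by (auto intro!: exI[of _ "\<lambda>n x. c * \<phi> n x"])
qed

lemma semi_inner_H10:
  "semi_inner (H10 \<Omega>) (L2_inner \<Omega>)" "semi_inner (H10 \<Omega>) (form_a \<Omega>)" "semi_inner (H10 \<Omega>) (h1_inner \<Omega>)"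
  by (rule L2.subspace a.subspace h1.subspace; use H10_L2 H10_subset H10_zero H10_add H10_scale in blast)+

lemma sobolev_H_cong_AE:
  assumes "f \<in> sobolev_H (Suc k) \<Omega>" "f' \<in> L2 \<Omega>" "AE x in lebesgue_on \<Omega>. f x = f' x"
  shows "f' \<in> sobolev_H (Suc k) \<Omega>"
proof -
  have f: "f \<in> L2 \<Omega>" using assms(1) by (simp add: sobolev_H.simps(2))
  have "is_weak_pderiv \<Omega> b f' g" if "is_weak_pderiv \<Omega> b f g" "b \<in> Basis" for b g
    using that L2_inner_cong_AE[OF f _ assms(2) _ assms(3) AE_I2[OF refl]]
    by (simp add: is_weak_pderiv_iff test_functions_derivative test_L2)
  then show ?thesis using assms unfolding sobolev_H.simps(2) by blast
qed

text \<open>If \<open>v\<close> is a test function, this is the definition of the second weak derivatives. Both sides are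
  continuous in \<open>v\<close> with respect to \<open>H1_norm\<close>.\<close>

lemma form_a_laplacian:
  assumes y0: "y0 \<in> sobolev_H (Suc (Suc k)) \<Omega>" and v: "v \<in> H10 \<Omega>"
  shows "weak_laplacian \<Omega> y0 \<in> L2 \<Omega>" "form_a \<Omega> y0 v = - L2_inner \<Omega> (weak_laplacian \<Omega> y0) v"
proof -
  let ?D = "\<lambda>b. weak_pderiv \<Omega> b"
  have D: "?D b y0 \<in> sobolev_H (Suc k) \<Omega>" if b: "b \<in> Basis" for b
  proof -
    obtain g where g: "g \<in> sobolev_H (Suc k) \<Omega>" "is_weak_pderiv \<Omega> b y0 g" using y0 b by (auto simp: sobolev_H.simps(2))
    then have gL: "g \<in> L2 \<Omega>" using sobolev_H_subset_L2 by blast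
    have "AE x in lebesgue_on \<Omega>. g x = ?D b y0 x" using weak_pderiv_AE[OF gL g(2)] by eventually_elim simp
    then show ?thesis using sobolev_H_cong_AE[OF g(1)] sobolev_H_Suc_weak_pderiv[OF y0 b] by blast
  qed
  have DD: "?D b (?D b y0) \<in> L2 \<Omega>" "is_weak_pderiv \<Omega> b (?D b y0) (?D b (?D b y0))" if "b \<in> Basis" for b
    using sobolev_H_Suc_weak_pderiv[OF D[OF that] that] by auto
  have y1: "y0 \<in> sobolev_H 1 \<Omega>"
    using y0 sobolev_H_subset_L2[of "Suc k"] unfolding sobolev_1 sobolev_H.simps(2)[of "Suc k"] by blast
  have lap: "weak_laplacian \<Omega> y0 = (\<lambda>x. \<Sum>b\<in>Basis. 1 * ?D b (?D b y0) x)"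
    by (simp add: weak_laplacian_def[abs_def])
  show L: "weak_laplacian \<Omega> y0 \<in> L2 \<Omega>" unfolding lap by (intro L2.sum_in DD(1)) auto
  have eq: "form_a \<Omega> y0 \<phi> = - L2_inner \<Omega> (weak_laplacian \<Omega> y0) \<phi>" if \<phi>: "\<phi> \<in> test_functions \<Omega>" for \<phi>
  proof -
    have "L2_inner \<Omega> (?D b y0) (?D b \<phi>) = - L2_inner \<Omega> (?D b (?D b y0)) \<phi>" if b: "b \<in> Basis" for b
    proof -
      have "L2_inner \<Omega> (?D b y0) (?D b \<phi>) = L2_inner \<Omega> (?D b y0) (\<lambda>x. frechet_derivative \<phi> (at x) b)"
        using b by (intro L2_inner_cong_AE test_sobolev_1(2)[OF \<phi>] AE_I2 refl test_L2[OF test_functions_derivative[OF \<phi>]]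
              sobolev_1D(2)[OF y1] sobolev_1D(2)[OF test_sobolev_1(1)[OF \<phi>]])
      then show ?thesis using DD(2)[OF b] \<phi> by (simp add: is_weak_pderiv_iff)
    qed
    moreover have "L2_inner \<Omega> (weak_laplacian \<Omega> y0) \<phi> = (\<Sum>b\<in>Basis. 1 * L2_inner \<Omega> (?D b (?D b y0)) \<phi>)"
      unfolding lap by (intro L2.sum_left DD(1) test_L2 \<phi>) auto
    ultimately show ?thesis using y1 \<phi> by (simp add: form_a_eq test_sobolev_1(1) flip: sum_negf)
  qed
  obtain \<phi> where \<phi>: "\<And>n. \<phi> n \<in> test_functions \<Omega>" "(\<lambda>n. H1_norm \<Omega> (\<lambda>x. v x - \<phi> n x)) \<longlonglongrightarrow> 0"
    using v by (auto simp: H10_def)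
  have v1: "v \<in> sobolev_H 1 \<Omega>" using v H10_subset by blast
  let ?d = "\<lambda>n x. v x - \<phi> n x"
  have d1: "?d n \<in> sobolev_H 1 \<Omega>" for n using h1.diff_in[OF v1 test_sobolev_1(1)[OF \<phi>(1)]] .
  have dL: "?d n \<in> L2 \<Omega>" for n using sobolev_1D(1)[OF d1] .
  let ?C = "form_norm (form_a \<Omega>) y0 + form_norm (L2_inner \<Omega>) (weak_laplacian \<Omega> y0)"
  have "\<bar>form_a \<Omega> y0 v + L2_inner \<Omega> (weak_laplacian \<Omega> y0) v\<bar> \<le> ?C * H1_norm \<Omega> (?d n)" for n
  proof -
    have le: "form_norm (form_a \<Omega>) (?d n) \<le> H1_norm \<Omega> (?d n)" "form_norm (L2_inner \<Omega>) (?d n) \<le> H1_norm \<Omega> (?d n)"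
      using a.nonneg[OF d1[of n]] L2.nonneg[OF dL[of n]] by (simp_all add: form_norm_def H1_norm_def)
    have "form_a \<Omega> y0 v + L2_inner \<Omega> (weak_laplacian \<Omega> y0) v
        = form_a \<Omega> y0 (?d n) + L2_inner \<Omega> (weak_laplacian \<Omega> y0) (?d n)"
      using eq[OF \<phi>(1)] a.diff_right[OF v1 test_sobolev_1(1)[OF \<phi>(1)] y1]
        L2.diff_right[OF sobolev_1D(1)[OF v1] test_L2[OF \<phi>(1)] L] by simp
    then have "\<bar>form_a \<Omega> y0 v + L2_inner \<Omega> (weak_laplacian \<Omega> y0) v\<bar> \<le> form_norm (form_a \<Omega>) y0 * form_norm (form_a \<Omega>) (?d n)
        + form_norm (L2_inner \<Omega>) (weak_laplacian \<Omega> y0) * form_norm (L2_inner \<Omega>) (?d n)"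
      using abs_triangle_ineq[of "form_a \<Omega> y0 (?d n)" "L2_inner \<Omega> (weak_laplacian \<Omega> y0) (?d n)"]
        a.cauchy_schwarz[OF y1 d1[of n]] L2.cauchy_schwarz[OF L dL[of n]] by linarith
    also have "\<dots> \<le> form_norm (form_a \<Omega>) y0 * H1_norm \<Omega> (?d n)
        + form_norm (L2_inner \<Omega>) (weak_laplacian \<Omega> y0) * H1_norm \<Omega> (?d n)"
      using le by (intro add_mono mult_left_mono a.norm_nonneg L2.norm_nonneg y1 L)
    finally show ?thesis by (simp add: algebra_simps)
  qed
  moreover have "(\<lambda>n. ?C * H1_norm \<Omega> (?d n)) \<longlonglongrightarrow> 0" using tendsto_mult_left[OF \<phi>(2), of ?C] by simp
  ultimately have "\<bar>form_a \<Omega> y0 v + L2_inner \<Omega> (weak_laplacian \<Omega> y0) v\<bar> \<le> 0"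
    by (intro LIMSEQ_le_const) auto
  then show "form_a \<Omega> y0 v = - L2_inner \<Omega> (weak_laplacian \<Omega> y0) v" by simp
qed

text \<open>The boundedness of \<open>F\<close> makes the supremum in \<open>Hm1_norm\<close> meaningful. If \<open>v\<close> has norm 0, it
  cannot be normalized, but then \<open>F v = 0\<close>.\<close>

lemma Hm1_bound:
  assumes F: "F \<in> Hm1 \<Omega>" and v: "v \<in> H10 \<Omega>"
  shows "\<bar>F v\<bar> \<le> Hm1_norm \<Omega> F * H1_norm \<Omega> v"
proof -
  interpret V: semi_inner "H10 \<Omega>" "h1_inner \<Omega>" by (rule semi_inner_H10)
  obtain K where K: "\<And>v. v \<in> H10 \<Omega> \<Longrightarrow> \<bar>F v\<bar> \<le> K * H1_norm \<Omega> v" using F unfolding Hm1_def by blast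
  show ?thesis
  proof (cases "H1_norm \<Omega> v = 0")
    case True
    then show ?thesis using K[OF v] by simp
  next
    case False
    then have p: "H1_norm \<Omega> v > 0" using V.norm_nonneg[OF v] by (simp add: H1_norm_eq)
    let ?c = "1 / H1_norm \<Omega> v"
    have in_H: "(\<lambda>x. ?c * v x) \<in> H10 \<Omega>" by (rule H10_scale[OF v])
    have n1: "H1_norm \<Omega> (\<lambda>x. ?c * v x) = 1"
      unfolding H1_norm_eq using V.norm_scale[OF v, of "1 / form_norm (h1_inner \<Omega>) v"] p by (simp add: H1_norm_eq)
    have "\<bar>F (\<lambda>x. ?c * v x)\<bar> \<le> Hm1_norm \<Omega> F"
      unfolding Hm1_norm_def
    proof (rule cSUP_upper)
      show "bdd_above ((\<lambda>v. \<bar>F v\<bar>) ` {v \<in> H10 \<Omega>. H1_norm \<Omega> v \<le> 1})"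
      proof (rule bdd_aboveI2)
        fix w assume w: "w \<in> {v \<in> H10 \<Omega>. H1_norm \<Omega> v \<le> 1}"
        then have "\<bar>F w\<bar> \<le> K * H1_norm \<Omega> w" using K by blast
        also have "\<dots> \<le> \<bar>K\<bar> * H1_norm \<Omega> w"
          using w V.norm_nonneg by (intro mult_right_mono) (auto simp: H1_norm_eq)
        also have "\<dots> \<le> \<bar>K\<bar> * 1" using w by (intro mult_left_mono) auto
        finally show "\<bar>F w\<bar> \<le> \<bar>K\<bar>" by simp
      qed
    qed (use in_H n1 in auto)
    moreover have "F (\<lambda>x. ?c * v x) = ?c * F v" using F v unfolding Hm1_def by blast
    ultimately have "?c * \<bar>F v\<bar> \<le> Hm1_norm \<Omega> F" using p by (simp add: abs_mult)
    then show ?thesis using p by (simp add: field_simps)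
  qed
qed

lemma L2_inner_Hm1:
  assumes "f \<in> L2 \<Omega>" shows "L2_inner \<Omega> f \<in> Hm1 \<Omega>"
proof -
  have "\<bar>L2_inner \<Omega> f v\<bar> \<le> form_norm (L2_inner \<Omega>) f * H1_norm \<Omega> v" if v: "v \<in> H10 \<Omega>" for v
  proof -
    have "form_norm (L2_inner \<Omega>) v \<le> H1_norm \<Omega> v"
      using a.nonneg v H10_subset by (auto simp: form_norm_def H1_norm_def)
    then show ?thesis
      using L2.cauchy_schwarz[OF assms H10_L2[OF v]] L2.norm_nonneg[OF assms]
      by (meson mult_left_mono order_trans)
  qed
  then show ?thesis
    using assms by (auto simp: Hm1_def L2.add_right L2.scale_right H10_L2)
qed

lemma Hm1_add: "F \<in> Hm1 \<Omega> \<Longrightarrow> G \<in> Hm1 \<Omega> \<Longrightarrow> (\<lambda>v. F v + G v) \<in> Hm1 \<Omega>"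
proof -
  assume F: "F \<in> Hm1 \<Omega>" and G: "G \<in> Hm1 \<Omega>"
  have "\<bar>F v + G v\<bar> \<le> (Hm1_norm \<Omega> F + Hm1_norm \<Omega> G) * H1_norm \<Omega> v" if "v \<in> H10 \<Omega>" for v
    using Hm1_bound[OF F that] Hm1_bound[OF G that] by (simp add: algebra_simps)
  then have "\<exists>K. \<forall>v\<in>H10 \<Omega>. \<bar>F v + G v\<bar> \<le> K * H1_norm \<Omega> v" by blast
  then show ?thesis using F G by (simp add: Hm1_def distrib_left)
qed

lemma Hm1_scale: "F \<in> Hm1 \<Omega> \<Longrightarrow> (\<lambda>v. c * F v) \<in> Hm1 \<Omega>"
proof -
  assume F: "F \<in> Hm1 \<Omega>"
  have "\<bar>c * F v\<bar> \<le> (\<bar>c\<bar> * Hm1_norm \<Omega> F) * H1_norm \<Omega> v" if "v \<in> H10 \<Omega>" for v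
    using mult_left_mono[OF Hm1_bound[OF F that], of "\<bar>c\<bar>"] by (simp add: abs_mult mult.assoc)
  then have "\<exists>K. \<forall>v\<in>H10 \<Omega>. \<bar>c * F v\<bar> \<le> K * H1_norm \<Omega> v" by blast
  then show ?thesis using F by (simp add: Hm1_def distrib_left mult.left_commute)
qed

lemma Hm1_zero: "(\<lambda>v. 0) \<in> Hm1 \<Omega>"
  by (auto simp: Hm1_def intro!: exI[of _ 0])

end

section \<open>Vector-valued functions of time\<close>

lemma finite_measure_time: "finite_measure (time_measure T)"
  by (rule finite_measure_lebesgue_on) simp

lemma integrable_time_bounded:
  fixes f :: "real \<Rightarrow> real"
  assumes "f \<in> borel_measurable (time_measure T)" "\<And>t. 0 < t \<Longrightarrow> t < T \<Longrightarrow> \<bar>f t\<bar> \<le> C"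
  shows "integrable (time_measure T) f"
proof (rule finite_measure.integrable_const_bound[OF finite_measure_time])
  show "AE t in time_measure T. norm (f t) \<le> C" by (rule AE_I2) (use assms(2) in simp)
qed (rule assms(1))

lemma integrable_mult_bounded:
  fixes f k :: "real \<Rightarrow> real"
  assumes f: "integrable (time_measure T) f" and k: "k \<in> borel_measurable (time_measure T)"
    and C: "\<And>t. 0 < t \<Longrightarrow> t < T \<Longrightarrow> \<bar>k t\<bar> \<le> C"
  shows "integrable (time_measure T) (\<lambda>t. k t * f t)"
proof (rule Bochner_Integration.integrable_bound)
  show "integrable (time_measure T) (\<lambda>t. C * f t)" using f by simp
  show "(\<lambda>t. k t * f t) \<in> borel_measurable (time_measure T)" using f k by simp
  show "AE t in time_measure T. norm (k t * f t) \<le> norm (C * f t)"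
  proof (rule AE_I2)
    fix t assume "t \<in> space (time_measure T)"
    then have "\<bar>k t\<bar> \<le> \<bar>C\<bar>" using C[of t] by auto
    then show "norm (k t * f t) \<le> norm (C * f t)" by (simp add: abs_mult mult_right_mono)
  qed
qed

lemma integrable_time_square:
  fixes f :: "real \<Rightarrow> real"
  assumes "f \<in> borel_measurable (time_measure T)" "integrable (time_measure T) (\<lambda>t. (f t)\<^sup>2)"
  shows "integrable (time_measure T) f"
proof (rule Bochner_Integration.integrable_bound)
  show "integrable (time_measure T) (\<lambda>t. 1 + (f t)\<^sup>2)"
    using assms(2) integrable_time_bounded[of "\<lambda>_. 1" T 1] by simp
  have "\<bar>x\<bar> \<le> 1 + x\<^sup>2" for x :: real
  proof -
    have "0 \<le> (\<bar>x\<bar> - 1)\<^sup>2" by simp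
    then have "2 * \<bar>x\<bar> \<le> 1 + x\<^sup>2" by (simp add: power2_diff)
    then show ?thesis using abs_ge_zero[of x] by linarith
  qed
  then show "AE t in time_measure T. norm (f t) \<le> norm (1 + (f t)\<^sup>2)" by (intro AE_I2) (simp add: add_nonneg_nonneg)
qed (rule assms(1))

text \<open>Here the completeness of the Lebesgue measure is essential: nothing is known about \<open>f\<close> on the
  exceptional null set.\<close>

lemma borel_measurable_AE_limit:
  fixes f :: "'a::euclidean_space \<Rightarrow> real"
  assumes S: "S \<in> sets lebesgue" and s: "\<And>n::nat. s n \<in> borel_measurable (lebesgue_on S)"
    and lim: "AE t in lebesgue_on S. (\<lambda>n. s n t) \<longlonglongrightarrow> f t"
  shows "f \<in> borel_measurable (lebesgue_on S)"
proof -
  have S': "S \<inter> space lebesgue \<in> sets lebesgue" using S by simp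
  let ?g = "\<lambda>t. lim (\<lambda>n. s n t)"
  have "?g \<in> borel_measurable (lebesgue_on S)" using s by measurable
  then have m: "(\<lambda>t. indicator S t *\<^sub>R ?g t) \<in> borel_measurable lebesgue"
    by (rule borel_measurable_restrict_space_iff[OF S', THEN iffD1])
  have "AE t in lebesgue. t \<in> S \<longrightarrow> (\<lambda>n. s n t) \<longlonglongrightarrow> f t"
    by (rule AE_restrict_space_iff[OF S', THEN iffD1]) (rule lim)
  then have "AE t in lebesgue. indicator S t *\<^sub>R ?g t = indicator S t *\<^sub>R f t"
    by eventually_elim (auto simp: indicator_def limI)
  from borel_measurable_AE[OF m this] show ?thesis
    by (rule borel_measurable_restrict_space_iff[OF S', THEN iffD2])
qed

subsection \<open>Bounded linear functionals\<close>

text \<open>A bounded linear functional on a seminormed space of functions. Evaluating such functionals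
  turns vector-valued integrals and derivatives into scalar ones.\<close>

locale bounded_functional =
  fixes X :: "'x fun_space" and \<Lambda> :: "('x \<Rightarrow> real) \<Rightarrow> real" and K :: real
  assumes zero_in: "(\<lambda>x. 0) \<in> elems X"
    and add_in: "f \<in> elems X \<Longrightarrow> g \<in> elems X \<Longrightarrow> (\<lambda>x. f x + g x) \<in> elems X"
    and scale_in: "f \<in> elems X \<Longrightarrow> (\<lambda>x. c * f x) \<in> elems X"
    and add: "f \<in> elems X \<Longrightarrow> g \<in> elems X \<Longrightarrow> \<Lambda> (\<lambda>x. f x + g x) = \<Lambda> f + \<Lambda> g"
    and scale: "f \<in> elems X \<Longrightarrow> \<Lambda> (\<lambda>x. c * f x) = c * \<Lambda> f"
    and K_nonneg: "K \<ge> 0"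
    and bound: "f \<in> elems X \<Longrightarrow> \<bar>\<Lambda> f\<bar> \<le> K * nrm X f"

lemma simple_valued_measurable:
  fixes m :: "('x \<Rightarrow> real) \<Rightarrow> real"
  assumes "simple_valued T X s"
  shows "(\<lambda>t. m (s t)) \<in> borel_measurable (time_measure T)"
  using assms simple_function_compose1[of "time_measure T" s m]
  by (intro borel_measurable_simple_function) (simp add: simple_valued_def)

text \<open>The integral of \<open>k(t) s(t)\<close> for a simple function \<open>s\<close>, as a finite sum.\<close>

definition weighted_integral :: "real \<Rightarrow> (real \<Rightarrow> real) \<Rightarrow> (real \<Rightarrow> 'x \<Rightarrow> real) \<Rightarrow> 'x \<Rightarrow> real" where
  "weighted_integral T k s =
     (\<lambda>x. \<Sum>g\<in>s ` {0<..<T}. (\<integral>t. k t * indicator {t. s t = g} t \<partial>time_measure T) * g x)"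

lemma simple_valued_finite: "simple_valued T X s \<Longrightarrow> finite (s ` {0<..<T})"
  by (simp add: simple_valued_def simple_function_def)

lemma simple_valued_in: "simple_valued T X s \<Longrightarrow> g \<in> s ` {0<..<T} \<Longrightarrow> g \<in> elems X"
  by (auto simp: simple_valued_def)

lemma simple_valued_sets:
  assumes "simple_valued T X s"
  shows "{t \<in> {0<..<T}. s t = g} \<in> sets lebesgue" "(indicator {t. s t = g} :: real \<Rightarrow> real) \<in> borel_measurable (time_measure T)"
proof -
  have "s -` {g} \<inter> space (time_measure T) \<in> sets (time_measure T)"
    using assms simple_functionD(2) unfolding simple_valued_def by blast
  moreover have "s -` {g} \<inter> space (time_measure T) = {t \<in> {0<..<T}. s t = g}" by auto
  ultimately have *: "{t \<in> {0<..<T}. s t = g} \<in> sets (time_measure T)" by metis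
  then show "{t \<in> {0<..<T}. s t = g} \<in> sets lebesgue" by (simp add: sets_restrict_space_iff)
  have "(indicator {t \<in> {0<..<T}. s t = g} :: real \<Rightarrow> real) \<in> borel_measurable (time_measure T)"
    using * by simp
  then show "(indicator {t. s t = g} :: real \<Rightarrow> real) \<in> borel_measurable (time_measure T)"
    by (rule measurable_cong[THEN iffD1, rotated]) (simp add: indicator_def)
qed

lemma simple_integral_eq:
  assumes "simple_valued T X s"
  shows "simple_integral T s = weighted_integral T (\<lambda>t. 1) s"
proof -
  have "measure lebesgue {t \<in> {0<..<T}. s t = g} = (\<integral>t. 1 * indicator {t. s t = g} t \<partial>time_measure T)" for g
  proof -
    have "(\<integral>t. 1 * indicator {t. s t = g} t \<partial>time_measure T)
        = (\<integral>t. indicator {0<..<T} t *\<^sub>R (1 * indicator {t. s t = g} t :: real) \<partial>lebesgue)"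
      by (rule integral_restrict_space) simp
    also have "\<dots> = (\<integral>t. indicator {t \<in> {0<..<T}. s t = g} t \<partial>lebesgue)"
      by (intro Bochner_Integration.integral_cong) (auto simp: indicator_def)
    also have "\<dots> = measure lebesgue {t \<in> {0<..<T}. s t = g}" by simp
    finally show ?thesis by simp
  qed
  then show ?thesis by (simp add: simple_integral_def weighted_integral_def)
qed

lemma simple_valued_integral:
  fixes m :: "('x \<Rightarrow> real) \<Rightarrow> real"
  assumes s: "simple_valued T X s" and k: "integrable (time_measure T) k"
  shows "integrable (time_measure T) (\<lambda>t. k t * m (s t))"
    and "(\<integral>t. k t * m (s t) \<partial>time_measure T)
      = (\<Sum>g\<in>s ` {0<..<T}. (\<integral>t. k t * indicator {t. s t = g} t \<partial>time_measure T) * m g)"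
proof -
  note fin = simple_valued_finite[OF s]
  have eq: "k t * m (s t) = (\<Sum>g\<in>s ` {0<..<T}. (k t * indicator {t. s t = g} t) * m g)"
    if "t \<in> space (time_measure T)" for t
  proof -
    have "(\<Sum>g\<in>s ` {0<..<T}. (k t * indicator {t. s t = g} t) * m g)
        = (\<Sum>g\<in>s ` {0<..<T}. if s t = g then k t * m g else 0)"
      by (intro sum.cong) (auto simp: indicator_def)
    also have "\<dots> = k t * m (s t)" using that fin by (simp add: sum.delta)
    finally show ?thesis by simp
  qed
  have int: "integrable (time_measure T) (\<lambda>t. k t * indicator {t. s t = g} t)" for g
    using integrable_mult_bounded[OF k simple_valued_sets(2)[OF s], where C = 1] by (simp add: mult.commute indicator_def)
  show "integrable (time_measure T) (\<lambda>t. k t * m (s t))"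
    by (subst Bochner_Integration.integrable_cong[OF refl eq]) (use int in auto)
  have "(\<integral>t. k t * m (s t) \<partial>time_measure T)
      = (\<integral>t. (\<Sum>g\<in>s ` {0<..<T}. (k t * indicator {t. s t = g} t) * m g) \<partial>time_measure T)"
    by (rule Bochner_Integration.integral_cong[OF refl eq])
  then show "(\<integral>t. k t * m (s t) \<partial>time_measure T)
      = (\<Sum>g\<in>s ` {0<..<T}. (\<integral>t. k t * indicator {t. s t = g} t \<partial>time_measure T) * m g)"
    using int by (simp add: Bochner_Integration.integral_sum)
qed

text \<open>Almost everywhere, the values of \<open>\<Lambda>\<close> are limits of its values at simple functions. \<open>\<Lambda>\<close> need not
  be linear, so that this also applies to norms.\<close>

lemma strongly_measurable_lipschitz:
  fixes \<Lambda> :: "('x \<Rightarrow> real) \<Rightarrow> real"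
  assumes "strongly_measurable T X f"
    and lipschitz: "\<And>f g. f \<in> elems X \<Longrightarrow> g \<in> elems X \<Longrightarrow> \<bar>\<Lambda> f - \<Lambda> g\<bar> \<le> K * nrm X (\<lambda>x. f x - g x)"
  shows "(\<lambda>t. \<Lambda> (f t)) \<in> borel_measurable (time_measure T)"
proof -
  obtain s where s: "\<And>n. simple_valued T X (s n)"
    and lim: "AE t in time_measure T. (\<lambda>n::nat. nrm X (\<lambda>x. f t x - s n t x)) \<longlonglongrightarrow> 0"
    and f: "AE t in time_measure T. f t \<in> elems X"
    using assms by (auto simp: strongly_measurable_def)
  show ?thesis
  proof (rule borel_measurable_AE_limit)
    show "(\<lambda>t. \<Lambda> (s n t)) \<in> borel_measurable (time_measure T)" for n
      by (rule simple_valued_measurable[OF s])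
    show "AE t in time_measure T. (\<lambda>n. \<Lambda> (s n t)) \<longlonglongrightarrow> \<Lambda> (f t)"
      using lim f AE_space
    proof eventually_elim
      case (elim t)
      have lim0: "(\<lambda>n. K * nrm X (\<lambda>x. f t x - s n t x)) \<longlonglongrightarrow> 0"
        using tendsto_mult_left[OF elim(1), of K] by simp
      have "\<bar>\<Lambda> (s n t) - \<Lambda> (f t)\<bar> \<le> K * nrm X (\<lambda>x. f t x - s n t x)" for n
        using lipschitz[OF elim(2), of "s n t"] s[of n] elim(3) by (simp add: simple_valued_def abs_minus_commute)
      then have "(\<lambda>n. \<Lambda> (s n t) - \<Lambda> (f t)) \<longlonglongrightarrow> 0"
        by (intro Lim_null_comparison[OF always_eventually lim0]) simp
      then show ?case by (rule LIM_zero_cancel)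
    qed
  qed simp
qed

context bounded_functional
begin

lemma diff_in: "f \<in> elems X \<Longrightarrow> g \<in> elems X \<Longrightarrow> (\<lambda>x. f x - g x) \<in> elems X"
  using add_in[OF _ scale_in[of g "-1"], of f] by simp

lemma diff: "f \<in> elems X \<Longrightarrow> g \<in> elems X \<Longrightarrow> \<Lambda> (\<lambda>x. f x - g x) = \<Lambda> f - \<Lambda> g"
  using add[OF _ scale_in[of g "-1"], of f] scale[of g "-1"] by simp

lemma lipschitz: "f \<in> elems X \<Longrightarrow> g \<in> elems X \<Longrightarrow> \<bar>\<Lambda> f - \<Lambda> g\<bar> \<le> K * nrm X (\<lambda>x. f x - g x)"
  using bound[OF diff_in] diff by metis

lemma zero: "\<Lambda> (\<lambda>x. 0) = 0"
  using scale[OF zero_in, of 0] by simp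

lemma sum_in: "finite S \<Longrightarrow> S \<subseteq> elems X \<Longrightarrow> (\<lambda>x. \<Sum>g\<in>S. c g * g x) \<in> elems X"
  by (induction S rule: finite_induct) (auto intro!: zero_in add_in scale_in)

lemma sum: "finite S \<Longrightarrow> S \<subseteq> elems X \<Longrightarrow> \<Lambda> (\<lambda>x. \<Sum>g\<in>S. c g * g x) = (\<Sum>g\<in>S. c g * \<Lambda> g)"
  by (induction S rule: finite_induct) (auto simp: zero add scale scale_in sum_in)

lemma weighted:
  assumes "simple_valued T X s" "integrable (time_measure T) k"
  shows "weighted_integral T k s \<in> elems X"
    "\<Lambda> (weighted_integral T k s) = (\<integral>t. k t * \<Lambda> (s t) \<partial>time_measure T)"
proof -
  have S: "finite (s ` {0<..<T})" "s ` {0<..<T} \<subseteq> elems X"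
    using simple_valued_finite[OF assms(1)] simple_valued_in[OF assms(1)] by auto
  show "weighted_integral T k s \<in> elems X" unfolding weighted_integral_def by (rule sum_in[OF S])
  show "\<Lambda> (weighted_integral T k s) = (\<integral>t. k t * \<Lambda> (s t) \<partial>time_measure T)"
    unfolding weighted_integral_def sum[OF S] simple_valued_integral(2)[OF assms] ..
qed

lemma measurable_functional:
  "strongly_measurable T X f \<Longrightarrow> (\<lambda>t. \<Lambda> (f t)) \<in> borel_measurable (time_measure T)"
  by (rule strongly_measurable_lipschitz[OF _ lipschitz])

lemma L2_Bochner_functional:
  assumes "f \<in> L2_Bochner T X"
  shows "integrable (time_measure T) (\<lambda>t. (\<Lambda> (f t))\<^sup>2)" "integrable (time_measure T) (\<lambda>t. \<Lambda> (f t))"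
proof -
  have sm: "strongly_measurable T X f" and sq: "integrable (time_measure T) (\<lambda>t. (nrm X (f t))\<^sup>2)"
    using assms by (auto simp: L2_Bochner_def)
  have f: "AE t in time_measure T. f t \<in> elems X" using sm by (simp add: strongly_measurable_def)
  note m [measurable] = measurable_functional[OF sm]
  show 2: "integrable (time_measure T) (\<lambda>t. (\<Lambda> (f t))\<^sup>2)"
  proof (rule Bochner_Integration.integrable_bound)
    show "integrable (time_measure T) (\<lambda>t. K\<^sup>2 * (nrm X (f t))\<^sup>2)" using sq by simp
    show "AE t in time_measure T. norm ((\<Lambda> (f t))\<^sup>2) \<le> norm (K\<^sup>2 * (nrm X (f t))\<^sup>2)"
      using f
    proof eventually_elim
      case (elim t)
      then show ?case using power_mono[OF bound[OF elim] abs_ge_zero, of 2] by (simp add: power_mult_distrib)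
    qed
  qed measurable
  show "integrable (time_measure T) (\<lambda>t. \<Lambda> (f t))" by (rule integrable_time_square[OF m 2])
qed

text \<open>For simple functions the integral is a finite sum, with which \<open>\<Lambda>\<close> commutes. Both sides pass to
  the limit.\<close>

lemma integral_functional:
  assumes "has_integral_in T X f I"
  shows "integrable (time_measure T) (\<lambda>t. \<Lambda> (f t))" "(\<integral>t. \<Lambda> (f t) \<partial>time_measure T) = \<Lambda> I"
proof -
  obtain s where s: "\<And>n. simple_valued T X (s n)"
    and lim: "(\<lambda>n::nat. \<integral>\<^sup>+t. ennreal (nrm X (\<lambda>x. f t x - s n t x)) \<partial>time_measure T) \<longlonglongrightarrow> 0"
    and I: "(\<lambda>n. nrm X (\<lambda>x. simple_integral T (s n) x - I x)) \<longlonglongrightarrow> 0" "I \<in> elems X"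
    and sm: "strongly_measurable T X f" and f: "AE t in time_measure T. f t \<in> elems X"
    using assms by (auto simp: has_integral_in_def strongly_measurable_def)
  note meas [measurable] = measurable_functional[OF sm] simple_valued_measurable[OF s, of \<Lambda>]
  let ?e = "\<lambda>n. \<integral>\<^sup>+t. ennreal \<bar>\<Lambda> (f t) - \<Lambda> (s n t)\<bar> \<partial>time_measure T"
  have le: "AE t in time_measure T. \<bar>\<Lambda> (f t) - \<Lambda> (s n t)\<bar> \<le> K * nrm X (\<lambda>x. f t x - s n t x)" for n
    using f AE_space by eventually_elim (use s[of n] in \<open>auto intro!: lipschitz simp: simple_valued_def\<close>)
  have e: "?e \<longlonglongrightarrow> 0"
  proof (cases "K = 0")
    case True
    have "?e n = 0" for n
      using le[of n] True by (subst nn_integral_0_iff_AE) auto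
    then show ?thesis by simp
  next
    case False
    then have K: "K > 0" using K_nonneg by simp
    \<comment> \<open>The seminorm need not be a measurable function of time, so \<open>K\<close> is taken out of the
      integral on the other side of the inequality.\<close>
    have "?e n \<le> ennreal K * (\<integral>\<^sup>+t. ennreal (nrm X (\<lambda>x. f t x - s n t x)) \<partial>time_measure T)" for n
    proof -
      have "?e n = (\<integral>\<^sup>+t. ennreal K * ennreal (\<bar>\<Lambda> (f t) - \<Lambda> (s n t)\<bar> / K) \<partial>time_measure T)"
        using K by (intro nn_integral_cong) (simp flip: ennreal_mult)
      also have "\<dots> = ennreal K * (\<integral>\<^sup>+t. ennreal (\<bar>\<Lambda> (f t) - \<Lambda> (s n t)\<bar> / K) \<partial>time_measure T)"
        by (rule nn_integral_cmult) measurable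
      also have "\<dots> \<le> ennreal K * (\<integral>\<^sup>+t. ennreal (nrm X (\<lambda>x. f t x - s n t x)) \<partial>time_measure T)"
        using le[of n] K by (intro mult_left_mono nn_integral_mono_AE) (auto simp: field_simps intro!: ennreal_leI elim!: eventually_mono)
      finally show ?thesis .
    qed
    moreover have "(\<lambda>n. ennreal K * (\<integral>\<^sup>+t. ennreal (nrm X (\<lambda>x. f t x - s n t x)) \<partial>time_measure T)) \<longlonglongrightarrow> 0"
      using ennreal_tendsto_cmult[OF _ lim, of "ennreal K"] by simp
    ultimately show ?thesis
      by (intro tendsto_sandwich[OF _ _ tendsto_const, of 0 ?e]) (auto intro!: always_eventually)
  qed
  have s_int: "integrable (time_measure T) (\<lambda>t. \<Lambda> (s n t))"
    "(\<integral>t. \<Lambda> (s n t) \<partial>time_measure T) = \<Lambda> (simple_integral T (s n))" "simple_integral T (s n) \<in> elems X" for n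
  proof -
    have 1: "integrable (time_measure T) (\<lambda>t. 1::real)" by (rule integrable_time_bounded[of _ _ 1]) auto
    show "integrable (time_measure T) (\<lambda>t. \<Lambda> (s n t))" using simple_valued_integral(1)[OF s 1, of \<Lambda> n] by simp
    show "(\<integral>t. \<Lambda> (s n t) \<partial>time_measure T) = \<Lambda> (simple_integral T (s n))" "simple_integral T (s n) \<in> elems X"
      using weighted[OF s 1, of n] by (auto simp: simple_integral_eq[OF s])
  qed
  show int: "integrable (time_measure T) (\<lambda>t. \<Lambda> (f t))"
  proof -
    have "eventually (\<lambda>n. ?e n < 1) sequentially" using e order_tendstoD(2)[of ?e 0 sequentially 1] by simp
    then obtain n where n: "?e n < 1" by (auto simp: eventually_sequentially)
    have "integrable (time_measure T) (\<lambda>t. \<Lambda> (f t) - \<Lambda> (s n t))"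
    proof (rule integrableI_bounded)
      show "(\<lambda>t. \<Lambda> (f t) - \<Lambda> (s n t)) \<in> borel_measurable (time_measure T)" by measurable
      show "(\<integral>\<^sup>+ t. ennreal (norm (\<Lambda> (f t) - \<Lambda> (s n t))) \<partial>time_measure T) < \<infinity>"
        using n by (auto intro: less_trans)
    qed
    from Bochner_Integration.integrable_add[OF this s_int(1)[of n]] show ?thesis by simp
  qed
  have "(\<lambda>n. \<integral>t. \<Lambda> (s n t) \<partial>time_measure T) \<longlonglongrightarrow> (\<integral>t. \<Lambda> (f t) \<partial>time_measure T)"
    by (rule tendsto_L1_int[OF s_int(1) int]) (use e in \<open>simp add: abs_minus_commute\<close>)
  moreover have "(\<lambda>n. \<Lambda> (simple_integral T (s n))) \<longlonglongrightarrow> \<Lambda> I"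
  proof -
    have "(\<lambda>n. K * nrm X (\<lambda>x. simple_integral T (s n) x - I x)) \<longlonglongrightarrow> 0"
      using tendsto_mult_left[OF I(1), of K] by simp
    then have "(\<lambda>n. \<Lambda> (simple_integral T (s n)) - \<Lambda> I) \<longlonglongrightarrow> 0"
      by (rule Lim_null_comparison[rotated]) (use lipschitz[OF s_int(3) I(2)] in auto)
    then show ?thesis by (rule LIM_zero_cancel)
  qed
  ultimately show "(\<integral>t. \<Lambda> (f t) \<partial>time_measure T) = \<Lambda> I"
    using LIMSEQ_unique by (simp add: s_int(2)) blast
qed

lemma time_deriv_functional:
  assumes "is_time_deriv T X v w" "\<phi> \<in> test_functions {0<..<T}"
  shows "integrable (time_measure T) (\<lambda>t. deriv \<phi> t * \<Lambda> (v t))" "integrable (time_measure T) (\<lambda>t. \<phi> t * \<Lambda> (w t))"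
    "(\<integral>t. deriv \<phi> t * \<Lambda> (v t) \<partial>time_measure T) = - (\<integral>t. \<phi> t * \<Lambda> (w t) \<partial>time_measure T)"
proof -
  obtain I where I: "has_integral_in T X (\<lambda>t x. deriv \<phi> t * v t x) I" "has_integral_in T X (\<lambda>t x. \<phi> t * w t x) (\<lambda>x. - I x)"
    using assms by (auto simp: is_time_deriv_def)
  have vw: "strongly_measurable T X v" "strongly_measurable T X w"
    using assms(1) by (auto simp: is_time_deriv_def L2_Bochner_def)
  then have in_X: "AE t in time_measure T. v t \<in> elems X" "AE t in time_measure T. w t \<in> elems X"
    by (auto simp: strongly_measurable_def)
  have \<phi>: "smooth \<phi>" using assms(2) by (auto elim: test_functionsE)
  have m: "(\<lambda>t. deriv \<phi> t * \<Lambda> (v t)) \<in> borel_measurable (time_measure T)" "(\<lambda>t. \<phi> t * \<Lambda> (w t)) \<in> borel_measurable (time_measure T)"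
    using measurable_functional[OF vw(1)] measurable_functional[OF vw(2)]
      smooth_measurable[OF \<phi>] smooth_measurable[OF smooth_deriv(2)[OF \<phi>]] by (auto intro!: borel_measurable_times)
  have ae: "AE t in time_measure T. \<Lambda> (\<lambda>x. deriv \<phi> t * v t x) = deriv \<phi> t * \<Lambda> (v t)"
    "AE t in time_measure T. \<Lambda> (\<lambda>x. \<phi> t * w t x) = \<phi> t * \<Lambda> (w t)"
    using in_X by (eventually_elim, simp add: scale)+
  note i1 = integral_functional[OF I(1)] and i2 = integral_functional[OF I(2)]
  show "integrable (time_measure T) (\<lambda>t. deriv \<phi> t * \<Lambda> (v t))" "integrable (time_measure T) (\<lambda>t. \<phi> t * \<Lambda> (w t))"
    using Bochner_Integration.integrable_cong_AE_imp[OF i1(1) m(1)] ae(1)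
      Bochner_Integration.integrable_cong_AE_imp[OF i2(1) m(2)] ae(2) by auto
  have "I \<in> elems X" using I by (simp add: has_integral_in_def)
  then have "\<Lambda> (\<lambda>x. - I x) = - \<Lambda> I" using scale[of I "-1"] by simp
  moreover have "(\<integral>t. deriv \<phi> t * \<Lambda> (v t) \<partial>time_measure T) = \<Lambda> I"
    using integral_cong_AE[OF _ m(1) ae(1)] i1 borel_measurable_integrable by metis
  moreover have "(\<integral>t. \<phi> t * \<Lambda> (w t) \<partial>time_measure T) = \<Lambda> (\<lambda>x. - I x)"
    using integral_cong_AE[OF _ m(2) ae(2)] i2 borel_measurable_integrable by metis
  ultimately show "(\<integral>t. deriv \<phi> t * \<Lambda> (v t) \<partial>time_measure T) = - (\<integral>t. \<phi> t * \<Lambda> (w t) \<partial>time_measure T)"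
    by simp
qed

lemma initial_value_functional:
  assumes v: "has_initial_value T X v v0" and "AE t in time_measure T. v t \<in> elems X" "v0 \<in> elems X" "0 < T"
  obtains p where "AE t in time_measure T. \<Lambda> (v t) = p t" "(p \<longlongrightarrow> \<Lambda> v0) (at_right 0)"
proof -
  obtain w where w: "\<And>t. t \<in> {0..T} \<Longrightarrow> w t \<in> elems X"
    "\<And>t. t \<in> {0..T} \<Longrightarrow> ((\<lambda>s. nrm X (\<lambda>x. w s x - w t x)) \<longlongrightarrow> 0) (at t within {0..T})"
    "AE t in time_measure T. nrm X (\<lambda>x. v t x - w t x) = 0" "nrm X (\<lambda>x. w 0 x - v0 x) = 0"
    using v unfolding has_initial_value_def by blast
  have 0: "\<Lambda> (w 0) = \<Lambda> v0" using lipschitz[OF w(1) assms(3), of 0] w(4) assms(4) by simp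
  show ?thesis
  proof (rule that[of "\<lambda>t. \<Lambda> (w t)"])
    show "AE t in time_measure T. \<Lambda> (v t) = \<Lambda> (w t)"
      using w(3) assms(2) AE_space
    proof eventually_elim
      case (elim t)
      then show ?case using lipschitz[OF elim(2) w(1), of t] by simp
    qed
    have "((\<lambda>s. \<Lambda> (w s) - \<Lambda> (w 0)) \<longlongrightarrow> 0) (at 0 within {0..T})"
    proof (rule Lim_null_comparison)
      show "((\<lambda>s. K * nrm X (\<lambda>x. w s x - w 0 x)) \<longlongrightarrow> 0) (at 0 within {0..T})"
        using tendsto_mult_left[OF w(2)[of 0], of K] assms(4) by simp
      show "eventually (\<lambda>s. norm (\<Lambda> (w s) - \<Lambda> (w 0)) \<le> K * nrm X (\<lambda>x. w s x - w 0 x)) (at 0 within {0..T})"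
        using lipschitz w(1) assms(4) by (auto simp: eventually_at_filter)
    qed
    then have "((\<lambda>s. \<Lambda> (w s)) \<longlongrightarrow> \<Lambda> v0) (at 0 within {0..T})" unfolding 0 by (rule LIM_zero_cancel)
    then show "((\<lambda>s. \<Lambda> (w s)) \<longlongrightarrow> \<Lambda> v0) (at_right 0)" using assms(4) by (simp add: at_within_Icc_at_right)
  qed
qed

end

subsection \<open>Value spaces with a semi-inner product\<close>

locale inner_fun_space = semi_inner "elems X" B for X :: "'x fun_space" and B +
  assumes nrm_eq: "nrm X = form_norm B"
begin

lemma inner_functional:
  assumes "v \<in> elems X"
  shows "bounded_functional X (\<lambda>f. B f v) (form_norm B v)"
proof
  fix f assume "f \<in> elems X"
  then show "\<bar>B f v\<bar> \<le> form_norm B v * nrm X f"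
    using cauchy_schwarz[OF _ assms] by (simp add: nrm_eq mult.commute)
qed (use assms in \<open>auto intro: zero_in add_in scale_in add_left scale_left norm_nonneg\<close>)

lemma nrm_nonneg: "f \<in> elems X \<Longrightarrow> nrm X f \<ge> 0"
  by (simp add: nrm_eq norm_nonneg)

lemma nrm_lipschitz:
  assumes "f \<in> elems X" "g \<in> elems X"
  shows "\<bar>nrm X f - nrm X g\<bar> \<le> 1 * nrm X (\<lambda>x. f x - g x)"
  using norm_diff_le[OF assms] norm_diff_le[OF assms(2,1)] norm_diff_commute[OF assms]
  by (simp add: nrm_eq abs_le_iff)

lemma measurable_nrm:
  "strongly_measurable T X f \<Longrightarrow> (\<lambda>t. nrm X (f t)) \<in> borel_measurable (time_measure T)"
  by (rule strongly_measurable_lipschitz[OF _ nrm_lipschitz])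

lemma L2_Bochner_nrm:
  "f \<in> L2_Bochner T X \<Longrightarrow> integrable (time_measure T) (\<lambda>t. nrm X (f t))"
  by (rule integrable_time_square) (simp_all add: L2_Bochner_def measurable_nrm)

lemma simple_valued_strongly_measurable:
  "simple_valued T X s \<Longrightarrow> strongly_measurable T X s"
  unfolding strongly_measurable_def
proof (intro conjI exI[of _ "\<lambda>n. s"] allI)
  assume s: "simple_valued T X s"
  show "AE t in time_measure T. s t \<in> elems X" using s by (intro AE_I2) (simp add: simple_valued_def)
  show "AE t in time_measure T. (\<lambda>n::nat. nrm X (\<lambda>x. s t x - s t x)) \<longlonglongrightarrow> 0"
    by (intro AE_I2) (simp add: nrm_eq norm_zero)
qed

lemma simple_valued_diff:
  assumes "simple_valued T X s" "simple_valued T X r"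
  shows "simple_valued T X (\<lambda>t x. s t x - r t x)"
  using assms simple_function_compose2[of "time_measure T" s r "\<lambda>f g x. f x - g x"]
  by (auto simp: simple_valued_def diff_in)

lemma strongly_measurable_diff:
  assumes "strongly_measurable T X f" "strongly_measurable T X g"
  shows "strongly_measurable T X (\<lambda>t x. f t x - g t x)"
proof -
  obtain s where s: "\<And>n. simple_valued T X (s n)" "AE t in time_measure T. (\<lambda>n::nat. nrm X (\<lambda>x. f t x - s n t x)) \<longlonglongrightarrow> 0"
    and f: "AE t in time_measure T. f t \<in> elems X"
    using assms(1) by (auto simp: strongly_measurable_def)
  obtain r where r: "\<And>n. simple_valued T X (r n)" "AE t in time_measure T. (\<lambda>n::nat. nrm X (\<lambda>x. g t x - r n t x)) \<longlonglongrightarrow> 0"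
    and g: "AE t in time_measure T. g t \<in> elems X"
    using assms(2) by (auto simp: strongly_measurable_def)
  have "simple_valued T X (\<lambda>t x. s n t x - r n t x)" for n
    by (rule simple_valued_diff[OF s(1) r(1)])
  moreover have "AE t in time_measure T. (\<lambda>n. nrm X (\<lambda>x. (f t x - g t x) - (s n t x - r n t x))) \<longlonglongrightarrow> 0"
    using s(2) r(2) f g AE_space
  proof eventually_elim
    case (elim t)
    have sr: "s n t \<in> elems X" "r n t \<in> elems X" for n using s(1)[of n] r(1)[of n] elim(5) by (auto simp: simple_valued_def)
    have lim: "(\<lambda>n. nrm X (\<lambda>x. f t x - s n t x) + nrm X (\<lambda>x. g t x - r n t x)) \<longlonglongrightarrow> 0"
      using tendsto_add[OF elim(1,2)] by simp
    have "norm (nrm X (\<lambda>x. (f t x - g t x) - (s n t x - r n t x)))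
        \<le> nrm X (\<lambda>x. f t x - s n t x) + nrm X (\<lambda>x. g t x - r n t x)" for n
    proof -
      have e: "(\<lambda>x. (f t x - g t x) - (s n t x - r n t x)) = (\<lambda>x. (f t x - s n t x) + (r n t x - g t x))" by auto
      have "form_norm B (\<lambda>x. (f t x - s n t x) + (r n t x - g t x))
          \<le> form_norm B (\<lambda>x. f t x - s n t x) + form_norm B (\<lambda>x. r n t x - g t x)"
        by (intro norm_triangle diff_in elim sr)
      then show ?thesis
        unfolding nrm_eq e using norm_diff_commute[OF elim(4) sr(2)[of n]]
          norm_nonneg[OF add_in[OF diff_in[OF elim(3) sr(1)] diff_in[OF sr(2) elim(4)]], of n n] by simp
    qed
    then show ?case by (intro Lim_null_comparison[OF always_eventually lim] allI)
  qed
  moreover have "AE t in time_measure T. (\<lambda>x. f t x - g t x) \<in> elems X"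
    using f g by eventually_elim (rule diff_in)
  ultimately show ?thesis unfolding strongly_measurable_def by (intro conjI exI[of _ "\<lambda>n t x. s n t x - r n t x"]) auto
qed

lemma L2_Bochner_diff:
  assumes "f \<in> L2_Bochner T X" "g \<in> L2_Bochner T X"
  shows "(\<lambda>t x. f t x - g t x) \<in> L2_Bochner T X"
proof -
  have sm: "strongly_measurable T X f" "strongly_measurable T X g" using assms by (auto simp: L2_Bochner_def)
  have fg: "AE t in time_measure T. f t \<in> elems X" "AE t in time_measure T. g t \<in> elems X"
    using sm by (auto simp: strongly_measurable_def)
  note d = strongly_measurable_diff[OF sm]
  note [measurable] = measurable_nrm[OF d]
  have "integrable (time_measure T) (\<lambda>t. (nrm X (\<lambda>x. f t x - g t x))\<^sup>2)"
  proof (rule Bochner_Integration.integrable_bound)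
    show "integrable (time_measure T) (\<lambda>t. 2 * (nrm X (f t))\<^sup>2 + 2 * (nrm X (g t))\<^sup>2)"
      using assms by (auto simp: L2_Bochner_def)
    show "AE t in time_measure T. norm ((nrm X (\<lambda>x. f t x - g t x))\<^sup>2) \<le> norm (2 * (nrm X (f t))\<^sup>2 + 2 * (nrm X (g t))\<^sup>2)"
      using fg
    proof eventually_elim
      case (elim t)
      \<comment> \<open>the parallelogram identity\<close>
      have "B (\<lambda>x. f t x - g t x) (\<lambda>x. f t x - g t x) + B (\<lambda>x. f t x + g t x) (\<lambda>x. f t x + g t x) = 2 * B (f t) (f t) + 2 * B (g t) (g t)"
        using elim by (simp add: diff_left diff_right add_left add_right diff_in add_in)
      then show ?case
        using elim nonneg[OF add_in[OF elim]] by (simp add: nrm_eq norm_power2 diff_in nonneg)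
    qed
  qed measurable
  then show ?thesis using d by (simp add: L2_Bochner_def)
qed

lemma L2_Bochner_mult:
  assumes \<phi>: "\<phi> \<in> borel_measurable (time_measure T)" "integrable (time_measure T) (\<lambda>t. (\<phi> t)\<^sup>2)" and g: "g \<in> elems X"
  shows "(\<lambda>t x. \<phi> t * g x) \<in> L2_Bochner T X"
proof -
  obtain s where s: "\<And>i. simple_function (time_measure T) (s i)" "\<And>t. t \<in> space (time_measure T) \<Longrightarrow> (\<lambda>i. s i t) \<longlonglongrightarrow> \<phi> t"
    using integrable_implies_simple_function_sequence[OF integrable_time_square[OF \<phi>]] by metis
  have "simple_valued T X (\<lambda>t x. s n t * g x)" for n
    using s(1)[of n] simple_function_compose1[of "time_measure T" "s n" "\<lambda>c x. c * g x"] g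
    by (auto simp: simple_valued_def scale_in)
  moreover have "AE t in time_measure T. (\<lambda>n. nrm X (\<lambda>x. \<phi> t * g x - s n t * g x)) \<longlonglongrightarrow> 0"
  proof (rule AE_I2)
    fix t assume "t \<in> space (time_measure T)"
    from s(2)[OF this] have "(\<lambda>n. \<bar>\<phi> t - s n t\<bar> * nrm X g) \<longlonglongrightarrow> \<bar>\<phi> t - \<phi> t\<bar> * nrm X g"
      by (intro tendsto_intros)
    moreover have "nrm X (\<lambda>x. \<phi> t * g x - s n t * g x) = \<bar>\<phi> t - s n t\<bar> * nrm X g" for n
      using norm_scale[OF g, of "\<phi> t - s n t"] by (simp add: nrm_eq left_diff_distrib)
    ultimately show "(\<lambda>n. nrm X (\<lambda>x. \<phi> t * g x - s n t * g x)) \<longlonglongrightarrow> 0" by simp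
  qed
  ultimately have "strongly_measurable T X (\<lambda>t x. \<phi> t * g x)"
    unfolding strongly_measurable_def using g by (intro conjI exI[of _ "\<lambda>n t x. s n t * g x"]) (auto simp: scale_in)
  moreover have "nrm X (\<lambda>x. \<phi> t * g x) = \<bar>\<phi> t\<bar> * nrm X g" for t using norm_scale[OF g] by (simp add: nrm_eq)
  ultimately show ?thesis using \<phi>(2) by (simp add: L2_Bochner_def power_mult_distrib)
qed

text \<open>The simple functions from strong measurability only converge pointwise. Setting them to 0 where
  their norm exceeds twice that of \<open>f\<close> keeps the convergence and provides the dominating function
  \<open>3 nrm X (f t)\<close>.\<close>

lemma simple_approx:
  assumes sm: "strongly_measurable T X f" and int: "integrable (time_measure T) (\<lambda>t. nrm X (f t))" and e: "e > 0"
  obtains s where "simple_valued T X s" "integrable (time_measure T) (\<lambda>t. nrm X (\<lambda>x. f t x - s t x))"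
    "(\<integral>t. nrm X (\<lambda>x. f t x - s t x) \<partial>time_measure T) < e"
proof -
  obtain s where s: "\<And>n. simple_valued T X (s n)" "AE t in time_measure T. (\<lambda>n::nat. nrm X (\<lambda>x. f t x - s n t x)) \<longlonglongrightarrow> 0"
    and f: "AE t in time_measure T. f t \<in> elems X"
    using sm by (auto simp: strongly_measurable_def)
  note mf [measurable] = measurable_nrm[OF sm]
  note ms [measurable] = simple_valued_measurable[OF s(1), of "nrm X"]
  define r where "r n t = (if nrm X (s n t) \<le> 2 * nrm X (f t) then s n t else (\<lambda>x. 0))" for n t
  have r: "simple_valued T X (r n)" for n
  proof -
    have "{t \<in> space (time_measure T). nrm X (s n t) \<le> 2 * nrm X (f t)} \<in> sets (time_measure T)" by measurable
    then have "simple_function (time_measure T) (r n)"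
      unfolding r_def[abs_def] using s(1)[of n] by (intro simple_function_If) (auto simp: simple_valued_def)
    then show ?thesis using s(1)[of n] zero_in by (auto simp: simple_valued_def r_def)
  qed
  note mr [measurable] = measurable_nrm[OF strongly_measurable_diff[OF sm simple_valued_strongly_measurable[OF r]]]
  have bound: "AE t in time_measure T. norm (nrm X (\<lambda>x. f t x - r n t x)) \<le> 3 * nrm X (f t)" for n
    using f AE_space
  proof eventually_elim
    case (elim t)
    have rt: "r n t \<in> elems X" using r[of n] elim(2) by (simp add: simple_valued_def)
    have "nrm X (r n t) \<le> 2 * nrm X (f t)"
      using norm_nonneg[OF elim(1)] by (simp add: r_def nrm_eq norm_zero)
    moreover have "nrm X (\<lambda>x. f t x - r n t x) \<le> nrm X (f t) + nrm X (r n t)"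
      using norm_triangle[OF elim(1) scale_in[OF rt, of "-1"]] norm_scale[OF rt, of "-1"] by (simp add: nrm_eq)
    ultimately show ?case using norm_nonneg[OF diff_in[OF elim(1) rt]] by (simp add: nrm_eq)
  qed
  have lim: "AE t in time_measure T. (\<lambda>n. nrm X (\<lambda>x. f t x - r n t x)) \<longlonglongrightarrow> 0"
    using f s(2) AE_space
  proof eventually_elim
    case (elim t)
    have st: "s n t \<in> elems X" "r n t \<in> elems X" for n using s(1)[of n] r[of n] elim(3) by (auto simp: simple_valued_def)
    show ?case
    proof (cases "nrm X (f t) = 0")
      case True
      have "nrm X (\<lambda>x. f t x - r n t x) = 0" for n
      proof -
        have "nrm X (r n t) \<le> 0" using True by (simp add: r_def nrm_eq norm_zero)
        moreover have "nrm X (\<lambda>x. f t x - r n t x) \<le> nrm X (f t) + nrm X (r n t)"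
          using norm_triangle[OF elim(1) scale_in[OF st(2)[of n], of "-1"]] norm_scale[OF st(2)[of n], of "-1"] by (simp add: nrm_eq)
        ultimately show ?thesis using True norm_nonneg[OF diff_in[OF elim(1) st(2)[of n]]] by (simp add: nrm_eq)
      qed
      then show ?thesis by simp
    next
      case False
      then have p: "nrm X (f t) > 0" using norm_nonneg[OF elim(1)] by (simp add: nrm_eq)
      from order_tendstoD(2)[OF elim(2) p]
      have "eventually (\<lambda>n. nrm X (\<lambda>x. f t x - r n t x) = nrm X (\<lambda>x. f t x - s n t x)) sequentially"
      proof eventually_elim
        case (elim n)
        have "nrm X (s n t) \<le> nrm X (f t) + nrm X (\<lambda>x. f t x - s n t x)"
          using nrm_lipschitz[OF \<open>f t \<in> elems X\<close> st(1)[of n]] by (simp add: abs_le_iff)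
        then show ?case using elim by (simp add: r_def)
      qed
      then show ?thesis using elim(2) tendsto_cong by fastforce
    qed
  qed
  have "(\<lambda>n. \<integral>t. nrm X (\<lambda>x. f t x - r n t x) \<partial>time_measure T) \<longlonglongrightarrow> (\<integral>t. 0 \<partial>time_measure T)"
    by (rule integral_dominated_convergence[where w = "\<lambda>t. 3 * nrm X (f t)"]) (use int lim bound in auto)
  then have "eventually (\<lambda>n. (\<integral>t. nrm X (\<lambda>x. f t x - r n t x) \<partial>time_measure T) < e) sequentially"
    using e by (auto intro: order_tendstoD(2))
  then obtain n where n: "(\<integral>t. nrm X (\<lambda>x. f t x - r n t x) \<partial>time_measure T) < e"
    by (auto simp: eventually_sequentially)
  have "integrable (time_measure T) (\<lambda>t. nrm X (\<lambda>x. f t x - r n t x))"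
  proof (rule Bochner_Integration.integrable_bound)
    show "integrable (time_measure T) (\<lambda>t. 3 * nrm X (f t))" using int by simp
    show "AE t in time_measure T. norm (nrm X (\<lambda>x. f t x - r n t x)) \<le> norm (3 * nrm X (f t))"
      using bound[of n] by eventually_elim simp
  qed measurable
  then show ?thesis using that[OF r] n by blast
qed

end

section \<open>Weak time derivatives and initial values\<close>

lemma time_integral_FTC:
  fixes f :: "real \<Rightarrow> real"
  assumes f: "\<And>t. (f has_real_derivative f' t) (at t)" and f': "continuous_on UNIV f'" and T: "0 \<le> a" "a \<le> b" "b \<le> T"
  shows "(\<integral>t. f' t * indicator {a..b} t \<partial>time_measure T) = f b - f a"
proof -
  have "(\<integral>t. f' t * indicator {a..b} t \<partial>time_measure T) = (\<integral>t. indicator {0<..<T} t *\<^sub>R (f' t * indicator {a..b} t) \<partial>lebesgue)"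
    by (rule integral_restrict_space) simp
  also have "\<dots> = (\<integral>t. f' t * indicator {a..b} t \<partial>lebesgue)"
  proof (rule integral_cong_AE)
    have "AE t in lebesgue. t \<noteq> 0" "AE t in lebesgue. t \<noteq> T"
      by (intro AE_completion AE_lborel_singleton)+
    then show "AE t in lebesgue. indicator {0<..<T} t *\<^sub>R (f' t * indicator {a..b} t) = f' t * indicator {a..b} t"
      by eventually_elim (use T in \<open>auto simp: indicator_def\<close>)
    have f'm: "f' \<in> borel_measurable lebesgue"
      using f' by (intro measurable_completion) (simp add: borel_measurable_continuous_onI)
    show "(\<lambda>t. indicator {0<..<T} t *\<^sub>R (f' t * indicator {a..b} t)) \<in> borel_measurable lebesgue"
      by (intro borel_measurable_scaleR borel_measurable_times f'm borel_measurable_indicator) auto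
    show "(\<lambda>t. f' t * indicator {a..b} t) \<in> borel_measurable lebesgue"
      by (intro borel_measurable_times f'm borel_measurable_indicator) auto
  qed
  also have "\<dots> = (\<integral>t. f' t * indicator {a..b} t \<partial>lborel)"
    using f' by (intro integral_completion borel_measurable_times borel_measurable_indicator)
      (auto simp: borel_measurable_continuous_onI)
  also have "\<dots> = f b - f a"
    using f f' by (intro integral_FTC_Icc_real T) (auto simp: continuous_on_eq_continuous_at)
  finally show ?thesis .
qed

lemma time_integral_FTC_full:
  fixes f :: "real \<Rightarrow> real"
  assumes f: "\<And>t. (f has_real_derivative f' t) (at t)" and f': "continuous_on UNIV f'" and T: "0 \<le> T"
  shows "(\<integral>t. f' t \<partial>time_measure T) = f T - f 0"
proof -
  have "(\<integral>t. f' t \<partial>time_measure T) = (\<integral>t. f' t * indicator {0..T} t \<partial>time_measure T)"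
    by (intro Bochner_Integration.integral_cong) auto
  then show ?thesis using time_integral_FTC[OF f f', of 0 T T] T by simp
qed

lemma DERIV_locally_const:
  fixes f :: "real \<Rightarrow> real"
  assumes "open S" "x \<in> S" "\<And>y. y \<in> S \<Longrightarrow> f y = c"
  shows "(f has_real_derivative 0) (at x)"
  by (rule has_field_derivative_transform_within_open[OF DERIV_const assms(1,2)]) (simp add: assms(3))

lemma continuous_time_measurable:
  "continuous_on UNIV f \<Longrightarrow> (f :: real \<Rightarrow> real) \<in> borel_measurable (time_measure T)"
  by (intro measurable_restrict_space1 measurable_completion) (simp add: borel_measurable_continuous_onI)

lemma continuous_time_bounded:
  assumes "continuous_on UNIV (f :: real \<Rightarrow> real)"
  obtains C where "C \<ge> 0" "\<And>t. 0 \<le> t \<Longrightarrow> t \<le> T \<Longrightarrow> \<bar>f t\<bar> \<le> C"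
proof -
  have "bounded (f ` {0..T})"
    using assms by (intro compact_imp_bounded compact_continuous_image) (auto intro: continuous_on_subset)
  then obtain C where "\<forall>x\<in>f ` {0..T}. norm x \<le> C" using bounded_iff by blast
  then have C: "\<bar>f t\<bar> \<le> C" if "t \<in> {0..T}" for t using that by auto
  show ?thesis by (rule that[of "max C 0"]) (auto intro: C order_trans simp: le_max_iff_disj)
qed

lemma continuous_time_integrable:
  assumes "continuous_on UNIV (f :: real \<Rightarrow> real)"
  shows "integrable (time_measure T) f"
proof -
  obtain C where "C \<ge> 0" "\<And>t. 0 \<le> t \<Longrightarrow> t \<le> T \<Longrightarrow> \<bar>f t\<bar> \<le> C"
    using continuous_time_bounded[OF assms] by blast
  then show ?thesis by (intro integrable_time_bounded[of _ _ C] continuous_time_measurable assms) auto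
qed

lemma continuous_mult_integrable:
  assumes "continuous_on UNIV (k :: real \<Rightarrow> real)" "integrable (time_measure T) f"
  shows "integrable (time_measure T) (\<lambda>t. k t * f t)"
proof -
  obtain C where "C \<ge> 0" "\<And>t. 0 \<le> t \<Longrightarrow> t \<le> T \<Longrightarrow> \<bar>k t\<bar> \<le> C"
    using continuous_time_bounded[OF assms(1)] by blast
  then show ?thesis by (intro integrable_mult_bounded[of _ _ _ C] continuous_time_measurable assms) auto
qed

text \<open>The weak derivative \<open>q\<close> of \<open>p\<close> is tested with functions that vanish near 0. A test function
  \<open>\<phi>\<close> that does not is multiplied by a cutoff \<open>\<eta>\<^sub>n\<close> rising from 0 to 1 on \<open>[1/n, 2/n]\<close>. The
  derivatives of the \<open>\<eta>\<^sub>n\<close> are nonnegative with integral 1, and so produce the initial value of \<open>p\<close>.\<close>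

lemma weak_deriv_initial:
  fixes p q \<phi> :: "real \<Rightarrow> real"
  assumes T: "0 < T" and p: "integrable (time_measure T) p" and q: "integrable (time_measure T) q"
    and weak: "\<And>\<psi>. \<psi> \<in> test_functions {0<..<T} \<Longrightarrow>
      (\<integral>t. deriv \<psi> t * p t \<partial>time_measure T) = - (\<integral>t. \<psi> t * q t \<partial>time_measure T)"
    and p': "AE t in time_measure T. p t = p' t" "(p' \<longlongrightarrow> p0) (at_right 0)"
    and \<phi>: "smooth \<phi>" "\<And>t. t > c \<Longrightarrow> \<phi> t = 0" and c: "c < T"
  shows "(\<integral>t. deriv \<phi> t * p t \<partial>time_measure T) = - (\<integral>t. \<phi> t * q t \<partial>time_measure T) - p0 * \<phi> 0"
proof -
  define \<eta> where "\<eta> n t = smooth_step (real n * t + (-1))" for n t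
  have \<eta>: "smooth (\<eta> n)" for n unfolding \<eta>_def[abs_def] by (rule smooth_affine[OF smooth_smooth_step])
  have d\<eta>: "deriv (\<eta> n) t = deriv smooth_step (real n * t + (-1)) * real n" for n t
  proof (rule DERIV_imp_deriv)
    have "((\<lambda>t. real n * t + (-1)) has_real_derivative real n) (at t)" by (auto intro!: derivative_eq_intros)
    then show "(\<eta> n has_real_derivative deriv smooth_step (real n * t + (-1)) * real n) (at t)"
      unfolding \<eta>_def[abs_def] by (rule DERIV_chain2[OF smooth_deriv(1)[OF smooth_smooth_step]])
  qed
  have cont: "continuous_on UNIV \<phi>" "continuous_on UNIV (deriv \<phi>)" "continuous_on UNIV (\<eta> n)" "continuous_on UNIV (deriv (\<eta> n))" for n
    using \<phi>(1) \<eta> by (auto intro: smooth_continuous smooth_deriv)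
  have \<eta>_nonneg: "deriv (\<eta> n) t \<ge> 0" for n t by (simp add: d\<eta> deriv_smooth_step_nonneg)
  have \<eta>_range: "0 \<le> \<eta> n t" "\<eta> n t \<le> 1" for n t by (simp_all add: \<eta>_def smooth_step_range)
  have \<eta>_0: "\<eta> n t = 0" if "real n * t \<le> 1" for n t using that by (simp add: \<eta>_def smooth_step_0)
  have \<eta>_1: "\<eta> n t = 1" if "real n * t \<ge> 2" for n t using that by (simp add: \<eta>_def smooth_step_1)
  have d\<eta>_0: "deriv (\<eta> n) t = 0" if "real n * t > 2" for n t
  proof (rule DERIV_imp_deriv)
    have "open {t. real n * t > 2}" by (intro open_Collect_less continuous_intros)
    then show "(\<eta> n has_real_derivative 0) (at t)"
      by (rule DERIV_locally_const[where c = 1]) (use \<eta>_1 that in auto)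
  qed
  have \<eta>_lim: "(\<lambda>n. \<eta> n t) \<longlonglongrightarrow> 1" if "t > 0" for t
  proof -
    obtain N where N: "2 / t \<le> real N" using real_arch_simple by blast
    have "\<eta> n t = 1" if "n \<ge> N" for n
    proof (rule \<eta>_1)
      have "2 / t \<le> real n" using N that by simp
      then show "2 \<le> real n * t" using \<open>t > 0\<close> by (simp add: field_simps)
    qed
    then show ?thesis by (intro tendsto_eventually) (auto simp: eventually_sequentially)
  qed
  have eq: "- (\<integral>t. \<eta> n t * (\<phi> t * q t) \<partial>time_measure T)
      = (\<integral>t. \<eta> n t * (deriv \<phi> t * p t) \<partial>time_measure T) + (\<integral>t. deriv (\<eta> n) t * (\<phi> t * p t) \<partial>time_measure T)"
    if "n > 0" for n
  proof -
    have test: "(\<lambda>t. \<phi> t * \<eta> n t) \<in> test_functions {0<..<T}"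
    proof (rule test_functionsI)
      show "smooth (\<lambda>t. \<phi> t * \<eta> n t)" by (intro smooth_mult \<phi> \<eta>)
      have "0 < 1 / real n" using that by simp
      then show "{1 / real n..c} \<subseteq> {0<..<T}" using c by (auto simp del: zero_less_divide_1_iff)
      show "\<phi> t * \<eta> n t = 0" if "t \<notin> {1 / real n..c}" for t
      proof -
        have "t < 1 / real n \<or> t > c" using that by auto
        then show ?thesis
        proof
          assume "t < 1 / real n"
          then have "real n * t \<le> 1" using \<open>n > 0\<close> by (simp add: field_simps)
          then show ?thesis by (simp add: \<eta>_0)
        qed (simp add: \<phi>(2))
      qed
    qed simp
    have d: "deriv (\<lambda>t. \<phi> t * \<eta> n t) t = \<eta> n t * deriv \<phi> t + deriv (\<eta> n) t * \<phi> t" for t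
      using DERIV_mult[OF smooth_deriv(1)[OF \<phi>(1)] smooth_deriv(1)[OF \<eta>[of n]], of t]
      by (intro DERIV_imp_deriv) (simp add: algebra_simps)
    have i: "integrable (time_measure T) (\<lambda>t. \<eta> n t * (deriv \<phi> t * p t))" "integrable (time_measure T) (\<lambda>t. deriv (\<eta> n) t * (\<phi> t * p t))"
      by (intro continuous_mult_integrable cont p)+
    have "(\<integral>t. deriv (\<lambda>t. \<phi> t * \<eta> n t) t * p t \<partial>time_measure T)
        = (\<integral>t. \<eta> n t * (deriv \<phi> t * p t) + deriv (\<eta> n) t * (\<phi> t * p t) \<partial>time_measure T)"
      unfolding d by (intro Bochner_Integration.integral_cong) (auto simp: algebra_simps)
    also have "\<dots> = (\<integral>t. \<eta> n t * (deriv \<phi> t * p t) \<partial>time_measure T) + (\<integral>t. deriv (\<eta> n) t * (\<phi> t * p t) \<partial>time_measure T)"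
      by (rule Bochner_Integration.integral_add[OF i])
    finally show ?thesis using weak[OF test] by (simp add: mult.assoc mult.left_commute)
  qed
  have dct: "(\<lambda>n. \<integral>t. \<eta> n t * f t \<partial>time_measure T) \<longlonglongrightarrow> (\<integral>t. f t \<partial>time_measure T)"
    if f: "integrable (time_measure T) f" for f
  proof (rule integral_dominated_convergence)
    show "integrable (time_measure T) (\<lambda>t. \<bar>f t\<bar>)" using f by simp
    show "AE t in time_measure T. (\<lambda>n. \<eta> n t * f t) \<longlonglongrightarrow> f t"
      using tendsto_mult_right[OF \<eta>_lim] by (intro AE_I2) force
    show "AE t in time_measure T. norm (\<eta> n t * f t) \<le> \<bar>f t\<bar>" for n
      using \<eta>_range by (intro AE_I2) (auto simp: abs_mult mult_left_le_one_le)
    show "(\<lambda>t. \<eta> n t * f t) \<in> borel_measurable (time_measure T)" for n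
      using continuous_mult_integrable[OF cont(3) f] by (rule borel_measurable_integrable)
  qed (use f in auto)
  have mass: "(\<integral>t. deriv (\<eta> n) t \<partial>time_measure T) = 1" if "real n * T \<ge> 2" for n
    using time_integral_FTC_full[OF smooth_deriv(1)[OF \<eta>[of n]] cont(4)[of n], of T] T \<eta>_0[of n 0] \<eta>_1[OF that] by simp
  have init: "(\<lambda>n. \<integral>t. deriv (\<eta> n) t * (\<phi> t * p t) \<partial>time_measure T) \<longlonglongrightarrow> p0 * \<phi> 0"
  proof (rule LIMSEQ_I)
    fix e :: real assume e: "e > 0"
    have "(\<phi> \<longlongrightarrow> \<phi> 0) (at_right 0)"
      using cont(1) by (meson continuous_on_def UNIV_I filterlim_at_split tendsto_within_subset subset_UNIV)
    from tendsto_mult[OF this p'(2)] have "((\<lambda>t. \<phi> t * p' t) \<longlongrightarrow> p0 * \<phi> 0) (at_right 0)"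
      by (simp only: mult.commute[of p0])
    from tendstoD[OF this, of "e / 2"] e obtain d where d: "d > 0" "\<And>t. 0 < t \<Longrightarrow> t < d \<Longrightarrow> \<bar>\<phi> t * p' t - p0 * \<phi> 0\<bar> < e / 2"
      unfolding eventually_at_right_field by (auto simp: dist_real_def)
    obtain N where N: "2 / min d T < real N" using reals_Archimedean2 by blast
    show "\<exists>N. \<forall>n\<ge>N. norm ((\<integral>t. deriv (\<eta> n) t * (\<phi> t * p t) \<partial>time_measure T) - p0 * \<phi> 0) < e"
    proof (intro exI allI impI)
      fix n assume "n \<ge> N"
      then have "2 / min d T < real n" using N by simp
      then have n: "real n * min d T > 2" using d T by (simp add: field_simps)
      have nd: "real n * d > 2" "real n * T \<ge> 2"
        using n mult_left_mono[of "min d T" d "real n"] mult_left_mono[of "min d T" T "real n"] by auto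
      have i: "integrable (time_measure T) (\<lambda>t. deriv (\<eta> n) t * (\<phi> t * p t))" "integrable (time_measure T) (deriv (\<eta> n))"
        by (intro continuous_mult_integrable continuous_time_integrable cont p)+
      have "(\<integral>t. deriv (\<eta> n) t * (\<phi> t * p t) \<partial>time_measure T) - p0 * \<phi> 0
          = (\<integral>t. deriv (\<eta> n) t * (\<phi> t * p t) - deriv (\<eta> n) t * (p0 * \<phi> 0) \<partial>time_measure T)"
        using i mass[OF nd(2)] by simp
      also have "norm \<dots> \<le> (\<integral>t. deriv (\<eta> n) t * (e / 2) \<partial>time_measure T)"
      proof (rule order_trans[OF integral_norm_bound], rule integral_mono_AE)
        show "AE t in time_measure T. norm (deriv (\<eta> n) t * (\<phi> t * p t) - deriv (\<eta> n) t * (p0 * \<phi> 0)) \<le> deriv (\<eta> n) t * (e / 2)"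
          using p'(1) AE_space
        proof eventually_elim
          case (elim t)
          show ?case
          proof (cases "real n * t > 2")
            case True
            then show ?thesis by (simp add: d\<eta>_0)
          next
            case False
            then have "real n * t < real n * d" using nd by linarith
            then have "t < d" by (simp add: mult_less_cancel_left)
            then have "\<bar>\<phi> t * p t - p0 * \<phi> 0\<bar> \<le> e / 2" using d(2)[of t] elim by auto
            then have "deriv (\<eta> n) t * \<bar>\<phi> t * p t - p0 * \<phi> 0\<bar> \<le> deriv (\<eta> n) t * (e / 2)"
              by (intro mult_left_mono \<eta>_nonneg)
            then show ?thesis using \<eta>_nonneg[of n t] by (simp add: abs_mult flip: right_diff_distrib)
          qed
        qed
      qed (use i in auto)
      also have "\<dots> = e / 2" using mass[OF nd(2)] by simp
      also have "\<dots> < e" using e by simp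
      finally show "norm ((\<integral>t. deriv (\<eta> n) t * (\<phi> t * p t) \<partial>time_measure T) - p0 * \<phi> 0) < e" .
    qed
  qed
  have "(\<lambda>n. - (\<integral>t. \<eta> n t * (\<phi> t * q t) \<partial>time_measure T)) \<longlonglongrightarrow> - (\<integral>t. \<phi> t * q t \<partial>time_measure T)"
    by (intro tendsto_minus dct continuous_mult_integrable cont q)
  moreover have "(\<lambda>n. (\<integral>t. \<eta> n t * (deriv \<phi> t * p t) \<partial>time_measure T) + (\<integral>t. deriv (\<eta> n) t * (\<phi> t * p t) \<partial>time_measure T))
      \<longlonglongrightarrow> (\<integral>t. deriv \<phi> t * p t \<partial>time_measure T) + p0 * \<phi> 0"
    by (intro tendsto_add dct init continuous_mult_integrable cont p)
  then have "(\<lambda>n. - (\<integral>t. \<eta> n t * (\<phi> t * q t) \<partial>time_measure T)) \<longlonglongrightarrow> (\<integral>t. deriv \<phi> t * p t \<partial>time_measure T) + p0 * \<phi> 0"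
    by (rule Lim_transform_eventually) (use eq in \<open>auto simp: eventually_sequentially intro!: exI[of _ 1]\<close>)
  ultimately show ?thesis using LIMSEQ_unique by fastforce
qed

section \<open>Mollification in time\<close>

text \<open>\<open>step_deriv h j\<close> is the \<open>j\<close>-th derivative of a step that rises from 0 to 1 on \<open>[0, h]\<close>. So
  \<open>step_deriv h 1\<close> is a mollifying kernel that only looks back in time.\<close>

definition step_deriv :: "real \<Rightarrow> nat \<Rightarrow> real \<Rightarrow> real" where
  "step_deriv h j = (deriv ^^ j) (\<lambda>t. smooth_step ((1 / h) * t + 0))"

lemma smooth_step_deriv: "smooth (step_deriv h j)"
  unfolding step_deriv_def
proof (induction j)
  case 0
  show ?case using smooth_affine[OF smooth_smooth_step, of "1 / h" 0] by simp
qed (simp add: smooth_deriv(2))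

lemma step_deriv_DERIV: "(step_deriv h j has_real_derivative step_deriv h (Suc j) t) (at t)"
  using smooth_deriv(1)[OF smooth_step_deriv[of h j]] by (simp add: step_deriv_def)

lemma step_deriv_0:
  assumes "h > 0"
  shows "t \<ge> h \<Longrightarrow> step_deriv h 0 t = 1" "0 \<le> step_deriv h 0 t" "step_deriv h 0 t \<le> 1"
  using assms by (auto simp: step_deriv_def smooth_step_range smooth_step_1)

lemma step_deriv_neg:
  assumes "h > 0" "t < 0"
  shows "step_deriv h j t = 0"
  using assms(2)
proof (induction j arbitrary: t)
  case 0
  then show ?case using assms(1) by (simp add: step_deriv_def smooth_step_0 divide_nonpos_pos)
next
  case (Suc j)
  have "(step_deriv h j has_real_derivative 0) (at t)"
    by (rule DERIV_locally_const[where S = "{..<0}" and c = 0]) (use Suc in auto)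
  then show ?case by (rule DERIV_unique[OF step_deriv_DERIV])
qed

lemma step_deriv_large:
  assumes "h > 0" "t > h"
  shows "step_deriv h (Suc j) t = 0"
  using assms(2)
proof (induction j arbitrary: t)
  case 0
  have "(step_deriv h 0 has_real_derivative 0) (at t)"
    by (rule DERIV_locally_const[where S = "{h<..}" and c = 1]) (use 0 step_deriv_0(1)[OF assms(1)] in auto)
  then show ?case by (rule DERIV_unique[OF step_deriv_DERIV])
next
  case (Suc j)
  have "(step_deriv h (Suc j) has_real_derivative 0) (at t)"
    by (rule DERIV_locally_const[where S = "{h<..}" and c = 0]) (use Suc in auto)
  then show ?case by (rule DERIV_unique[OF step_deriv_DERIV])
qed

lemma step_deriv_1_nonneg: "h > 0 \<Longrightarrow> step_deriv h 1 t \<ge> 0"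
proof -
  assume h: "h > 0"
  have "((\<lambda>t. smooth_step ((1 / h) * t + 0)) has_real_derivative deriv smooth_step ((1 / h) * t + 0) * (1 / h)) (at t)"
    by (rule DERIV_chain2[OF smooth_deriv(1)[OF smooth_smooth_step]]) (use h in \<open>auto intro!: derivative_eq_intros\<close>)
  then have "step_deriv h 1 t = deriv smooth_step ((1 / h) * t + 0) * (1 / h)"
    by (simp add: step_deriv_def One_nat_def DERIV_imp_deriv)
  then show ?thesis using h by (simp add: deriv_smooth_step_nonneg)
qed

lemma step_deriv_bounded:
  assumes "h > 0"
  obtains C where "C \<ge> 0" "\<And>t. \<bar>step_deriv h j t\<bar> \<le> C"
proof (cases j)
  case 0
  then show ?thesis using that[of 1] step_deriv_0[OF assms] by simp
next
  case (Suc i)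
  have "step_deriv h j \<in> test_functions UNIV"
    by (rule test_functionsI[OF smooth_step_deriv compact_Icc[of 0 h]])
       (use step_deriv_neg[OF assms] step_deriv_large[OF assms] Suc in \<open>auto simp: not_le\<close>)
  then show ?thesis using test_functions_bounded that by blast
qed

definition time_conv :: "real \<Rightarrow> (real \<Rightarrow> real) \<Rightarrow> (real \<Rightarrow> real) \<Rightarrow> real \<Rightarrow> real" where
  "time_conv T k m t = (\<integral>s. k (t - s) * m s \<partial>time_measure T)"

abbreviation mollify :: "real \<Rightarrow> real \<Rightarrow> nat \<Rightarrow> (real \<Rightarrow> real) \<Rightarrow> real \<Rightarrow> real" where
  "mollify T h j m t \<equiv> time_conv T (step_deriv h j) m t"

lemma step_deriv_continuous: "continuous_on UNIV (\<lambda>s. step_deriv h j (t - s))"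
  by (intro continuous_on_compose2[OF smooth_continuous[OF smooth_step_deriv]] continuous_intros) auto

lemma mollify_integrable:
  "integrable (time_measure T) m \<Longrightarrow> integrable (time_measure T) (\<lambda>s. step_deriv h j (t - s) * m s)"
  by (rule continuous_mult_integrable[OF step_deriv_continuous])

lemma mollify_DERIV:
  assumes h: "h > 0" and m: "integrable (time_measure T) m"
  shows "((\<lambda>t. mollify T h j m t) has_real_derivative mollify T h (Suc j) m t) (at t)"
proof -
  obtain C where C: "C \<ge> 0" "\<And>t. \<bar>step_deriv h (Suc j) t\<bar> \<le> C" using step_deriv_bounded[OF h] by blast
  let ?q = "\<lambda>d s. (step_deriv h j (t + d - s) - step_deriv h j (t - s)) / d"
  have q_bound: "\<bar>?q d s\<bar> \<le> C" if d: "d \<noteq> 0" for d s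
  proof -
    have "\<bar>step_deriv h j (t + d - s) - step_deriv h j (t - s)\<bar> \<le> C * \<bar>(t + d - s) - (t - s)\<bar>"
      using field_differentiable_bound[of UNIV "step_deriv h j" "step_deriv h (Suc j)" C "t + d - s" "t - s"]
        step_deriv_DERIV C(2) by (auto intro: has_field_derivative_at_within)
    then show ?thesis using d by (simp add: field_simps)
  qed
  have "((\<lambda>d. \<integral>s. ?q d s * m s \<partial>time_measure T) \<longlongrightarrow> mollify T h (Suc j) m t) (at 0)"
    unfolding tendsto_at_iff_sequentially comp_def time_conv_def
  proof (intro allI impI)
    fix X :: "nat \<Rightarrow> real" assume X: "\<forall>i. X i \<in> UNIV - {0}" "X \<longlonglongrightarrow> 0"
    show "(\<lambda>n. \<integral>s. ?q (X n) s * m s \<partial>time_measure T) \<longlonglongrightarrow> (\<integral>s. step_deriv h (Suc j) (t - s) * m s \<partial>time_measure T)"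
    proof (rule integral_dominated_convergence)
      show "integrable (time_measure T) (\<lambda>s. C * \<bar>m s\<bar>)" using m by simp
      show "AE s in time_measure T. (\<lambda>n. ?q (X n) s * m s) \<longlonglongrightarrow> step_deriv h (Suc j) (t - s) * m s"
      proof (intro AE_I2 tendsto_mult tendsto_const)
        fix s
        have "((\<lambda>d. (step_deriv h j (t - s + d) - step_deriv h j (t - s)) / d) \<longlongrightarrow> step_deriv h (Suc j) (t - s)) (at 0)"
          using step_deriv_DERIV[of h j "t - s"] by (simp add: DERIV_def)
        then have "(\<lambda>n. (step_deriv h j (t - s + X n) - step_deriv h j (t - s)) / X n) \<longlonglongrightarrow> step_deriv h (Suc j) (t - s)"
          using X unfolding tendsto_at_iff_sequentially comp_def by blast
        then show "(\<lambda>n. ?q (X n) s) \<longlonglongrightarrow> step_deriv h (Suc j) (t - s)" by (simp add: algebra_simps)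
      qed
      show "AE s in time_measure T. norm (?q (X n) s * m s) \<le> C * \<bar>m s\<bar>" for n
        unfolding real_norm_def abs_mult by (intro AE_I2 mult_right_mono q_bound) (use X in auto)
      show "(\<lambda>s. step_deriv h (Suc j) (t - s) * m s) \<in> borel_measurable (time_measure T)"
        using mollify_integrable[OF m] by blast
      have "?q d \<in> borel_measurable (time_measure T)" for d
        using continuous_time_measurable[OF step_deriv_continuous] by (intro borel_measurable_divide borel_measurable_diff) auto
      then show "(\<lambda>s. ?q (X n) s * m s) \<in> borel_measurable (time_measure T)" for n
        using m by (intro borel_measurable_times) auto
    qed
  qed
  moreover have "(\<integral>s. ?q d s * m s \<partial>time_measure T) = (mollify T h j m (t + d) - mollify T h j m t) / d" for d
  proof -
    have "(\<integral>s. ?q d s * m s \<partial>time_measure T)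
        = (\<integral>s. (step_deriv h j (t + d - s) * m s - step_deriv h j (t - s) * m s) / d \<partial>time_measure T)"
      by (intro Bochner_Integration.integral_cong) (auto simp: field_simps)
    then show ?thesis using mollify_integrable[OF m] by (simp add: time_conv_def)
  qed
  ultimately show ?thesis by (simp only: DERIV_def)
qed

lemma mollify_continuous:
  assumes "h > 0" "integrable (time_measure T) m"
  shows "continuous_on UNIV (\<lambda>t. mollify T h j m t)"
  using DERIV_isCont[OF mollify_DERIV[OF assms]] by (simp add: continuous_at_imp_continuous_on)

lemma mollify_0:
  assumes h: "h > 0"
  shows "mollify T h j m 0 = 0"
proof -
  have "mollify T h j m 0 = (\<integral>s. 0 \<partial>time_measure T)"
    unfolding time_conv_def by (intro Bochner_Integration.integral_cong) (auto simp: step_deriv_neg[OF h])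
  then show ?thesis by simp
qed

text \<open>The mollification has the antiderivative \<open>step_deriv h 0 * m\<close>, which is at most the integral
  of \<open>m\<close>.\<close>

lemma mollify_L1:
  assumes h: "h > 0" and T: "0 \<le> T" and m: "integrable (time_measure T) m" "AE s in time_measure T. m s \<ge> 0"
  shows "(\<integral>t. mollify T h 1 m t \<partial>time_measure T) \<le> (\<integral>s. m s \<partial>time_measure T)"
proof -
  have "(\<integral>t. mollify T h 1 m t \<partial>time_measure T) = mollify T h 0 m T - mollify T h 0 m 0"
    using mollify_DERIV[OF h m(1), of 0] mollify_continuous[OF h m(1)] T
    by (intro time_integral_FTC_full) (auto simp: One_nat_def)
  also have "\<dots> = mollify T h 0 m T" by (simp add: mollify_0[OF h])
  also have "\<dots> \<le> (\<integral>s. m s \<partial>time_measure T)"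
    unfolding time_conv_def
  proof (rule integral_mono_AE[OF mollify_integrable[OF m(1)] m(1)])
    show "AE s in time_measure T. step_deriv h 0 (T - s) * m s \<le> m s"
      using m(2) by eventually_elim (use step_deriv_0[OF h] in \<open>auto intro: mult_left_le_one_le\<close>)
  qed
  finally show ?thesis .
qed

lemma mollify_one:
  assumes h: "h > 0" and t: "0 < t" "t < T"
  shows "(\<integral>s. step_deriv h 1 (t - s) \<partial>time_measure T) = step_deriv h 0 t"
proof -
  have "((\<lambda>s. - step_deriv h 0 (t - s)) has_real_derivative step_deriv h 1 (t - s)) (at s)" for s
  proof -
    have "((\<lambda>s. t - s) has_real_derivative -1) (at s)" by (auto intro!: derivative_eq_intros)
    from DERIV_minus[OF DERIV_chain2[OF step_deriv_DERIV this]] show ?thesis by (simp add: One_nat_def)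
  qed
  from time_integral_FTC_full[OF this step_deriv_continuous, of T]
  show ?thesis using t step_deriv_neg[OF h, of "t - T" 0] by simp
qed

lemma mollify_bound:
  assumes h: "h > 0" and m: "integrable (time_measure T) m" and m': "integrable (time_measure T) m'"
    and le: "AE s in time_measure T. \<bar>m s\<bar> \<le> m' s"
  shows "\<bar>mollify T h 1 m t\<bar> \<le> mollify T h 1 m' t"
  unfolding time_conv_def
proof (rule order_trans[OF integral_abs_bound])
  show "(\<integral>s. \<bar>step_deriv h 1 (t - s) * m s\<bar> \<partial>time_measure T) \<le> (\<integral>s. step_deriv h 1 (t - s) * m' s \<partial>time_measure T)"
  proof (rule integral_mono_AE[OF integrable_abs[OF mollify_integrable[OF m]] mollify_integrable[OF m']])
    show "AE s in time_measure T. \<bar>step_deriv h 1 (t - s) * m s\<bar> \<le> step_deriv h 1 (t - s) * m' s"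
      using le by eventually_elim (use step_deriv_1_nonneg[OF h] in \<open>auto simp: abs_mult intro: mult_left_mono\<close>)
  qed
qed

text \<open>Jensen's inequality: with \<open>N\<close> the mollification of \<open>m\<close>, expand the nonnegative mollification of
  \<open>(m - N)\<^sup>2\<close>. The mass of the kernel inside \<open>(0, T)\<close> is at most 1.\<close>

lemma mollify_square:
  assumes h: "h > 0" and t: "0 < t" "t < T"
    and m: "integrable (time_measure T) m" "integrable (time_measure T) (\<lambda>s. (m s)\<^sup>2)"
  shows "(mollify T h 1 m t)\<^sup>2 \<le> mollify T h 1 (\<lambda>s. (m s)\<^sup>2) t"
proof -
  let ?N = "mollify T h 1 m t" and ?k = "\<lambda>s. step_deriv h 1 (t - s)"
  note i = mollify_integrable[OF m(1), of h 1 t] mollify_integrable[OF m(2), of h 1 t]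
    continuous_time_integrable[OF step_deriv_continuous[of h 1 t], of T]
  have "0 \<le> (\<integral>s. ?k s * (m s - ?N)\<^sup>2 \<partial>time_measure T)"
    by (intro integral_nonneg_AE AE_I2 mult_nonneg_nonneg step_deriv_1_nonneg h) simp
  also have "\<dots> = (\<integral>s. ?k s * (m s)\<^sup>2 - 2 * ?N * (?k s * m s) + ?N\<^sup>2 * ?k s \<partial>time_measure T)"
    by (intro Bochner_Integration.integral_cong) (auto simp: power2_diff algebra_simps)
  also have "\<dots> = mollify T h 1 (\<lambda>s. (m s)\<^sup>2) t - 2 * ?N * ?N + ?N\<^sup>2 * step_deriv h 0 t"
    using i by (simp add: time_conv_def mollify_one[OF h t])
  also have "\<dots> \<le> mollify T h 1 (\<lambda>s. (m s)\<^sup>2) t - 2 * ?N * ?N + ?N\<^sup>2 * 1"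
    by (intro add_left_mono mult_left_mono step_deriv_0 h) simp
  finally show ?thesis by (simp add: power2_eq_square)
qed

lemma mollify_square_integral:
  assumes h: "h > 0" and T: "0 \<le> T"
    and m: "integrable (time_measure T) m" "integrable (time_measure T) (\<lambda>s. (m s)\<^sup>2)"
  shows "(\<integral>t. (mollify T h 1 m t)\<^sup>2 \<partial>time_measure T) \<le> (\<integral>s. (m s)\<^sup>2 \<partial>time_measure T)"
proof -
  have "(\<integral>t. (mollify T h 1 m t)\<^sup>2 \<partial>time_measure T) \<le> (\<integral>t. mollify T h 1 (\<lambda>s. (m s)\<^sup>2) t \<partial>time_measure T)"
    by (intro integral_mono_AE continuous_time_integrable continuous_on_power mollify_continuous h m AE_I2)
      (auto intro: mollify_square h m)
  also have "\<dots> \<le> (\<integral>s. (m s)\<^sup>2 \<partial>time_measure T)" by (intro mollify_L1 h T m) auto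
  finally show ?thesis .
qed

text \<open>Mollification converges in \<open>L\<^sup>1\<close>. The indicator is compared with a continuous function \<open>c\<close>
  that differs from it only on \<open>U - C\<close>, where \<open>C \<subseteq> E \<subseteq> U\<close> with \<open>C\<close> closed and \<open>U\<close> open.\<close>

lemma mollify_indicator_tendsto:
  assumes T: "0 < T" and E: "E \<in> sets lebesgue" "E \<subseteq> {0<..<T}"
  shows "((\<lambda>h. \<integral>t. \<bar>indicator E t - mollify T h 1 (indicator E) t\<bar> \<partial>time_measure T) \<longlongrightarrow> 0) (at_right 0)"
proof (rule tendstoI)
  fix e' :: real assume e': "e' > 0"
  \<comment> \<open>The error is at most \<open>2 e\<close> each for replacing \<open>E\<close> by \<open>c\<close> before and after mollification, \<open>T e\<close>
    for the uniform continuity of \<open>c\<close>, and less than \<open>e\<close> for the times up to \<open>h\<close>.\<close>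
  define e where "e = e' / (T + 5)"
  have e: "e > 0" using e' T by (simp add: e_def)
  obtain C where C: "closed C" "C \<subseteq> E" "E - C \<in> lmeasurable" "emeasure lebesgue (E - C) < ennreal e"
    using sets_lebesgue_inner_closed[OF E(1) e] by blast
  obtain U where U: "open U" "E \<subseteq> U" "U - E \<in> lmeasurable" "emeasure lebesgue (U - E) < ennreal e"
    using sets_lebesgue_outer_open[OF E(1) e] by blast
  obtain c :: "real \<Rightarrow> real" where c: "continuous_on UNIV c" "\<And>x. c x \<in> closed_segment 1 0"
      "\<And>x. x \<in> C \<Longrightarrow> c x = 1" "\<And>x. x \<in> - U \<Longrightarrow> c x = 0"
    using Urysohn[of C "- U" 1 "0::real"] C U by (auto simp: closed_Compl)
  have c01: "0 \<le> c x" "c x \<le> 1" for x using c(2)[of x] by (auto simp: closed_segment_eq_real_ivl)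
  let ?I = "indicator E :: real \<Rightarrow> real"
  have Im: "?I \<in> borel_measurable (time_measure T)"
    using E(1) by (intro measurable_restrict_space1) simp
  have Ii: "integrable (time_measure T) ?I" using Im by (rule integrable_time_bounded[of _ _ 1]) (auto simp: indicator_def)
  have ci: "integrable (time_measure T) c" using c(1) by (rule continuous_time_integrable)
  have di: "integrable (time_measure T) (\<lambda>t. \<bar>?I t - c t\<bar>)" using Ii ci by simp
  have diff: "(\<integral>t. \<bar>?I t - c t\<bar> \<partial>time_measure T) \<le> 2 * e"
  proof -
    have D: "(E - C) \<union> (U - E) \<in> lmeasurable" using C(3) U(3) by (rule fmeasurable.Un)
    have Ti: "{0<..<T} \<inter> space lebesgue \<in> sets lebesgue" by simp
    have "(\<integral>t. \<bar>?I t - c t\<bar> \<partial>time_measure T) = (\<integral>t. indicator {0<..<T} t *\<^sub>R \<bar>?I t - c t\<bar> \<partial>lebesgue)"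
      by (rule integral_restrict_space[OF Ti])
    also have "\<dots> \<le> (\<integral>t. indicator ((E - C) \<union> (U - E)) t \<partial>lebesgue)"
    proof (rule integral_mono_AE)
      show "integrable lebesgue (\<lambda>t. indicator {0<..<T} t *\<^sub>R \<bar>?I t - c t\<bar>)"
        using di integrable_restrict_space[OF Ti, of "\<lambda>t. \<bar>?I t - c t\<bar>"] by blast
      show "integrable lebesgue (indicator ((E - C) \<union> (U - E)) :: real \<Rightarrow> real)"
        using D unfolding fmeasurable_def by (intro integrable_real_indicator) blast+
      have "\<bar>?I t - c t\<bar> \<le> indicator ((E - C) \<union> (U - E)) t" for t
        using c01[of t] c(3)[of t] c(4)[of t] C(2) U(2) by (cases "t \<in> C"; cases "t \<in> U"; cases "t \<in> E") auto
      then have "indicator {0<..<T} t *\<^sub>R \<bar>?I t - c t\<bar> \<le> indicator ((E - C) \<union> (U - E)) t" for t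
        by (rule order_trans[rotated]) (simp add: indicator_def)
      then show "AE t in lebesgue. indicator {0<..<T} t *\<^sub>R \<bar>?I t - c t\<bar> \<le> indicator ((E - C) \<union> (U - E)) t"
        by (intro AE_I2)
    qed
    also have "\<dots> = measure lebesgue ((E - C) \<union> (U - E))" by simp
    also have "\<dots> \<le> measure lebesgue (E - C) + measure lebesgue (U - E)"
      by (rule measure_Un_le) (use C(3) U(3) in auto)
    also have "\<dots> \<le> e + e"
    proof (rule add_mono)
      show "measure lebesgue (E - C) \<le> e" using C(4) e by (auto simp: measure_def intro!: enn2real_leI)
      show "measure lebesgue (U - E) \<le> e" using U(4) e by (auto simp: measure_def intro!: enn2real_leI)
    qed
    finally show ?thesis by simp
  qed
  have "uniformly_continuous_on {0..T} c"
    using c(1) by (intro compact_uniformly_continuous continuous_on_subset[OF c(1)]) auto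
  then obtain d where d: "d > 0" "\<And>s t. s \<in> {0..T} \<Longrightarrow> t \<in> {0..T} \<Longrightarrow> \<bar>s - t\<bar> < d \<Longrightarrow> \<bar>c s - c t\<bar> < e"
    using e unfolding uniformly_continuous_on_def dist_real_def by metis
  have main: "(\<integral>t. \<bar>?I t - mollify T h 1 ?I t\<bar> \<partial>time_measure T) < e'" if h: "0 < h" "h < d" "h < e" for h
  proof -
    have mci: "integrable (time_measure T) (\<lambda>t. mollify T h 1 f t)" if "integrable (time_measure T) f" for f
      by (intro continuous_time_integrable mollify_continuous h that)
    have cc: "\<bar>c t - mollify T h 1 c t\<bar> \<le> e + indicator {0..h} t" if t: "0 < t" "t < T" for t
    proof -
      have m: "0 \<le> mollify T h 1 c t" "mollify T h 1 c t \<le> 1"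
      proof -
        show "0 \<le> mollify T h 1 c t"
          unfolding time_conv_def by (intro integral_nonneg_AE AE_I2 mult_nonneg_nonneg step_deriv_1_nonneg h c01)
        have "mollify T h 1 c t \<le> (\<integral>s. step_deriv h 1 (t - s) \<partial>time_measure T)"
          unfolding time_conv_def
          by (intro integral_mono_AE mollify_integrable ci continuous_time_integrable step_deriv_continuous AE_I2)
            (auto intro!: mult_right_le_one_le step_deriv_1_nonneg h c01)
        then show "mollify T h 1 c t \<le> 1" using mollify_one[OF h(1) t] step_deriv_0(3)[OF h(1)] by (simp add: order_trans)
      qed
      show ?thesis
      proof (cases "t \<le> h")
        case True
        then show ?thesis using m c01[of t] t e by (simp add: abs_le_iff)
      next
        case False
        have one: "(\<integral>s. step_deriv h 1 (t - s) \<partial>time_measure T) = 1"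
          using mollify_one[OF h(1) t] step_deriv_0(1)[OF h(1), of t] False by simp
        have i: "integrable (time_measure T) (\<lambda>s. step_deriv h 1 (t - s))"
          by (intro continuous_time_integrable step_deriv_continuous)
        have "c t - mollify T h 1 c t = (\<integral>s. step_deriv h 1 (t - s) * c t \<partial>time_measure T) - mollify T h 1 c t"
          using one by simp
        also have "\<dots> = (\<integral>s. step_deriv h 1 (t - s) * c t - step_deriv h 1 (t - s) * c s \<partial>time_measure T)"
          unfolding time_conv_def using i mollify_integrable[OF ci, of h 1 t] by (subst Bochner_Integration.integral_diff) auto
        finally have "\<bar>c t - mollify T h 1 c t\<bar> = \<bar>\<integral>s. step_deriv h 1 (t - s) * c t - step_deriv h 1 (t - s) * c s \<partial>time_measure T\<bar>"
          by simp
        also have "\<dots> \<le> (\<integral>s. step_deriv h 1 (t - s) * e \<partial>time_measure T)"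
        proof (rule order_trans[OF integral_abs_bound], rule integral_mono_AE)
          show "AE s in time_measure T. \<bar>step_deriv h 1 (t - s) * c t - step_deriv h 1 (t - s) * c s\<bar> \<le> step_deriv h 1 (t - s) * e"
          proof (rule AE_I2)
            fix s assume s: "s \<in> space (time_measure T)"
            show "\<bar>step_deriv h 1 (t - s) * c t - step_deriv h 1 (t - s) * c s\<bar> \<le> step_deriv h 1 (t - s) * e"
            proof (cases "t - s < 0 \<or> t - s > h")
              case True
              then have "step_deriv h 1 (t - s) = 0"
                using step_deriv_neg[OF h(1)] step_deriv_large[OF h(1), of "t - s" 0] by (auto simp: One_nat_def)
              then show ?thesis by simp
            next
              case False
              then have "\<bar>t - s\<bar> < d" using h by auto
              then have "\<bar>c t - c s\<bar> \<le> e" using d(2)[of t s] s t by auto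
              then have "step_deriv h 1 (t - s) * \<bar>c t - c s\<bar> \<le> step_deriv h 1 (t - s) * e"
                by (intro mult_left_mono step_deriv_1_nonneg h)
              then show ?thesis using step_deriv_1_nonneg[OF h(1), of "t - s"] by (simp add: abs_mult flip: right_diff_distrib)
            qed
          qed
        qed (use i mollify_integrable[OF ci, of h 1 t] in auto)
        also have "\<dots> = e" using one by simp
        finally show ?thesis using t False by (simp add: indicator_def)
      qed
    qed
    have ind_h: "(\<lambda>t. indicator {0..h} t :: real) \<in> borel_measurable (time_measure T)"
      by (intro measurable_restrict_space1 borel_measurable_indicator) auto
    have indi: "integrable (time_measure T) (\<lambda>t. indicator {0..h} t :: real)"
      using ind_h by (rule integrable_time_bounded[of _ _ 1]) (auto simp: indicator_def)
    have one_i: "integrable (time_measure T) (\<lambda>t. e)" by (rule integrable_time_bounded[of _ _ e]) (use e in auto)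
    have "(\<integral>t. \<bar>?I t - mollify T h 1 ?I t\<bar> \<partial>time_measure T)
        \<le> (\<integral>t. \<bar>?I t - c t\<bar> + (e + indicator {0..h} t) + mollify T h 1 (\<lambda>t. \<bar>?I t - c t\<bar>) t \<partial>time_measure T)"
    proof (rule integral_mono_AE)
      show "integrable (time_measure T) (\<lambda>t. \<bar>?I t - mollify T h 1 ?I t\<bar>)" using Ii mci[OF Ii] by simp
      show "integrable (time_measure T) (\<lambda>t. \<bar>?I t - c t\<bar> + (e + indicator {0..h} t) + mollify T h 1 (\<lambda>t. \<bar>?I t - c t\<bar>) t)"
        by (intro Bochner_Integration.integrable_add di one_i indi mci)
      show "AE t in time_measure T. \<bar>?I t - mollify T h 1 ?I t\<bar>
          \<le> \<bar>?I t - c t\<bar> + (e + indicator {0..h} t) + mollify T h 1 (\<lambda>t. \<bar>?I t - c t\<bar>) t"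
      proof (rule AE_I2)
        fix t assume "t \<in> space (time_measure T)"
        then have t: "0 < t" "t < T" by auto
        have "mollify T h 1 c t - mollify T h 1 ?I t = mollify T h 1 (\<lambda>s. c s - ?I s) t"
          unfolding time_conv_def using mollify_integrable[OF ci, of h 1 t] mollify_integrable[OF Ii, of h 1 t]
          by (simp add: right_diff_distrib)
        moreover have "\<bar>mollify T h 1 (\<lambda>s. c s - ?I s) t\<bar> \<le> mollify T h 1 (\<lambda>t. \<bar>?I t - c t\<bar>) t"
          using ci Ii by (intro mollify_bound h di) (auto simp: abs_minus_commute)
        ultimately show "\<bar>?I t - mollify T h 1 ?I t\<bar>
          \<le> \<bar>?I t - c t\<bar> + (e + indicator {0..h} t) + mollify T h 1 (\<lambda>t. \<bar>?I t - c t\<bar>) t"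
          using cc[OF t] by linarith
      qed
    qed
    also have "\<dots> = (\<integral>t. \<bar>?I t - c t\<bar> \<partial>time_measure T) + ((\<integral>t. e \<partial>time_measure T) + (\<integral>t. indicator {0..h} t \<partial>time_measure T))
        + (\<integral>t. mollify T h 1 (\<lambda>t. \<bar>?I t - c t\<bar>) t \<partial>time_measure T)"
      using di one_i indi mci[OF di] by simp
    also have "\<dots> \<le> 2 * e + (e * T + h) + 2 * e"
    proof (intro add_mono diff)
      have t0: "((\<lambda>t. x * t) has_real_derivative x) (at t)" for x t :: real by (auto intro!: derivative_eq_intros)
      show "(\<integral>t. e \<partial>time_measure T) \<le> e * T"
        using time_integral_FTC_full[OF t0[of e], of T] T by (auto simp: mult.commute)
      have "(\<integral>t. indicator {0..h} t \<partial>time_measure T) = (\<integral>t. (1::real) * indicator {0..min h T} t \<partial>time_measure T)"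
        by (intro Bochner_Integration.integral_cong) (auto simp: indicator_def)
      also have "\<dots> = min h T" using time_integral_FTC[OF t0[of 1], of 0 "min h T" T] T h by simp
      finally show "(\<integral>t. indicator {0..h} t \<partial>time_measure T) \<le> h" by simp
      have "(\<integral>t. mollify T h 1 (\<lambda>t. \<bar>?I t - c t\<bar>) t \<partial>time_measure T) \<le> (\<integral>t. \<bar>?I t - c t\<bar> \<partial>time_measure T)"
        using T by (intro mollify_L1 h di) auto
      then show "(\<integral>t. mollify T h 1 (\<lambda>t. \<bar>?I t - c t\<bar>) t \<partial>time_measure T) \<le> 2 * e" using diff by simp
    qed
    also have "\<dots> < (T + 5) * e" using h by (simp add: algebra_simps)
    also have "\<dots> = e'" using T by (simp add: e_def)
    finally show ?thesis .
  qed
  show "eventually (\<lambda>h. dist (\<integral>t. \<bar>?I t - mollify T h 1 ?I t\<bar> \<partial>time_measure T) 0 < e') (at_right 0)"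
  proof (rule eventually_at_rightI[of 0 "min d e"])
    show "0 < min d e" using d e by simp
    fix h assume "h \<in> {0<..<min d e}"
    then show "dist (\<integral>t. \<bar>?I t - mollify T h 1 ?I t\<bar> \<partial>time_measure T) 0 < e'"
      using main[of h] by simp
  qed
qed

section \<open>Energy estimates\<close>

locale energy_space =
  fixes X :: "'x fun_space" and a b :: "('x \<Rightarrow> real) \<Rightarrow> ('x \<Rightarrow> real) \<Rightarrow> real"
  assumes semi_inner_a: "semi_inner (elems X) a" and semi_inner_b: "semi_inner (elems X) b"
    and nrm_ab: "nrm X = form_norm (\<lambda>f g. b f g + a f g)"
begin

sublocale a: semi_inner "elems X" a by (rule semi_inner_a)
sublocale b: semi_inner "elems X" b by (rule semi_inner_b)
sublocale inner_fun_space X "\<lambda>f g. b f g + a f g"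
  using semi_inner_sum[OF semi_inner_b semi_inner_a] nrm_ab
  by (simp add: inner_fun_space_def inner_fun_space_axioms_def)

lemma norm_b_le: "f \<in> elems X \<Longrightarrow> form_norm b f \<le> nrm X f"
  and norm_a_le: "f \<in> elems X \<Longrightarrow> form_norm a f \<le> nrm X f"
  by (simp_all add: nrm_ab form_norm_def a.nonneg b.nonneg)

end

text \<open>Both parts \<open>a\<close> and \<open>b\<close> of the energy norm are of this kind, and so is the semi-inner product
  that defines the norm of \<open>X\<close>.\<close>

locale bounded_form = inner_fun_space X n + F: semi_inner "elems X" B
  for X :: "'x fun_space" and n B +
  assumes form_norm_le: "f \<in> elems X \<Longrightarrow> form_norm B f \<le> nrm X f"
begin

lemma form_bound: "f \<in> elems X \<Longrightarrow> g \<in> elems X \<Longrightarrow> \<bar>B f g\<bar> \<le> nrm X f * nrm X g"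
  using F.cauchy_schwarz[of f g] form_norm_le[of f] form_norm_le[of g] F.norm_nonneg[of f] F.norm_nonneg[of g]
  by (meson mult_mono order_trans)

lemma form_functional:
  assumes "g \<in> elems X"
  shows "bounded_functional X (\<lambda>f. B f g) (nrm X g)"
proof
  fix f assume "f \<in> elems X"
  then show "\<bar>B f g\<bar> \<le> nrm X g * nrm X f"
    using form_bound[OF _ assms] by (simp add: mult.commute)
next
  show "0 \<le> nrm X g" using form_norm_le[OF assms] F.norm_nonneg[OF assms] by simp
qed (use assms in \<open>auto intro: F.zero_in F.add_in F.scale_in F.add_left F.scale_left\<close>)

end

sublocale energy_space \<subseteq> fa: bounded_form X "\<lambda>f g. b f g + a f g" a
  by unfold_locales (rule norm_a_le)
sublocale energy_space \<subseteq> fb: bounded_form X "\<lambda>f g. b f g + a f g" b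
  by unfold_locales (rule norm_b_le)
sublocale inner_fun_space \<subseteq> self: bounded_form X B B
  by unfold_locales (simp add: nrm_eq)

text \<open>The integral of \<open>step_deriv h j (t - s) \<sigma>(s)\<close> over \<open>s\<close> is a finite linear combination of the
  values of \<open>\<sigma>\<close>, and so it stays in the value space.\<close>

definition moll :: "real \<Rightarrow> real \<Rightarrow> nat \<Rightarrow> (real \<Rightarrow> 'x \<Rightarrow> real) \<Rightarrow> real \<Rightarrow> 'x \<Rightarrow> real" where
  "moll T h j \<sigma> t = weighted_integral T (\<lambda>s. step_deriv h j (t - s)) \<sigma>"

lemma kernel_integrable: "integrable (time_measure T) (\<lambda>s. step_deriv h j (t - s))"
  by (intro continuous_time_integrable step_deriv_continuous)

lemma simple_valued_integrable:
  fixes m :: "('x \<Rightarrow> real) \<Rightarrow> real"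
  assumes "simple_valued T X s"
  shows "integrable (time_measure T) (\<lambda>t. m (s t))"
  using simple_valued_integral(1)[OF assms integrable_time_bounded[of "\<lambda>_. 1" T 1], of m] by simp

lemma moll_eq:
  "moll T h j \<sigma> t = (\<lambda>x. \<Sum>g\<in>\<sigma> ` {0<..<T}. mollify T h j (indicator {s. \<sigma> s = g}) t * g x)"
  by (simp add: moll_def weighted_integral_def time_conv_def)

context bounded_form
begin

lemma moll_in:
  assumes "simple_valued T X \<sigma>" shows "moll T h j \<sigma> t \<in> elems X"
  using bounded_functional.weighted(1)[OF form_functional[OF zero_in] assms kernel_integrable]
  by (simp add: moll_def)

lemma moll_form:
  assumes "simple_valued T X \<sigma>" "g \<in> elems X"
  shows "B (moll T h j \<sigma> t) g = mollify T h j (\<lambda>s. B (\<sigma> s) g) t"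
  using bounded_functional.weighted(2)[OF form_functional[OF assms(2)] assms(1) kernel_integrable]
  by (simp add: moll_def time_conv_def)

lemma moll_DERIV:
  assumes "h > 0" "simple_valued T X \<sigma>" "g \<in> elems X"
  shows "((\<lambda>t. B (moll T h j \<sigma> t) g) has_real_derivative B (moll T h (Suc j) \<sigma> t) g) (at t)"
  unfolding moll_form[OF assms(2,3)]
  by (rule mollify_DERIV[OF assms(1) simple_valued_integrable[OF assms(2)]])

lemma moll_moll_DERIV:
  assumes h: "h > 0" and \<sigma>: "simple_valued T X \<sigma>" and \<kappa>: "simple_valued T X \<kappa>"
  shows "((\<lambda>t. B (moll T h i \<sigma> t) (moll T h j \<kappa> t)) has_real_derivative
    B (moll T h (Suc i) \<sigma> t) (moll T h j \<kappa> t) + B (moll T h i \<sigma> t) (moll T h (Suc j) \<kappa> t)) (at t)"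
proof -
  let ?S = "\<sigma> ` {0<..<T}" and ?c = "\<lambda>i g t. mollify T h i (indicator {s. \<sigma> s = g}) t"
  have fin: "finite ?S" and S: "\<And>g. g \<in> ?S \<Longrightarrow> g \<in> elems X"
    using simple_valued_finite[OF \<sigma>] simple_valued_in[OF \<sigma>] by auto
  have expand: "B (moll T h i \<sigma> t) f = (\<Sum>g\<in>?S. ?c i g t * B f g)" if f: "f \<in> elems X" for i t f
    unfolding moll_eq[of T h i \<sigma> t] using F.sum_left[OF fin S f] S f by (simp add: F.sym)
  have c: "((\<lambda>t. ?c i g t) has_real_derivative ?c (Suc i) g t) (at t)" for g i t
  proof (rule mollify_DERIV[OF h])
    show "integrable (time_measure T) (indicator {s. \<sigma> s = g} :: real \<Rightarrow> real)"
      using simple_valued_sets(2)[OF \<sigma>] by (rule integrable_time_bounded[of _ _ 1]) (auto simp: indicator_def)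
  qed
  have "((\<lambda>t. \<Sum>g\<in>?S. ?c i g t * B (moll T h j \<kappa> t) g) has_real_derivative
      (\<Sum>g\<in>?S. ?c i g t * B (moll T h (Suc j) \<kappa> t) g + ?c (Suc i) g t * B (moll T h j \<kappa> t) g)) (at t)"
    by (intro DERIV_sum DERIV_mult' c moll_DERIV h \<kappa> S)
  then show ?thesis
    by (simp add: expand moll_in[OF \<kappa>] sum.distrib add.commute)
qed

lemma moll_continuous:
  assumes "h > 0" "simple_valued T X \<sigma>" "simple_valued T X \<kappa>"
  shows "continuous_on UNIV (\<lambda>t. B (moll T h i \<sigma> t) (moll T h j \<kappa> t))"
  using DERIV_isCont[OF moll_moll_DERIV[OF assms]] by (simp add: continuous_at_imp_continuous_on)

lemma moll_0:
  assumes "h > 0" "simple_valued T X \<sigma>" "g \<in> elems X"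
  shows "B (moll T h j \<sigma> 0) g = 0"
  unfolding moll_form[OF assms(2,3)] by (rule mollify_0[OF assms(1)])

text \<open>Testing with an arbitrary \<open>g\<close> shows that \<open>moll T h j \<sigma> t\<close> approximates the kernel integral
  of any \<open>\<zeta>\<close> which \<open>\<sigma>\<close> approximates in \<open>L\<^sup>1\<close>.\<close>

lemma moll_approx:
  assumes M: "\<And>t. \<bar>step_deriv h j t\<bar> \<le> M" and \<sigma>: "simple_valued T X \<sigma>" and g: "g \<in> elems X"
    and \<zeta>: "strongly_measurable T X \<zeta>" "integrable (time_measure T) (\<lambda>s. B (\<zeta> s) g)"
    and d: "integrable (time_measure T) (\<lambda>s. nrm X (\<lambda>x. \<zeta> s x - \<sigma> s x))"
      "(\<integral>s. nrm X (\<lambda>x. \<zeta> s x - \<sigma> s x) \<partial>time_measure T) \<le> \<delta>"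
  shows "\<bar>mollify T h j (\<lambda>s. B (\<zeta> s) g) t - B (moll T h j \<sigma> t) g\<bar> \<le> M * \<delta> * nrm X g"
proof -
  have M0: "M \<ge> 0" using M[of 0] by simp
  have ng: "nrm X g \<ge> 0" using form_norm_le[OF g] F.norm_nonneg[OF g] by simp
  let ?k = "\<lambda>s. step_deriv h j (t - s)"
  have i: "integrable (time_measure T) (\<lambda>s. ?k s * B (\<zeta> s) g)" "integrable (time_measure T) (\<lambda>s. ?k s * B (\<sigma> s) g)"
    by (intro mollify_integrable \<zeta> simple_valued_integrable[OF \<sigma>])+
  have "\<bar>mollify T h j (\<lambda>s. B (\<zeta> s) g) t - B (moll T h j \<sigma> t) g\<bar>
      = \<bar>\<integral>s. ?k s * B (\<zeta> s) g - ?k s * B (\<sigma> s) g \<partial>time_measure T\<bar>"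
    unfolding moll_form[OF \<sigma> g] time_conv_def using i by simp
  also have "\<dots> \<le> (\<integral>s. M * (nrm X (\<lambda>x. \<zeta> s x - \<sigma> s x) * nrm X g) \<partial>time_measure T)"
  proof (rule order_trans[OF integral_abs_bound], rule integral_mono_AE)
    have "AE s in time_measure T. \<zeta> s \<in> elems X" using \<zeta>(1) by (simp add: strongly_measurable_def)
    then show "AE s in time_measure T. \<bar>?k s * B (\<zeta> s) g - ?k s * B (\<sigma> s) g\<bar> \<le> M * (nrm X (\<lambda>x. \<zeta> s x - \<sigma> s x) * nrm X g)"
      using AE_space
    proof eventually_elim
      case (elim s)
      have s: "\<sigma> s \<in> elems X" using \<sigma> elim(2) by (simp add: simple_valued_def)
      have "?k s * B (\<zeta> s) g - ?k s * B (\<sigma> s) g = ?k s * B (\<lambda>x. \<zeta> s x - \<sigma> s x) g"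
        using F.diff_left[OF elim(1) s g] by (simp add: right_diff_distrib)
      then show ?case
        using M[of "t - s"] form_bound[OF F.diff_in[OF elim(1) s] g] M0 by (simp add: abs_mult mult_mono)
    qed
  qed (use i d in auto)
  also have "\<dots> = M * (\<integral>s. nrm X (\<lambda>x. \<zeta> s x - \<sigma> s x) \<partial>time_measure T) * nrm X g"
    using d by simp
  also have "\<dots> \<le> M * \<delta> * nrm X g" using d(2) M0 ng by (intro mult_right_mono mult_left_mono)
  finally show ?thesis .
qed

end

context inner_fun_space
begin

text \<open>Bounds for a vector-valued integral are obtained by testing it with itself.\<close>

lemma nrm_le_if_tested:
  assumes v: "v \<in> elems X" and c: "B v v \<le> c * nrm X v" and "c \<ge> 0"
  shows "nrm X v \<le> c"
proof (cases "nrm X v = 0")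
  case False
  then have "nrm X v > 0" using norm_nonneg[OF v] by (simp add: nrm_eq)
  moreover have "B v v = nrm X v * nrm X v" using norm_power2[OF v] by (simp add: nrm_eq power2_eq_square)
  ultimately show ?thesis using c by simp
qed (use assms in simp)

end

text \<open>For \<open>s < T\<close> the sign of \<open>G\<close> is needed because the integral extends over all of \<open>(0, T)\<close>.\<close>

lemma mono_from_deriv:
  fixes \<Phi> \<Phi>' G :: "real \<Rightarrow> real"
  assumes d: "\<And>t. (\<Phi> has_real_derivative \<Phi>' t) (at t)" and c: "continuous_on UNIV \<Phi>'"
    and G: "integrable (time_measure T) G" "\<And>t. 0 < t \<Longrightarrow> t < T \<Longrightarrow> \<Phi>' t \<le> G t"
    and s: "0 \<le> s" "s \<le> T" and G0: "s = T \<or> (\<forall>t. G t \<ge> 0)"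
  shows "\<Phi> s - \<Phi> 0 \<le> (\<integral>t. G t \<partial>time_measure T)"
proof -
  have "\<Phi> s - \<Phi> 0 = (\<integral>t. \<Phi>' t * indicator {0..s} t \<partial>time_measure T)"
    using time_integral_FTC[OF d c, of 0 s T] s by simp
  also have "\<dots> \<le> (\<integral>t. G t \<partial>time_measure T)"
  proof (rule integral_mono_AE)
    have "(indicator {0..s} :: real \<Rightarrow> real) \<in> borel_measurable (time_measure T)"
      by (intro measurable_restrict_space1 borel_measurable_indicator) auto
    from integrable_mult_bounded[OF continuous_time_integrable[OF c] this, of 1]
    show "integrable (time_measure T) (\<lambda>t. \<Phi>' t * indicator {0..s} t)"
      by (simp add: mult.commute indicator_def)
    show "AE t in time_measure T. \<Phi>' t * indicator {0..s} t \<le> G t"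
      by (rule AE_I2) (use G(2) G0 in \<open>auto simp: indicator_def\<close>)
  qed (rule G)
  finally show ?thesis .
qed

lemma step_deriv_0_at_0: "step_deriv h 0 0 = 0"
  by (simp add: step_deriv_def smooth_step_0)

lemma kernel_mass:
  assumes "h > 0" "0 \<le> T"
  shows "(\<integral>t. step_deriv h 1 t \<partial>time_measure T) \<le> 1" "integrable (time_measure T) (step_deriv h 1)"
proof -
  have d: "(step_deriv h 0 has_real_derivative step_deriv h 1 t) (at t)" for t
    using step_deriv_DERIV[of h 0 t] by (simp add: One_nat_def)
  have c: "continuous_on UNIV (step_deriv h 1)" by (intro smooth_continuous smooth_step_deriv)
  show "integrable (time_measure T) (step_deriv h 1)" by (rule continuous_time_integrable[OF c])
  show "(\<integral>t. step_deriv h 1 t \<partial>time_measure T) \<le> 1"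
    using time_integral_FTC_full[OF d c assms(2)] step_deriv_0(3)[OF assms(1), of T] by (simp add: step_deriv_0_at_0)
qed

lemma time_integral_const: "0 \<le> T \<Longrightarrow> (\<integral>t. c \<partial>time_measure T) = T * (c::real)"
  and integrable_time_const: "integrable (time_measure T) (\<lambda>t. c::real)"
proof -
  have d: "((\<lambda>t. c * t) has_real_derivative c) (at t)" for t by (auto intro!: derivative_eq_intros)
  show "(\<integral>t. c \<partial>time_measure T) = T * c" if "0 \<le> T"
    using time_integral_FTC_full[OF d _ that] by (simp only: continuous_on_const) (simp add: mult.commute)
  show "integrable (time_measure T) (\<lambda>t. c::real)" by (intro continuous_time_integrable continuous_on_const)
qed

context energy_space
begin

text \<open>Let \<open>p\<close> be the mollified \<open>\<gamma>\<close> and \<open>R = p' + \<eta> y1\<close>, where \<open>\<eta>\<close> is the smoothed step. Testing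
  with \<open>p'' = R' - \<eta>' y1\<close> gives a bound for the derivative of \<open>E = a(R, R)\<close> that contains
  \<open>\<eta>' E\<close>. As \<open>\<eta>\<close> rises only from 0 to 1, the factor \<open>exp (- \<eta>)\<close> absorbs this term at the cost of
  \<open>exp 1\<close>, for every width \<open>h\<close> of the step.\<close>

lemma second_derivative_energy:
  assumes h: "h > 0" and T: "0 < T" and \<kappa>: "simple_valued T X \<kappa>" and y1: "y1 \<in> elems X"
    and N: "continuous_on UNIV N" and \<epsilon>: "\<epsilon> \<ge> 0"
    and eq: "\<And>t. 0 < t \<Longrightarrow> t < T \<Longrightarrow>
      b (moll T h 3 \<kappa> t) (moll T h 3 \<kappa> t) + a (moll T h 2 \<kappa> t) (moll T h 3 \<kappa> t) + step_deriv h 0 t * a y1 (moll T h 3 \<kappa> t)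
      \<le> N t * form_norm b (moll T h 3 \<kappa> t) + \<epsilon>"
  shows "(\<integral>t. b (moll T h 3 \<kappa> t) (moll T h 3 \<kappa> t) \<partial>time_measure T)
    \<le> exp 1 * ((\<integral>t. (N t)\<^sup>2 \<partial>time_measure T) + a y1 y1 + 2 * \<epsilon> * T)"
proof -
  let ?p1 = "moll T h 2 \<kappa>" and ?p2 = "moll T h 3 \<kappa>" and ?\<eta> = "step_deriv h 0" and ?k = "step_deriv h 1"
  let ?a1 = "a y1 y1"
  have p: "?p1 t \<in> elems X" "?p2 t \<in> elems X" for t by (rule fa.moll_in[OF \<kappa>])+
  define E where "E t = a (?p1 t) (?p1 t) + 2 * ?\<eta> t * a (?p1 t) y1 + (?\<eta> t)\<^sup>2 * ?a1" for t
  define E' where "E' t = 2 * a (?p1 t) (?p2 t) + 2 * (?k t * a (?p1 t) y1 + ?\<eta> t * a (?p2 t) y1) + 2 * ?\<eta> t * ?k t * ?a1" for t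
  have s23: "Suc 2 = 3" "Suc 0 = 1" by simp_all
  have d\<eta>: "(?\<eta> has_real_derivative ?k t) (at t)" for t
    using step_deriv_DERIV[of h 0 t] by (simp add: One_nat_def)
  have dp: "((\<lambda>t. a (?p1 t) (?p1 t)) has_real_derivative 2 * a (?p1 t) (?p2 t)) (at t)" for t
    using fa.moll_moll_DERIV[OF h \<kappa> \<kappa>, of 2 2 t] a.sym[OF p(2,1), of t t] by (simp add: s23)
  have dpy: "((\<lambda>t. a (?p1 t) y1) has_real_derivative a (?p2 t) y1) (at t)" for t
    using fa.moll_DERIV[OF h \<kappa> y1, of 2 t] by (simp add: s23)
  have dE: "(E has_real_derivative E' t) (at t)" for t
    unfolding E_def[abs_def] E'_def
    by (auto intro!: derivative_eq_intros dp dpy d\<eta> simp: algebra_simps power2_eq_square)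
  have E_R: "E t = a (\<lambda>x. ?p1 t x + ?\<eta> t * y1 x) (\<lambda>x. ?p1 t x + ?\<eta> t * y1 x)" for t
    using p y1 by (simp add: E_def a.add_left a.add_right a.scale_left a.scale_right a.scale_in a.add_in
        a.sym[OF y1 p(1)]) (simp add: power2_eq_square)
  have E_nonneg: "E t \<ge> 0" for t unfolding E_R by (intro a.nonneg a.add_in a.scale_in p y1)
  have yR: "2 * \<bar>a (?p1 t) y1 + ?\<eta> t * ?a1\<bar> \<le> E t + ?a1" for t
  proof -
    have R: "(\<lambda>x. ?p1 t x + ?\<eta> t * y1 x) \<in> elems X" by (intro a.add_in a.scale_in p y1)
    have "\<bar>a (?p1 t) y1 + ?\<eta> t * ?a1\<bar> = \<bar>a (\<lambda>x. ?p1 t x + ?\<eta> t * y1 x) y1\<bar>"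
      using p y1 by (simp add: a.add_left a.scale_left a.scale_in)
    also have "\<dots> \<le> form_norm a (\<lambda>x. ?p1 t x + ?\<eta> t * y1 x) * form_norm a y1" by (rule a.cauchy_schwarz[OF R y1])
    finally have "2 * \<bar>a (?p1 t) y1 + ?\<eta> t * ?a1\<bar> \<le> 2 * form_norm a (\<lambda>x. ?p1 t x + ?\<eta> t * y1 x) * form_norm a y1" by simp
    also have "\<dots> \<le> (form_norm a (\<lambda>x. ?p1 t x + ?\<eta> t * y1 x))\<^sup>2 + (form_norm a y1)\<^sup>2" by (rule sum_squares_bound)
    also have "\<dots> = E t + ?a1" by (simp add: a.norm_power2 R y1 E_R)
    finally show ?thesis .
  qed
  have E'_le: "E' t \<le> (N t)\<^sup>2 - b (?p2 t) (?p2 t) + 2 * \<epsilon> + ?k t * (E t + ?a1)" if t: "0 < t" "t < T" for t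
  proof -
    have e1: "E' t = 2 * (a (?p1 t) (?p2 t) + ?\<eta> t * a y1 (?p2 t)) + ?k t * (2 * (a (?p1 t) y1 + ?\<eta> t * ?a1))"
      unfolding E'_def a.sym[OF y1 p(2)] by (simp add: algebra_simps)
    have e2: "?k t * (2 * (a (?p1 t) y1 + ?\<eta> t * ?a1)) \<le> ?k t * (E t + ?a1)"
      by (intro mult_left_mono step_deriv_1_nonneg h order_trans[OF _ yR]) simp_all
    have e3: "2 * N t * form_norm b (?p2 t) \<le> (N t)\<^sup>2 + b (?p2 t) (?p2 t)"
      using sum_squares_bound[of "N t" "form_norm b (?p2 t)"] by (simp add: b.norm_power2 p)
    show ?thesis using eq[OF t] e1 e2 e3 by (simp add: algebra_simps)
  qed
  define \<Phi>' where "\<Phi>' t = (E' t - ?k t * E t) * exp (- ?\<eta> t)" for t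
  have d\<Phi>: "((\<lambda>t. E t * exp (- ?\<eta> t)) has_real_derivative \<Phi>' t) (at t)" for t
    unfolding \<Phi>'_def by (auto intro!: derivative_eq_intros dE d\<eta> simp: algebra_simps)
  have c\<eta>: "continuous_on UNIV (step_deriv h j)" for j by (intro smooth_continuous smooth_step_deriv)
  have cE: "continuous_on UNIV E" using DERIV_isCont[OF dE] by (simp add: continuous_at_imp_continuous_on)
  have cy: "continuous_on UNIV (\<lambda>t. a (moll T h j \<kappa> t) y1)" for j
    using DERIV_isCont[OF fa.moll_DERIV[OF h \<kappa> y1]] by (simp add: continuous_at_imp_continuous_on)
  have c\<Phi>: "continuous_on UNIV \<Phi>'"
    unfolding \<Phi>'_def[abs_def] E'_def[abs_def] by (intro continuous_intros cE c\<eta> cy fa.moll_continuous[OF h \<kappa> \<kappa>])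
  have cb: "continuous_on UNIV (\<lambda>t. b (?p2 t) (?p2 t))" by (rule fb.moll_continuous[OF h \<kappa> \<kappa>])
  let ?G = "\<lambda>t. ((N t)\<^sup>2 + 2 * \<epsilon> + ?a1 * ?k t) - exp (-1) * b (?p2 t) (?p2 t)"
  have iN: "integrable (time_measure T) (\<lambda>t. (N t)\<^sup>2)"
    by (intro continuous_time_integrable continuous_intros N)
  have ib: "integrable (time_measure T) (\<lambda>t. b (?p2 t) (?p2 t))" by (rule continuous_time_integrable[OF cb])
  note ik = kernel_mass[OF h less_imp_le[OF T]]
  have iG: "integrable (time_measure T) ?G"
    using iN ib ik(2) integrable_time_const by auto
  have a1: "?a1 \<ge> 0" by (rule a.nonneg[OF y1])
  have \<Phi>_le: "\<Phi>' t \<le> ?G t" if t: "0 < t" "t < T" for t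
  proof -
    let ?e = "exp (- ?\<eta> t)"
    have e: "exp (-1) \<le> ?e" "?e \<le> 1" "0 \<le> ?e" using step_deriv_0[OF h, of t] by auto
    have "\<Phi>' t \<le> ((N t)\<^sup>2 - b (?p2 t) (?p2 t) + 2 * \<epsilon> + ?k t * (E t + ?a1) - ?k t * E t) * ?e"
      unfolding \<Phi>'_def using E'_le[OF t] by (intro mult_right_mono e) linarith
    also have "\<dots> = ((N t)\<^sup>2 + 2 * \<epsilon> + ?a1 * ?k t) * ?e - b (?p2 t) (?p2 t) * ?e" by (simp add: algebra_simps)
    also have "\<dots> \<le> ((N t)\<^sup>2 + 2 * \<epsilon> + ?a1 * ?k t) * 1 - b (?p2 t) (?p2 t) * exp (-1)"
      using a1 \<epsilon> step_deriv_1_nonneg[OF h, of t]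
      by (intro diff_mono mult_left_mono e b.nonneg p add_nonneg_nonneg mult_nonneg_nonneg) auto
    finally show ?thesis by (simp add: mult.commute)
  qed
  have "0 \<le> E T * exp (- ?\<eta> T) - E 0 * exp (- ?\<eta> 0)"
    using E_nonneg[of T] fa.moll_0[OF h \<kappa> p(1)] by (simp add: E_def step_deriv_0_at_0)
  also have "\<dots> \<le> (\<integral>t. ?G t \<partial>time_measure T)"
    using T by (intro mono_from_deriv[OF d\<Phi> c\<Phi> iG \<Phi>_le]) auto
  also have "\<dots> = (\<integral>t. (N t)\<^sup>2 \<partial>time_measure T) + T * (2 * \<epsilon>) + ?a1 * (\<integral>t. ?k t \<partial>time_measure T)
      - exp (-1) * (\<integral>t. b (?p2 t) (?p2 t) \<partial>time_measure T)"
    using iN ib ik(2) integrable_time_const T by (simp add: time_integral_const del: integral_const lebesgue_integral_const)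
  also have "\<dots> \<le> (\<integral>t. (N t)\<^sup>2 \<partial>time_measure T) + T * (2 * \<epsilon>) + ?a1 * 1
      - exp (-1) * (\<integral>t. b (?p2 t) (?p2 t) \<partial>time_measure T)"
    by (intro diff_right_mono add_left_mono mult_left_mono ik a1)
  finally have *: "exp (-1) * (\<integral>t. b (?p2 t) (?p2 t) \<partial>time_measure T) \<le> (\<integral>t. (N t)\<^sup>2 \<partial>time_measure T) + ?a1 + 2 * \<epsilon> * T"
    by (simp add: algebra_simps)
  have "(\<integral>t. b (?p2 t) (?p2 t) \<partial>time_measure T) = exp 1 * (exp (-1) * (\<integral>t. b (?p2 t) (?p2 t) \<partial>time_measure T))"
    by (simp flip: mult.assoc exp_add)
  also have "\<dots> \<le> exp 1 * ((\<integral>t. (N t)\<^sup>2 \<partial>time_measure T) + ?a1 + 2 * \<epsilon> * T)"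
    by (rule mult_left_mono[OF *]) simp
  finally show ?thesis .
qed

text \<open>The energy of the damped wave equation \<open>\<tau> w'' + w' + A w = F\<close>. The damping term dominates
  the right-hand side, so the bound does not degenerate for small \<open>\<tau>\<close>.\<close>

lemma damped_wave_energy:
  assumes h: "h > 0" and \<tau>: "\<tau> > 0" and \<sigma>: "simple_valued T X \<sigma>"
    and N: "continuous_on UNIV N" and P: "continuous_on UNIV P" "\<And>t. P t \<ge> 0" and \<epsilon>: "\<epsilon> \<ge> 0"
    and eq: "\<And>t. 0 < t \<Longrightarrow> t < T \<Longrightarrow>
      \<tau> * b (moll T h 3 \<sigma> t) (moll T h 2 \<sigma> t) + b (moll T h 2 \<sigma> t) (moll T h 2 \<sigma> t) + a (moll T h 1 \<sigma> t) (moll T h 2 \<sigma> t)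
      \<le> N t * form_norm b (moll T h 2 \<sigma> t) + \<tau> * sqrt (P t) * form_norm b (moll T h 2 \<sigma> t) + \<epsilon>"
    and s: "0 < s" "s < T"
  shows "(nrm X (moll T h 1 \<sigma> s))\<^sup>2
    \<le> exp T * (2 * (\<integral>t. (N t)\<^sup>2 \<partial>time_measure T) + 2 * \<tau>\<^sup>2 * (\<integral>t. P t \<partial>time_measure T) + 2 * \<epsilon> * T)"
proof -
  let ?w0 = "moll T h 1 \<sigma>" and ?w1 = "moll T h 2 \<sigma>" and ?w2 = "moll T h 3 \<sigma>"
  have w: "?w0 t \<in> elems X" "?w1 t \<in> elems X" "?w2 t \<in> elems X" for t by (rule fa.moll_in[OF \<sigma>])+
  have T: "0 < T" using s by simp
  define L where "L t = \<tau> * b (?w1 t) (?w1 t) + a (?w0 t) (?w0 t) + b (?w0 t) (?w0 t)" for t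
  define L' where "L' t = 2 * (\<tau> * b (?w2 t) (?w1 t) + a (?w0 t) (?w1 t) + b (?w0 t) (?w1 t))" for t
  have s23: "Suc 2 = 3" "Suc 1 = 2" by simp_all
  have d1: "((\<lambda>t. b (?w1 t) (?w1 t)) has_real_derivative 2 * b (?w2 t) (?w1 t)) (at t)"
    and d2: "((\<lambda>t. a (?w0 t) (?w0 t)) has_real_derivative 2 * a (?w0 t) (?w1 t)) (at t)"
    and d3: "((\<lambda>t. b (?w0 t) (?w0 t)) has_real_derivative 2 * b (?w0 t) (?w1 t)) (at t)" for t
    using fb.moll_moll_DERIV[OF h \<sigma> \<sigma>, of 2 2 t] fa.moll_moll_DERIV[OF h \<sigma> \<sigma>, of 1 1 t]
      fb.moll_moll_DERIV[OF h \<sigma> \<sigma>, of 1 1 t]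
      b.sym[OF w(2,3), of t t] a.sym[OF w(2,1), of t t] b.sym[OF w(2,1), of t t]
    unfolding s23 by simp_all
  have dL: "(L has_real_derivative L' t) (at t)" for t
    unfolding L_def[abs_def] L'_def
    by (auto intro!: derivative_eq_intros d1 d2 d3 simp: algebra_simps)
  have L'_le: "L' t \<le> 2 * (N t)\<^sup>2 + 2 * \<tau>\<^sup>2 * P t + 2 * \<epsilon> + L t" if t: "0 < t" "t < T" for t
  proof -
    define n where "n = form_norm b (?w1 t)"
    define S where "S = N t + \<tau> * sqrt (P t)"
    have n2: "n\<^sup>2 = b (?w1 t) (?w1 t)" unfolding n_def by (rule b.norm_power2[OF w(2)])
    have "2 * b (?w0 t) (?w1 t) \<le> 2 * (form_norm b (?w0 t) * n)"
      using b.cauchy_schwarz[OF w(1,2), of t t] unfolding n_def by linarith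
    also have "\<dots> \<le> (form_norm b (?w0 t))\<^sup>2 + n\<^sup>2" using sum_squares_bound[of "form_norm b (?w0 t)" n] by simp
    finally have e1: "2 * b (?w0 t) (?w1 t) \<le> b (?w0 t) (?w0 t) + n\<^sup>2" by (simp add: b.norm_power2 w)
    have e2: "2 * S * n \<le> S\<^sup>2 + n\<^sup>2" by (rule sum_squares_bound)
    have "S\<^sup>2 \<le> 2 * (N t)\<^sup>2 + 2 * (\<tau> * sqrt (P t))\<^sup>2"
      using sum_squares_bound[of "N t" "\<tau> * sqrt (P t)"] by (simp add: S_def power2_sum)
    also have "(\<tau> * sqrt (P t))\<^sup>2 = \<tau>\<^sup>2 * P t" using P(2)[of t] by (simp add: power_mult_distrib)
    finally have e3: "S\<^sup>2 \<le> 2 * (N t)\<^sup>2 + 2 * \<tau>\<^sup>2 * P t" by simp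
    have e4: "0 \<le> \<tau> * b (?w1 t) (?w1 t)" "0 \<le> a (?w0 t) (?w0 t)" using \<tau> by (auto intro!: mult_nonneg_nonneg b.nonneg a.nonneg w)
    have e5: "2 * (\<tau> * b (?w2 t) (?w1 t) + a (?w0 t) (?w1 t)) \<le> 2 * S * n + 2 * \<epsilon> - 2 * n\<^sup>2"
      using eq[OF t] n2 unfolding S_def n_def by (simp add: algebra_simps)
    have "2 * b (?w0 t) (?w1 t) + 2 * (\<tau> * b (?w2 t) (?w1 t) + a (?w0 t) (?w1 t))
        \<le> 2 * (N t)\<^sup>2 + 2 * \<tau>\<^sup>2 * P t + 2 * \<epsilon> + b (?w0 t) (?w0 t)"
      using add_mono[OF e1 e5] e2 e3 by simp
    then show ?thesis unfolding L'_def L_def using e4 by simp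
  qed
  define \<Phi>' where "\<Phi>' t = (L' t - L t) * exp (- t)" for t
  have d\<Phi>: "((\<lambda>t. L t * exp (- t)) has_real_derivative \<Phi>' t) (at t)" for t
    unfolding \<Phi>'_def by (auto intro!: derivative_eq_intros dL simp: algebra_simps)
  have cL: "continuous_on UNIV L" using DERIV_isCont[OF dL] by (simp add: continuous_at_imp_continuous_on)
  have c\<Phi>: "continuous_on UNIV \<Phi>'"
    unfolding \<Phi>'_def[abs_def] L'_def[abs_def]
    by (intro continuous_intros cL fa.moll_continuous[OF h \<sigma> \<sigma>] fb.moll_continuous[OF h \<sigma> \<sigma>])
  let ?G = "\<lambda>t. 2 * (N t)\<^sup>2 + 2 * \<tau>\<^sup>2 * P t + 2 * \<epsilon>"
  have iN: "integrable (time_measure T) (\<lambda>t. (N t)\<^sup>2)" by (intro continuous_time_integrable continuous_intros N)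
  have iP: "integrable (time_measure T) P" by (rule continuous_time_integrable[OF P(1)])
  have G0: "?G t \<ge> 0" for t using P(2)[of t] \<epsilon> by simp
  have iG: "integrable (time_measure T) ?G" using iN iP integrable_time_const by auto
  have \<Phi>_le: "\<Phi>' t \<le> ?G t" if t: "0 < t" "t < T" for t
  proof -
    have "\<Phi>' t \<le> ?G t * exp (- t)"
      unfolding \<Phi>'_def using L'_le[OF t] by (intro mult_right_mono) auto
    also have "\<dots> \<le> ?G t * 1" using G0[of t] t by (intro mult_left_mono) auto
    finally show ?thesis by simp
  qed
  have "L s * exp (- s) - L 0 * exp (- 0) \<le> (\<integral>t. ?G t \<partial>time_measure T)"
    using s G0 by (intro mono_from_deriv[OF d\<Phi> c\<Phi> iG \<Phi>_le]) auto
  moreover have "L 0 = 0"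
    by (simp add: L_def fa.moll_0[OF h \<sigma> w(1)] fb.moll_0[OF h \<sigma> w(1)] fb.moll_0[OF h \<sigma> w(2)])
  moreover have "(\<integral>t. ?G t \<partial>time_measure T)
      = 2 * (\<integral>t. (N t)\<^sup>2 \<partial>time_measure T) + 2 * \<tau>\<^sup>2 * (\<integral>t. P t \<partial>time_measure T) + T * (2 * \<epsilon>)"
    using iN iP integrable_time_const T by (simp add: time_integral_const del: integral_const lebesgue_integral_const)
  moreover have "(\<integral>t. ?G t \<partial>time_measure T) \<ge> 0" by (intro integral_nonneg_AE AE_I2 G0)
  ultimately have *: "L s * exp (- s) \<le> 2 * (\<integral>t. (N t)\<^sup>2 \<partial>time_measure T) + 2 * \<tau>\<^sup>2 * (\<integral>t. P t \<partial>time_measure T) + 2 * \<epsilon> * T"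
    and pos: "0 \<le> 2 * (\<integral>t. (N t)\<^sup>2 \<partial>time_measure T) + 2 * \<tau>\<^sup>2 * (\<integral>t. P t \<partial>time_measure T) + 2 * \<epsilon> * T"
    by (simp_all add: algebra_simps)
  have "L s = exp s * (L s * exp (- s))" by (simp add: exp_minus)
  also have "\<dots> \<le> exp s * (2 * (\<integral>t. (N t)\<^sup>2 \<partial>time_measure T) + 2 * \<tau>\<^sup>2 * (\<integral>t. P t \<partial>time_measure T) + 2 * \<epsilon> * T)"
    using * by (intro mult_left_mono) auto
  also have "\<dots> \<le> exp T * (2 * (\<integral>t. (N t)\<^sup>2 \<partial>time_measure T) + 2 * \<tau>\<^sup>2 * (\<integral>t. P t \<partial>time_measure T) + 2 * \<epsilon> * T)"
    using pos s by (intro mult_right_mono) auto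
  finally have "L s \<le> exp T * (2 * (\<integral>t. (N t)\<^sup>2 \<partial>time_measure T) + 2 * \<tau>\<^sup>2 * (\<integral>t. P t \<partial>time_measure T) + 2 * \<epsilon> * T)" .
  moreover have "(nrm X (?w0 s))\<^sup>2 \<le> L s"
    using \<tau> b.nonneg[OF w(2), of s] norm_power2[OF w(1)] by (simp add: nrm_eq L_def)
  ultimately show ?thesis by simp
qed

end

text \<open>The two evolution equations in weak form, tested with \<open>\<phi>(t) g\<close>, where \<open>\<phi>\<close> vanishes near \<open>T\<close>
  but not near 0. So they include the homogeneous initial conditions of \<open>\<gamma>\<close> and \<open>\<zeta>\<close>.
  \<open>heat\<close> is the time derivative of \<open>\<gamma>' + A \<gamma> = q - t A y1\<close> with \<open>q' = Q\<close>; \<open>wave\<close> is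
  \<open>\<tau> \<zeta>'' + \<zeta>' + A \<zeta> = F - \<tau> \<gamma>''\<close>.\<close>

locale evolution_pair = energy_space X a b
  for X :: "'x fun_space" and a b +
  fixes T \<tau> :: real and \<zeta> \<gamma> :: "real \<Rightarrow> 'x \<Rightarrow> real" and y1 :: "'x \<Rightarrow> real"
    and F Q :: "real \<Rightarrow> ('x \<Rightarrow> real) \<Rightarrow> real" and Fn Qn :: "real \<Rightarrow> real"
  assumes T: "0 < T" and \<tau>: "0 < \<tau>"
    and \<zeta>: "\<zeta> \<in> L2_Bochner T X" and \<gamma>: "\<gamma> \<in> L2_Bochner T X" and y1: "y1 \<in> elems X"
    and F_int: "g \<in> elems X \<Longrightarrow> integrable (time_measure T) (\<lambda>t. F t g)"
    and Q_int: "g \<in> elems X \<Longrightarrow> integrable (time_measure T) (\<lambda>t. Q t g)"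
    and F_bound: "g \<in> elems X \<Longrightarrow> AE t in time_measure T. \<bar>F t g\<bar> \<le> Fn t * form_norm b g"
    and Q_bound: "g \<in> elems X \<Longrightarrow> AE t in time_measure T. \<bar>Q t g\<bar> \<le> Qn t * form_norm b g"
    and Fn: "integrable (time_measure T) Fn" "integrable (time_measure T) (\<lambda>t. (Fn t)\<^sup>2)"
    and Qn: "integrable (time_measure T) Qn" "integrable (time_measure T) (\<lambda>t. (Qn t)\<^sup>2)"
    and heat: "g \<in> elems X \<Longrightarrow> smooth \<phi> \<Longrightarrow> c < T \<Longrightarrow> (\<And>t. t > c \<Longrightarrow> \<phi> t = 0) \<Longrightarrow>
      (\<integral>t. deriv (deriv \<phi>) t * b (\<gamma> t) g \<partial>time_measure T) - (\<integral>t. deriv \<phi> t * a (\<gamma> t) g \<partial>time_measure T)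
      = (\<integral>t. \<phi> t * Q t g \<partial>time_measure T) - a y1 g * (\<integral>t. \<phi> t \<partial>time_measure T)"
    and wave: "g \<in> elems X \<Longrightarrow> smooth \<phi> \<Longrightarrow> c < T \<Longrightarrow> (\<And>t. t > c \<Longrightarrow> \<phi> t = 0) \<Longrightarrow>
      \<tau> * (\<integral>t. deriv (deriv \<phi>) t * b (\<zeta> t) g \<partial>time_measure T) - (\<integral>t. deriv \<phi> t * b (\<zeta> t) g \<partial>time_measure T)
        + (\<integral>t. \<phi> t * a (\<zeta> t) g \<partial>time_measure T)
      = (\<integral>t. \<phi> t * F t g \<partial>time_measure T) - \<tau> * (\<integral>t. deriv (deriv \<phi>) t * b (\<gamma> t) g \<partial>time_measure T)"
begin

text \<open>As a function of \<open>s\<close>, the kernel \<open>step_deriv h 1 (t - s)\<close> vanishes for \<open>s > t\<close> and so is an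
  admissible \<open>\<phi>\<close>. The mass that the kernel keeps inside \<open>(0, T)\<close> is \<open>step_deriv h 0 t\<close>.\<close>

lemma mollified_equations:
  assumes h: "h > 0" and t: "0 < t" "t < T" and g: "g \<in> elems X"
  shows "mollify T h 3 (\<lambda>s. b (\<gamma> s) g) t + mollify T h 2 (\<lambda>s. a (\<gamma> s) g) t
      = mollify T h 1 (\<lambda>s. Q s g) t - a y1 g * step_deriv h 0 t"
    and "\<tau> * mollify T h 3 (\<lambda>s. b (\<zeta> s) g) t + mollify T h 2 (\<lambda>s. b (\<zeta> s) g) t + mollify T h 1 (\<lambda>s. a (\<zeta> s) g) t
      = mollify T h 1 (\<lambda>s. F s g) t - \<tau> * mollify T h 3 (\<lambda>s. b (\<gamma> s) g) t"
proof -
  define \<phi> where "\<phi> s = step_deriv h 1 (t - s)" for s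
  have D: "((\<lambda>s. step_deriv h j (t - s)) has_real_derivative - step_deriv h (Suc j) (t - s)) (at s)" for j s
  proof -
    have "((\<lambda>s. t - s) has_real_derivative -1) (at s)" by (auto intro!: derivative_eq_intros)
    from DERIV_chain2[OF step_deriv_DERIV this] show ?thesis by simp
  qed
  have sm: "smooth \<phi>"
    using smooth_affine[OF smooth_step_deriv, of h 1 "-1" t] by (simp add: \<phi>_def[abs_def])
  have d1: "deriv \<phi> = (\<lambda>s. - step_deriv h 2 (t - s))"
    using D[of 1] unfolding \<phi>_def[abs_def] by (auto intro!: DERIV_imp_deriv simp: numeral_2_eq_2 One_nat_def)
  have d2: "deriv (deriv \<phi>) = (\<lambda>s. step_deriv h 3 (t - s))"
    using DERIV_minus[OF D[of 2]] unfolding d1 by (auto intro!: DERIV_imp_deriv simp: numeral_3_eq_3 numeral_2_eq_2)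
  have z: "\<phi> s = 0" if "s > t" for s using that by (simp add: \<phi>_def step_deriv_neg[OF h])
  note e1 = heat[OF g sm t(2) z] and e2 = wave[OF g sm t(2) z]
  have one: "(\<integral>s. \<phi> s \<partial>time_measure T) = step_deriv h 0 t" unfolding \<phi>_def by (rule mollify_one[OF h t])
  show "mollify T h 3 (\<lambda>s. b (\<gamma> s) g) t + mollify T h 2 (\<lambda>s. a (\<gamma> s) g) t
      = mollify T h 1 (\<lambda>s. Q s g) t - a y1 g * step_deriv h 0 t"
    using e1 unfolding one unfolding d2 unfolding d1 by (simp add: \<phi>_def time_conv_def)
  show "\<tau> * mollify T h 3 (\<lambda>s. b (\<zeta> s) g) t + mollify T h 2 (\<lambda>s. b (\<zeta> s) g) t + mollify T h 1 (\<lambda>s. a (\<zeta> s) g) t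
      = mollify T h 1 (\<lambda>s. F s g) t - \<tau> * mollify T h 3 (\<lambda>s. b (\<gamma> s) g) t"
    using e2 unfolding d2 unfolding d1 by (simp add: \<phi>_def time_conv_def)
qed

end

section \<open>The uniform bound for the error\<close>

lemma mollify_scale: "mollify T h j (\<lambda>s. m s * c) t = mollify T h j m t * c"
  by (simp add: time_conv_def flip: mult.assoc)

context inner_fun_space
begin

lemma moll_nrm_bound:
  assumes M: "\<And>t. \<bar>step_deriv h j t\<bar> \<le> M" and \<kappa>: "simple_valued T X \<kappa>"
  shows "nrm X (moll T h j \<kappa> t) \<le> M * (\<integral>s. nrm X (\<kappa> s) \<partial>time_measure T)"
proof (rule nrm_le_if_tested)
  let ?v = "moll T h j \<kappa> t"
  show v: "?v \<in> elems X" by (rule self.moll_in[OF \<kappa>])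
  have M0: "M \<ge> 0" using M[of 0] by simp
  show "0 \<le> M * (\<integral>s. nrm X (\<kappa> s) \<partial>time_measure T)"
    using \<kappa> by (intro mult_nonneg_nonneg M0 integral_nonneg_AE AE_I2) (simp add: simple_valued_def nrm_nonneg)
  have "B ?v ?v = (\<integral>s. step_deriv h j (t - s) * B (\<kappa> s) ?v \<partial>time_measure T)"
    using self.moll_form[OF \<kappa> v] by (simp add: time_conv_def)
  also have "\<dots> \<le> (\<integral>s. M * (nrm X (\<kappa> s) * nrm X ?v) \<partial>time_measure T)"
  proof (rule integral_mono_AE)
    show "integrable (time_measure T) (\<lambda>s. step_deriv h j (t - s) * B (\<kappa> s) ?v)"
      by (intro mollify_integrable simple_valued_integrable[OF \<kappa>])
    show "integrable (time_measure T) (\<lambda>s. M * (nrm X (\<kappa> s) * nrm X ?v))"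
      by (rule simple_valued_integrable[OF \<kappa>])
    show "AE s in time_measure T. step_deriv h j (t - s) * B (\<kappa> s) ?v \<le> M * (nrm X (\<kappa> s) * nrm X ?v)"
    proof (rule AE_I2)
      fix s assume "s \<in> space (time_measure T)"
      then have s: "\<kappa> s \<in> elems X" using \<kappa> by (simp add: simple_valued_def)
      have "step_deriv h j (t - s) * B (\<kappa> s) ?v \<le> \<bar>step_deriv h j (t - s)\<bar> * \<bar>B (\<kappa> s) ?v\<bar>"
        by (metis abs_ge_self abs_mult)
      also have "\<dots> \<le> M * (nrm X (\<kappa> s) * nrm X ?v)"
        by (intro mult_mono M self.form_bound s v M0) simp
      finally show "step_deriv h j (t - s) * B (\<kappa> s) ?v \<le> M * (nrm X (\<kappa> s) * nrm X ?v)" .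
    qed
  qed
  also have "\<dots> = M * (\<integral>s. nrm X (\<kappa> s) \<partial>time_measure T) * nrm X ?v" by simp
  finally show "B ?v ?v \<le> M * (\<integral>s. nrm X (\<kappa> s) \<partial>time_measure T) * nrm X ?v" .
qed

lemma simple_approx_L1:
  assumes \<zeta>: "strongly_measurable T X \<zeta>" "integrable (time_measure T) (\<lambda>t. nrm X (\<zeta> t))" and \<sigma>: "simple_valued T X \<sigma>"
    and d: "integrable (time_measure T) (\<lambda>t. nrm X (\<lambda>x. \<zeta> t x - \<sigma> t x))"
  shows "(\<integral>t. nrm X (\<sigma> t) \<partial>time_measure T)
    \<le> (\<integral>t. nrm X (\<zeta> t) \<partial>time_measure T) + (\<integral>t. nrm X (\<lambda>x. \<zeta> t x - \<sigma> t x) \<partial>time_measure T)"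
proof -
  have "(\<integral>t. nrm X (\<sigma> t) \<partial>time_measure T) \<le> (\<integral>t. nrm X (\<zeta> t) + nrm X (\<lambda>x. \<zeta> t x - \<sigma> t x) \<partial>time_measure T)"
  proof (rule integral_mono_AE)
    have "AE s in time_measure T. \<zeta> s \<in> elems X" using \<zeta>(1) by (simp add: strongly_measurable_def)
    then show "AE t in time_measure T. nrm X (\<sigma> t) \<le> nrm X (\<zeta> t) + nrm X (\<lambda>x. \<zeta> t x - \<sigma> t x)"
      using AE_space
    proof eventually_elim
      case (elim t)
      have "\<sigma> t \<in> elems X" using \<sigma> elim(2) by (simp add: simple_valued_def)
      from nrm_lipschitz[OF elim(1) this] show ?case by (simp add: abs_le_iff)
    qed
  qed (use \<zeta> d simple_valued_integrable[OF \<sigma>] in auto)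
  then show ?thesis using \<zeta> d by simp
qed

lemma moll_diff_bound:
  assumes h: "h > 0" and \<sigma>: "simple_valued T X \<sigma>" and \<rho>: "simple_valued T X \<rho>"
  shows "nrm X (\<lambda>x. moll T h 1 \<sigma> t x - moll T h 1 \<rho> t x) \<le> mollify T h 1 (\<lambda>s. nrm X (\<lambda>x. \<sigma> s x - \<rho> s x)) t"
proof (rule nrm_le_if_tested)
  let ?v = "\<lambda>x. moll T h 1 \<sigma> t x - moll T h 1 \<rho> t x" and ?k = "\<lambda>s. step_deriv h 1 (t - s)"
  note m = self.moll_in[OF \<sigma>, of h 1 t] self.moll_in[OF \<rho>, of h 1 t]
  show v: "?v \<in> elems X" by (rule diff_in[OF m])
  have in_X: "\<sigma> s \<in> elems X" "\<rho> s \<in> elems X" if "s \<in> space (time_measure T)" for s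
    using that \<sigma> \<rho> by (simp_all add: simple_valued_def)
  from simple_valued_integrable[OF simple_valued_diff[OF \<sigma> \<rho>], of "nrm X"]
  have int: "integrable (time_measure T) (\<lambda>s. nrm X (\<lambda>x. \<sigma> s x - \<rho> s x))" by simp
  show "0 \<le> mollify T h 1 (\<lambda>s. nrm X (\<lambda>x. \<sigma> s x - \<rho> s x)) t"
    unfolding time_conv_def
    by (intro integral_nonneg_AE AE_I2 mult_nonneg_nonneg step_deriv_1_nonneg h nrm_nonneg diff_in in_X)
  have i: "integrable (time_measure T) (\<lambda>s. ?k s * B (\<sigma> s) ?v)" "integrable (time_measure T) (\<lambda>s. ?k s * B (\<rho> s) ?v)"
    by (intro mollify_integrable simple_valued_integrable[OF \<sigma>] simple_valued_integrable[OF \<rho>])+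
  have "B ?v ?v = B (moll T h 1 \<sigma> t) ?v - B (moll T h 1 \<rho> t) ?v" by (rule diff_left[OF m v])
  also have "\<dots> = (\<integral>s. ?k s * B (\<sigma> s) ?v - ?k s * B (\<rho> s) ?v \<partial>time_measure T)"
    using i by (simp add: self.moll_form[OF \<sigma> v] self.moll_form[OF \<rho> v] time_conv_def)
  also have "\<dots> \<le> (\<integral>s. ?k s * (nrm X (\<lambda>x. \<sigma> s x - \<rho> s x) * nrm X ?v) \<partial>time_measure T)"
  proof (rule integral_mono_AE)
    show "AE s in time_measure T. ?k s * B (\<sigma> s) ?v - ?k s * B (\<rho> s) ?v \<le> ?k s * (nrm X (\<lambda>x. \<sigma> s x - \<rho> s x) * nrm X ?v)"
    proof (rule AE_I2)
      fix s assume s: "s \<in> space (time_measure T)"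
      have "?k s * B (\<sigma> s) ?v - ?k s * B (\<rho> s) ?v = ?k s * B (\<lambda>x. \<sigma> s x - \<rho> s x) ?v"
        using diff_left[OF in_X[OF s] v] by (simp add: right_diff_distrib)
      also have "\<dots> \<le> ?k s * (nrm X (\<lambda>x. \<sigma> s x - \<rho> s x) * nrm X ?v)"
        using self.form_bound[OF diff_in[OF in_X[OF s]] v] by (intro mult_left_mono step_deriv_1_nonneg h) simp
      finally show "?k s * B (\<sigma> s) ?v - ?k s * B (\<rho> s) ?v \<le> ?k s * (nrm X (\<lambda>x. \<sigma> s x - \<rho> s x) * nrm X ?v)" .
    qed
    show "integrable (time_measure T) (\<lambda>s. ?k s * (nrm X (\<lambda>x. \<sigma> s x - \<rho> s x) * nrm X ?v))"
      by (intro mollify_integrable integrable_mult_left int)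
  qed (use i in auto)
  also have "\<dots> = mollify T h 1 (\<lambda>s. nrm X (\<lambda>x. \<sigma> s x - \<rho> s x)) t * nrm X ?v"
    using mollify_scale[of T h 1 "\<lambda>s. nrm X (\<lambda>x. \<sigma> s x - \<rho> s x)" "nrm X ?v" t] by (simp add: time_conv_def)
  finally show "B ?v ?v \<le> mollify T h 1 (\<lambda>s. nrm X (\<lambda>x. \<sigma> s x - \<rho> s x)) t * nrm X ?v" .
qed

text \<open>The coefficients of the mollification of \<open>\<sigma>\<close> are the mollified indicators of its level sets.\<close>

lemma moll_simple_tendsto:
  assumes T: "0 < T" and \<sigma>: "simple_valued T X \<sigma>" and e: "e > 0"
  obtains h D where "h > 0" "integrable (time_measure T) D" "(\<integral>t. D t \<partial>time_measure T) < e"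
    "\<And>t. 0 < t \<Longrightarrow> t < T \<Longrightarrow> nrm X (\<lambda>x. \<sigma> t x - moll T h 1 \<sigma> t x) \<le> D t"
proof -
  let ?S = "\<sigma> ` {0<..<T}" and ?E = "\<lambda>g. {t \<in> {0<..<T}. \<sigma> t = g}"
  have fin: "finite ?S" and S: "\<And>g. g \<in> ?S \<Longrightarrow> g \<in> elems X"
    using simple_valued_finite[OF \<sigma>] simple_valued_in[OF \<sigma>] by auto
  define D where "D h t = (\<Sum>g\<in>?S. \<bar>indicator (?E g) t - mollify T h 1 (indicator (?E g)) t\<bar> * nrm X g)" for h t
  have ind: "integrable (time_measure T) (indicator (?E g) :: real \<Rightarrow> real)" for g
  proof (rule integrable_time_bounded[of _ _ 1])
    show "(indicator (?E g) :: real \<Rightarrow> real) \<in> borel_measurable (time_measure T)"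
      using simple_valued_sets(1)[OF \<sigma>] by (intro measurable_restrict_space1 borel_measurable_indicator)
  qed (auto simp: indicator_def)
  have int: "integrable (time_measure T) (\<lambda>t. \<bar>indicator (?E g) t - mollify T h 1 (indicator (?E g)) t\<bar> * nrm X g)" if "h > 0" for h g
    using ind[of g] continuous_time_integrable[OF mollify_continuous[OF that ind[of g]]] by simp
  have "((\<lambda>h. \<Sum>g\<in>?S. (\<integral>t. \<bar>indicator (?E g) t - mollify T h 1 (indicator (?E g)) t\<bar> \<partial>time_measure T) * nrm X g) \<longlongrightarrow> (\<Sum>g\<in>?S. 0 * nrm X g)) (at_right 0)"
    by (intro tendsto_sum tendsto_mult tendsto_const mollify_indicator_tendsto T simple_valued_sets(1)[OF \<sigma>]) auto
  then have "eventually (\<lambda>h. (\<Sum>g\<in>?S. (\<integral>t. \<bar>indicator (?E g) t - mollify T h 1 (indicator (?E g)) t\<bar> \<partial>time_measure T) * nrm X g) < e) (at_right 0)"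
    using e by (intro order_tendstoD(2)) auto
  then obtain h where h: "h > 0" "(\<Sum>g\<in>?S. (\<integral>t. \<bar>indicator (?E g) t - mollify T h 1 (indicator (?E g)) t\<bar> \<partial>time_measure T) * nrm X g) < e"
    unfolding eventually_at_right_field by (meson dense)
  show ?thesis
  proof (rule that[of h "D h"])
    show "integrable (time_measure T) (D h)" unfolding D_def[abs_def] by (intro Bochner_Integration.integrable_sum int h)
    show "(\<integral>t. D h t \<partial>time_measure T) < e"
    proof -
      have "(\<integral>t. D h t \<partial>time_measure T)
          = (\<Sum>g\<in>?S. (\<integral>t. \<bar>indicator (?E g) t - mollify T h 1 (indicator (?E g)) t\<bar> * nrm X g \<partial>time_measure T))"
        unfolding D_def by (rule Bochner_Integration.integral_sum[OF int[OF h(1)]])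
      then show ?thesis using h(2) by (simp only: integral_mult_left_zero)
    qed
    fix t assume t: "0 < t" "t < T"
    have "\<sigma> t x = (\<Sum>g\<in>?S. indicator (?E g) t * g x)" for x
    proof -
      have "(\<Sum>g\<in>?S. indicator (?E g) t * g x) = (\<Sum>g\<in>?S. if \<sigma> t = g then g x else 0)"
        using t by (intro sum.cong) (auto simp: indicator_def)
      also have "\<dots> = \<sigma> t x" using t fin by (simp add: sum.delta)
      finally show ?thesis by simp
    qed
    moreover have "mollify T h 1 (indicator {s. \<sigma> s = g}) t = mollify T h 1 (indicator (?E g)) t" for g
      unfolding time_conv_def by (intro Bochner_Integration.integral_cong) (auto simp: indicator_def)
    ultimately have "(\<lambda>x. \<sigma> t x - moll T h 1 \<sigma> t x)
        = (\<lambda>x. \<Sum>g\<in>?S. (indicator (?E g) t - mollify T h 1 (indicator (?E g)) t) * g x)"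
      by (simp add: moll_eq sum_subtractf left_diff_distrib)
    then show "nrm X (\<lambda>x. \<sigma> t x - moll T h 1 \<sigma> t x) \<le> D h t"
      unfolding D_def nrm_eq using norm_sum[OF fin, of "\<lambda>g. g"] S by simp
  qed (rule h)
qed

end

context evolution_pair
begin

text \<open>The bound from \<open>damped_wave_energy\<close>, with the bound of \<open>second_derivative_energy\<close> for the
  second derivative of \<open>\<gamma>\<close> inserted, both without the residuals.\<close>

definition state_bound :: real where
  "state_bound = exp T * (2 * (\<integral>t. (Fn t)\<^sup>2 \<partial>time_measure T)
     + 2 * \<tau>\<^sup>2 * (exp 1 * ((\<integral>t. (Qn t)\<^sup>2 \<partial>time_measure T) + a y1 y1)))"

lemma state_bound_nonneg: "state_bound \<ge> 0"
  unfolding state_bound_def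
  by (intro mult_nonneg_nonneg add_nonneg_nonneg integral_nonneg_AE AE_I2 a.nonneg y1) auto

lemma mollified_functional_bound:
  assumes h: "h > 0" and g: "g \<in> elems X" and G: "integrable (time_measure T) (\<lambda>t. G t g)" "integrable (time_measure T) Gn"
    and bound: "AE t in time_measure T. \<bar>G t g\<bar> \<le> Gn t * form_norm b g"
  shows "\<bar>mollify T h 1 (\<lambda>s. G s g) t\<bar> \<le> mollify T h 1 Gn t * form_norm b g"
  using mollify_bound[OF h G(1) integrable_mult_left[OF G(2)] bound, of t] by (simp only: mollify_scale)

text \<open>The residuals are of the order \<open>\<delta>\<close>, with a constant that contains bounds for the derivatives of
  the kernel and so depends on \<open>h\<close>, but not on the approximating simple functions.\<close>

lemma mollified_state_bound:
  assumes h: "h > 0"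
  obtains C where "C \<ge> 0"
    "\<And>\<sigma> \<kappa> \<delta> t. \<lbrakk>simple_valued T X \<sigma>; simple_valued T X \<kappa>; 0 \<le> \<delta>; \<delta> \<le> 1;
       integrable (time_measure T) (\<lambda>t. nrm X (\<lambda>x. \<zeta> t x - \<sigma> t x)); (\<integral>t. nrm X (\<lambda>x. \<zeta> t x - \<sigma> t x) \<partial>time_measure T) \<le> \<delta>;
       integrable (time_measure T) (\<lambda>t. nrm X (\<lambda>x. \<gamma> t x - \<kappa> t x)); (\<integral>t. nrm X (\<lambda>x. \<gamma> t x - \<kappa> t x) \<partial>time_measure T) \<le> \<delta>;
       0 < t; t < T\<rbrakk> \<Longrightarrow> (nrm X (moll T h 1 \<sigma> t))\<^sup>2 \<le> state_bound + C * \<delta>"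
proof -
  obtain M1 M2 M3 where M: "M1 \<ge> 0" "M2 \<ge> 0" "M3 \<ge> 0" "\<And>t. \<bar>step_deriv h 1 t\<bar> \<le> M1" "\<And>t. \<bar>step_deriv h 2 t\<bar> \<le> M2" "\<And>t. \<bar>step_deriv h 3 t\<bar> \<le> M3"
    using step_deriv_bounded[OF h] by metis
  define M where "M = M1 + M2 + M3"
  have M0: "M \<ge> 0" and Mj: "\<bar>step_deriv h 1 t\<bar> \<le> M" "\<bar>step_deriv h 2 t\<bar> \<le> M" "\<bar>step_deriv h 3 t\<bar> \<le> M" for t
    using M(1-3) M(4-6)[of t] by (auto simp: M_def)
  have sm: "strongly_measurable T X \<zeta>" "strongly_measurable T X \<gamma>" using \<zeta> \<gamma> by (auto simp: L2_Bochner_def)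
  define Lz where "Lz = M * ((\<integral>t. nrm X (\<zeta> t) \<partial>time_measure T) + 1)"
  define Lg where "Lg = M * ((\<integral>t. nrm X (\<gamma> t) \<partial>time_measure T) + 1)"
  have nn: "(\<integral>t. nrm X (\<zeta> t) \<partial>time_measure T) \<ge> 0" "(\<integral>t. nrm X (\<gamma> t) \<partial>time_measure T) \<ge> 0"
  proof -
    have "AE t in time_measure T. 0 \<le> nrm X (f t)" if "strongly_measurable T X f" for f
    proof -
      have "AE t in time_measure T. f t \<in> elems X" using that by (simp add: strongly_measurable_def)
      then show ?thesis by eventually_elim (rule nrm_nonneg)
    qed
    from this[OF sm(1)] this[OF sm(2)]
    show "(\<integral>t. nrm X (\<zeta> t) \<partial>time_measure T) \<ge> 0" "(\<integral>t. nrm X (\<gamma> t) \<partial>time_measure T) \<ge> 0"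
      by (auto intro: integral_nonneg_AE)
  qed
  have L0: "Lz \<ge> 0" "Lg \<ge> 0" using M0 nn by (auto simp: Lz_def Lg_def)
  define C where "C = exp T * (2 * \<tau>\<^sup>2 * (exp 1 * (2 * (2 * M * Lg) * T)) + 2 * ((2 * \<tau> + 2) * M * Lz) * T)"
  show ?thesis
  proof (rule that[of C])
    show "C \<ge> 0" unfolding C_def using M0 L0 T \<tau> by (intro mult_nonneg_nonneg add_nonneg_nonneg) auto
    fix \<sigma> \<kappa> \<delta> s
    assume \<sigma>: "simple_valued T X \<sigma>" and \<kappa>: "simple_valued T X \<kappa>" and \<delta>: "0 \<le> \<delta>" "\<delta> \<le> 1"
      and d\<sigma>: "integrable (time_measure T) (\<lambda>t. nrm X (\<lambda>x. \<zeta> t x - \<sigma> t x))" "(\<integral>t. nrm X (\<lambda>x. \<zeta> t x - \<sigma> t x) \<partial>time_measure T) \<le> \<delta>"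
      and d\<kappa>: "integrable (time_measure T) (\<lambda>t. nrm X (\<lambda>x. \<gamma> t x - \<kappa> t x))" "(\<integral>t. nrm X (\<lambda>x. \<gamma> t x - \<kappa> t x) \<partial>time_measure T) \<le> \<delta>"
      and s: "0 < s" "s < T"
    let ?w = "\<lambda>j. moll T h j \<sigma>" and ?p = "\<lambda>j. moll T h j \<kappa>"
    have w: "?w j t \<in> elems X" and p: "?p j t \<in> elems X" for j t
      by (rule self.moll_in[OF \<sigma>], rule self.moll_in[OF \<kappa>])
    have w_le: "nrm X (?w 2 t) \<le> Lz" and p_le: "nrm X (?p 3 t) \<le> Lg" for t
    proof -
      have "(\<integral>t. nrm X (\<sigma> t) \<partial>time_measure T) \<le> (\<integral>t. nrm X (\<zeta> t) \<partial>time_measure T) + 1"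
        using simple_approx_L1[OF sm(1) L2_Bochner_nrm[OF \<zeta>] \<sigma> d\<sigma>(1)] d\<sigma>(2) \<delta> by linarith
      then have "M * (\<integral>t. nrm X (\<sigma> t) \<partial>time_measure T) \<le> Lz" unfolding Lz_def by (intro mult_left_mono M0)
      then show "nrm X (?w 2 t) \<le> Lz" using moll_nrm_bound[OF Mj(2) \<sigma>, of t] by linarith
      have "(\<integral>t. nrm X (\<kappa> t) \<partial>time_measure T) \<le> (\<integral>t. nrm X (\<gamma> t) \<partial>time_measure T) + 1"
        using simple_approx_L1[OF sm(2) L2_Bochner_nrm[OF \<gamma>] \<kappa> d\<kappa>(1)] d\<kappa>(2) \<delta> by linarith
      then have "M * (\<integral>t. nrm X (\<kappa> t) \<partial>time_measure T) \<le> Lg" unfolding Lg_def by (intro mult_left_mono M0)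
      then show "nrm X (?p 3 t) \<le> Lg" using moll_nrm_bound[OF Mj(3) \<kappa>, of t] by linarith
    qed
    have ib: "integrable (time_measure T) (\<lambda>s. b (\<zeta> s) g)" "integrable (time_measure T) (\<lambda>s. b (\<gamma> s) g)"
      and ia: "integrable (time_measure T) (\<lambda>s. a (\<zeta> s) g)" "integrable (time_measure T) (\<lambda>s. a (\<gamma> s) g)"
      if g: "g \<in> elems X" for g
      using bounded_functional.L2_Bochner_functional(2)[OF fb.form_functional[OF g]]
        bounded_functional.L2_Bochner_functional(2)[OF fa.form_functional[OF g]] \<zeta> \<gamma> by blast+
    have ap\<gamma>: "\<bar>mollify T h 3 (\<lambda>s. b (\<gamma> s) g) t - b (?p 3 t) g\<bar> \<le> M * \<delta> * nrm X g"
      "\<bar>mollify T h 2 (\<lambda>s. a (\<gamma> s) g) t - a (?p 2 t) g\<bar> \<le> M * \<delta> * nrm X g"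
      and ap\<zeta>: "\<bar>mollify T h 3 (\<lambda>s. b (\<zeta> s) g) t - b (?w 3 t) g\<bar> \<le> M * \<delta> * nrm X g"
      "\<bar>mollify T h 2 (\<lambda>s. b (\<zeta> s) g) t - b (?w 2 t) g\<bar> \<le> M * \<delta> * nrm X g"
      "\<bar>mollify T h 1 (\<lambda>s. a (\<zeta> s) g) t - a (?w 1 t) g\<bar> \<le> M * \<delta> * nrm X g" if g: "g \<in> elems X" for g t
      by (intro fb.moll_approx fa.moll_approx Mj \<sigma> \<kappa> g sm ib ia d\<sigma> d\<kappa>)+
    let ?NF = "\<lambda>t. mollify T h 1 Fn t" and ?NQ = "\<lambda>t. mollify T h 1 Qn t" and ?P = "\<lambda>t. b (?p 3 t) (?p 3 t)"
    have eq1: "b (?p 3 t) (?p 3 t) + a (?p 2 t) (?p 3 t) + step_deriv h 0 t * a y1 (?p 3 t)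
        \<le> ?NQ t * form_norm b (?p 3 t) + 2 * M * \<delta> * Lg" if t: "0 < t" "t < T" for t
    proof -
      let ?g = "?p 3 t"
      have g: "?g \<in> elems X" by (rule p)
      have "M * \<delta> * nrm X ?g \<le> M * \<delta> * Lg" by (intro mult_left_mono p_le mult_nonneg_nonneg M0 \<delta>)
      then show ?thesis
        using mollified_equations(1)[OF h t g] ap\<gamma>[OF g, of t] 
          mollified_functional_bound[where G = Q, OF h g Q_int[OF g] Qn(1) Q_bound[OF g], of t]
        by (simp add: abs_le_iff algebra_simps)
    qed
    have eP: "(\<integral>t. ?P t \<partial>time_measure T) \<le> exp 1 * ((\<integral>t. (Qn t)\<^sup>2 \<partial>time_measure T) + a y1 y1 + 2 * (2 * M * \<delta> * Lg) * T)"
    proof -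
      have "(\<integral>t. ?P t \<partial>time_measure T) \<le> exp 1 * ((\<integral>t. (?NQ t)\<^sup>2 \<partial>time_measure T) + a y1 y1 + 2 * (2 * M * \<delta> * Lg) * T)"
        using M0 \<delta> L0 by (intro second_derivative_energy[OF h T \<kappa> y1 mollify_continuous[OF h Qn(1)] _ eq1]) auto
      also have "\<dots> \<le> exp 1 * ((\<integral>t. (Qn t)\<^sup>2 \<partial>time_measure T) + a y1 y1 + 2 * (2 * M * \<delta> * Lg) * T)"
        using T by (intro mult_left_mono add_right_mono mollify_square_integral h Qn) auto
      finally show ?thesis .
    qed
    have eq2: "\<tau> * b (?w 3 t) (?w 2 t) + b (?w 2 t) (?w 2 t) + a (?w 1 t) (?w 2 t)
        \<le> ?NF t * form_norm b (?w 2 t) + \<tau> * sqrt (?P t) * form_norm b (?w 2 t) + (2 * \<tau> + 2) * M * \<delta> * Lz"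
      if t: "0 < t" "t < T" for t
    proof -
      let ?g = "?w 2 t"
      have g: "?g \<in> elems X" by (rule w)
      define r where "r = M * \<delta> * nrm X ?g"
      have "M * \<delta> * nrm X ?g \<le> M * \<delta> * Lz" by (intro mult_left_mono w_le mult_nonneg_nonneg M0 \<delta>)
      then have r: "(2 * \<tau> + 2) * r \<le> (2 * \<tau> + 2) * (M * \<delta> * Lz)"
        unfolding r_def by (rule mult_left_mono) (use \<tau> in simp)
      have r1: "\<tau> * b (?w 3 t) ?g \<le> \<tau> * (mollify T h 3 (\<lambda>s. b (\<zeta> s) ?g) t + r)"
        using ap\<zeta>(1)[OF g, of t] \<tau> unfolding r_def by (intro mult_left_mono) (auto simp: abs_le_iff)
      have "\<bar>b (?p 3 t) ?g\<bar> \<le> sqrt (?P t) * form_norm b ?g"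
        using b.cauchy_schwarz[OF p g] by (simp add: form_norm_def)
      then have r2: "- (\<tau> * mollify T h 3 (\<lambda>s. b (\<gamma> s) ?g) t) \<le> \<tau> * (sqrt (?P t) * form_norm b ?g + r)"
        using ap\<gamma>(1)[OF g, of t] \<tau> unfolding r_def mult_minus_right[symmetric]
        by (intro mult_left_mono) (auto simp: abs_le_iff)
      have r3: "b (?w 2 t) ?g \<le> mollify T h 2 (\<lambda>s. b (\<zeta> s) ?g) t + r" "a (?w 1 t) ?g \<le> mollify T h 1 (\<lambda>s. a (\<zeta> s) ?g) t + r"
        using ap\<zeta>(2,3)[OF g, of t] unfolding r_def by (auto simp: abs_le_iff)
      have r4: "mollify T h 1 (\<lambda>s. F s ?g) t \<le> ?NF t * form_norm b ?g"
        using mollified_functional_bound[where G = F, OF h g F_int[OF g] Fn(1) F_bound[OF g], of t] by (simp add: abs_le_iff)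
      show ?thesis
        using mollified_equations(2)[OF h t g] r r1 r2 r3 r4 by (simp add: algebra_simps)
    qed
    have "(nrm X (?w 1 s))\<^sup>2 \<le> exp T * (2 * (\<integral>t. (?NF t)\<^sup>2 \<partial>time_measure T) + 2 * \<tau>\<^sup>2 * (\<integral>t. ?P t \<partial>time_measure T)
        + 2 * ((2 * \<tau> + 2) * M * \<delta> * Lz) * T)"
      using M0 \<delta> L0 \<tau>
      by (intro damped_wave_energy[OF h \<tau> \<sigma> mollify_continuous[OF h Fn(1)] fb.moll_continuous[OF h \<kappa> \<kappa>] _ _ eq2 s] b.nonneg p) auto
    also have "\<dots> \<le> exp T * (2 * (\<integral>t. (Fn t)\<^sup>2 \<partial>time_measure T)
        + 2 * \<tau>\<^sup>2 * (exp 1 * ((\<integral>t. (Qn t)\<^sup>2 \<partial>time_measure T) + a y1 y1 + 2 * (2 * M * \<delta> * Lg) * T))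
        + 2 * ((2 * \<tau> + 2) * M * \<delta> * Lz) * T)"
      using T by (intro mult_left_mono add_right_mono add_mono eP mollify_square_integral h Fn) auto
    also have "\<dots> = state_bound + C * \<delta>"
      unfolding state_bound_def C_def by (simp add: algebra_simps)
    finally show "(nrm X (?w 1 s))\<^sup>2 \<le> state_bound + C * \<delta>" .
  qed
qed

text \<open>Because of the constant in \<open>mollified_state_bound\<close>, the approximations are chosen in this order:
  \<open>\<rho>\<close> close to \<open>\<zeta>\<close>, then \<open>h\<close> so small that mollification hardly changes \<open>\<rho>\<close>, then \<open>\<sigma>\<close> and \<open>\<kappa>\<close> close
  to \<open>\<zeta>\<close> and \<open>\<gamma>\<close> as required by this \<open>h\<close>. The mollifications of \<open>\<rho>\<close> and \<open>\<sigma>\<close> differ in \<open>L\<^sup>1\<close> by no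
  more than \<open>\<rho>\<close> and \<open>\<sigma>\<close> do.\<close>

lemma state_le_bound: "AE t in time_measure T. (nrm X (\<zeta> t))\<^sup>2 \<le> state_bound"
proof -
  let ?K = state_bound
  have sm: "strongly_measurable T X \<zeta>" "strongly_measurable T X \<gamma>" using \<zeta> \<gamma> by (auto simp: L2_Bochner_def)
  have inX: "AE t in time_measure T. \<zeta> t \<in> elems X" using sm(1) by (simp add: strongly_measurable_def)
  note i\<zeta> = L2_Bochner_nrm[OF \<zeta>] and i\<gamma> = L2_Bochner_nrm[OF \<gamma>]
  have imax: "integrable (time_measure T) (\<lambda>t. max 0 (nrm X (\<zeta> t) - c))" for c
    using i\<zeta> integrable_time_const[of T c] by (intro integrable_max) auto
  have small: "(\<integral>t. max 0 (nrm X (\<zeta> t) - sqrt (?K + e)) \<partial>time_measure T) \<le> 4 * e" if e: "e > 0" for e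
  proof -
    obtain \<rho> where \<rho>: "simple_valued T X \<rho>" "integrable (time_measure T) (\<lambda>t. nrm X (\<lambda>x. \<zeta> t x - \<rho> t x))"
      "(\<integral>t. nrm X (\<lambda>x. \<zeta> t x - \<rho> t x) \<partial>time_measure T) < e"
      using simple_approx[OF sm(1) i\<zeta> e] by blast
    obtain h D where h: "h > 0" and D: "integrable (time_measure T) D" "(\<integral>t. D t \<partial>time_measure T) < e"
      "\<And>t. 0 < t \<Longrightarrow> t < T \<Longrightarrow> nrm X (\<lambda>x. \<rho> t x - moll T h 1 \<rho> t x) \<le> D t"
      using moll_simple_tendsto[OF T \<rho>(1) e] by blast
    obtain C where C: "C \<ge> 0"
      "\<And>\<sigma> \<kappa> \<delta> t. \<lbrakk>simple_valued T X \<sigma>; simple_valued T X \<kappa>; 0 \<le> \<delta>; \<delta> \<le> 1;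
       integrable (time_measure T) (\<lambda>t. nrm X (\<lambda>x. \<zeta> t x - \<sigma> t x)); (\<integral>t. nrm X (\<lambda>x. \<zeta> t x - \<sigma> t x) \<partial>time_measure T) \<le> \<delta>;
       integrable (time_measure T) (\<lambda>t. nrm X (\<lambda>x. \<gamma> t x - \<kappa> t x)); (\<integral>t. nrm X (\<lambda>x. \<gamma> t x - \<kappa> t x) \<partial>time_measure T) \<le> \<delta>;
       0 < t; t < T\<rbrakk> \<Longrightarrow> (nrm X (moll T h 1 \<sigma> t))\<^sup>2 \<le> ?K + C * \<delta>"
      using mollified_state_bound[OF h] by blast
    define \<delta> where "\<delta> = min (min 1 e) (e / (C + 1))"
    have \<delta>: "0 < \<delta>" "\<delta> \<le> 1" "\<delta> \<le> e" using e C(1) by (auto simp: \<delta>_def)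
    have C\<delta>: "C * \<delta> \<le> e"
    proof -
      have "C * \<delta> \<le> (C + 1) * (e / (C + 1))" using C(1) \<delta>(1) by (intro mult_mono) (auto simp: \<delta>_def)
      then show ?thesis using C(1) by simp
    qed
    obtain \<sigma> where \<sigma>: "simple_valued T X \<sigma>" "integrable (time_measure T) (\<lambda>t. nrm X (\<lambda>x. \<zeta> t x - \<sigma> t x))"
      "(\<integral>t. nrm X (\<lambda>x. \<zeta> t x - \<sigma> t x) \<partial>time_measure T) < \<delta>"
      using simple_approx[OF sm(1) i\<zeta> \<delta>(1)] by blast
    obtain \<kappa> where \<kappa>: "simple_valued T X \<kappa>" "integrable (time_measure T) (\<lambda>t. nrm X (\<lambda>x. \<gamma> t x - \<kappa> t x))"
      "(\<integral>t. nrm X (\<lambda>x. \<gamma> t x - \<kappa> t x) \<partial>time_measure T) < \<delta>"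
      using simple_approx[OF sm(2) i\<gamma> \<delta>(1)] by blast
    let ?m = "\<lambda>t. nrm X (\<lambda>x. \<rho> t x - \<sigma> t x)"
    from simple_valued_integrable[OF simple_valued_diff[OF \<rho>(1) \<sigma>(1)], of "nrm X"] have im: "integrable (time_measure T) ?m" by simp
    have m0: "AE t in time_measure T. ?m t \<ge> 0"
      using \<sigma>(1) \<rho>(1) by (intro AE_I2 nrm_nonneg diff_in) (auto simp: simple_valued_def)
    have m_int: "(\<integral>t. ?m t \<partial>time_measure T) \<le> 2 * e"
    proof -
      have "(\<integral>t. ?m t \<partial>time_measure T) \<le> (\<integral>t. nrm X (\<lambda>x. \<zeta> t x - \<rho> t x) + nrm X (\<lambda>x. \<zeta> t x - \<sigma> t x) \<partial>time_measure T)"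
      proof (rule integral_mono_AE)
        show "AE t in time_measure T. ?m t \<le> nrm X (\<lambda>x. \<zeta> t x - \<rho> t x) + nrm X (\<lambda>x. \<zeta> t x - \<sigma> t x)"
          using inX AE_space
        proof eventually_elim
          case (elim t)
          have "\<rho> t \<in> elems X" "\<sigma> t \<in> elems X" using \<sigma>(1) \<rho>(1) elim(2) by (auto simp: simple_valued_def)
          then show ?case
            using norm_diff_triangle[of "\<rho> t" "\<zeta> t" "\<sigma> t"] norm_diff_commute[of "\<zeta> t" "\<rho> t"] elim(1) by (simp add: nrm_eq)
        qed
      qed (use im \<rho> \<sigma> in auto)
      then show ?thesis using \<rho> \<sigma> \<delta> by simp
    qed
    let ?R = "\<lambda>t. nrm X (\<lambda>x. \<zeta> t x - \<rho> t x) + D t + mollify T h 1 ?m t"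
    have imm: "integrable (time_measure T) (\<lambda>t. mollify T h 1 ?m t)"
      by (intro continuous_time_integrable mollify_continuous h im)
    have "(\<integral>t. max 0 (nrm X (\<zeta> t) - sqrt (?K + e)) \<partial>time_measure T) \<le> (\<integral>t. ?R t \<partial>time_measure T)"
    proof (rule integral_mono_AE[OF imax])
      show "integrable (time_measure T) ?R" using \<rho>(2) D(1) imm by simp
      show "AE t in time_measure T. max 0 (nrm X (\<zeta> t) - sqrt (?K + e)) \<le> ?R t"
        using inX AE_space
      proof eventually_elim
        case (elim t)
        then have t: "0 < t" "t < T" by auto
        have in_X: "\<rho> t \<in> elems X" "moll T h 1 \<rho> t \<in> elems X" "moll T h 1 \<sigma> t \<in> elems X"
          using \<rho>(1) t by (auto simp: simple_valued_def intro: self.moll_in \<rho>(1) \<sigma>(1))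
        have "(nrm X (moll T h 1 \<sigma> t))\<^sup>2 \<le> ?K + C * \<delta>"
          using \<delta> \<sigma> \<kappa> t by (intro C(2)) auto
        then have "(nrm X (moll T h 1 \<sigma> t))\<^sup>2 \<le> ?K + e" using C\<delta> by linarith
        then have 1: "nrm X (moll T h 1 \<sigma> t) \<le> sqrt (?K + e)" by (rule real_le_rsqrt)
        have 2: "nrm X (\<lambda>x. moll T h 1 \<rho> t x - moll T h 1 \<sigma> t x) \<le> mollify T h 1 ?m t"
          by (rule moll_diff_bound[OF h \<rho>(1) \<sigma>(1)])
        have 3: "nrm X (\<zeta> t) \<le> nrm X (\<rho> t) + nrm X (\<lambda>x. \<zeta> t x - \<rho> t x)"
          "nrm X (\<rho> t) \<le> nrm X (moll T h 1 \<rho> t) + nrm X (\<lambda>x. \<rho> t x - moll T h 1 \<rho> t x)"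
          "nrm X (moll T h 1 \<rho> t) \<le> nrm X (moll T h 1 \<sigma> t) + nrm X (\<lambda>x. moll T h 1 \<rho> t x - moll T h 1 \<sigma> t x)"
          unfolding nrm_eq by (intro norm_diff_le elim in_X)+
        have 4: "0 \<le> nrm X (\<lambda>x. \<zeta> t x - \<rho> t x)" "0 \<le> nrm X (\<lambda>x. \<rho> t x - moll T h 1 \<rho> t x)"
          "0 \<le> nrm X (\<lambda>x. moll T h 1 \<rho> t x - moll T h 1 \<sigma> t x)"
          by (intro nrm_nonneg diff_in elim in_X)+
        have "nrm X (\<zeta> t) - sqrt (?K + e) \<le> ?R t" "0 \<le> ?R t" using 1 2 3 4 D(3)[OF t] by simp_all
        then show ?case by simp
      qed
    qed
    also have "\<dots> = (\<integral>t. nrm X (\<lambda>x. \<zeta> t x - \<rho> t x) \<partial>time_measure T) + (\<integral>t. D t \<partial>time_measure T) + (\<integral>t. mollify T h 1 ?m t \<partial>time_measure T)"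
      using \<rho>(2) D(1) imm by simp
    also have "\<dots> \<le> e + e + 2 * e"
      using \<rho>(3) D(2) mollify_L1[OF h less_imp_le[OF T] im m0] m_int by (intro add_mono) auto
    finally show ?thesis by simp
  qed
  have AE_e: "AE t in time_measure T. nrm X (\<zeta> t) \<le> sqrt (?K + e)" if e: "e > 0" for e
  proof -
    let ?I = "\<integral>t. max 0 (nrm X (\<zeta> t) - sqrt (?K + e)) \<partial>time_measure T"
    have "?I \<le> 0 + d" if d: "d > 0" for d
    proof -
      let ?d = "min e (d / 4)"
      have "?I \<le> (\<integral>t. max 0 (nrm X (\<zeta> t) - sqrt (?K + ?d)) \<partial>time_measure T)"
      proof (rule integral_mono_AE[OF imax imax], rule AE_I2)
        fix t
        have "sqrt (?K + ?d) \<le> sqrt (?K + e)" by (intro real_sqrt_le_mono) simp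
        then show "max 0 (nrm X (\<zeta> t) - sqrt (?K + e)) \<le> max 0 (nrm X (\<zeta> t) - sqrt (?K + ?d))" by (intro max.mono) auto
      qed
      also have "\<dots> \<le> 4 * ?d" using e d by (intro small) simp
      also have "\<dots> \<le> d" by simp
      finally show ?thesis by simp
    qed
    then have "?I \<le> 0" by (rule field_le_epsilon)
    moreover have "?I \<ge> 0" by (intro integral_nonneg_AE AE_I2) simp
    ultimately have "AE t in time_measure T. max 0 (nrm X (\<zeta> t) - sqrt (?K + e)) = 0"
      by (subst integral_nonneg_eq_0_iff_AE[symmetric, OF imax]) auto
    then show ?thesis by eventually_elim (simp add: max_def split: if_splits)
  qed
  have "AE t in time_measure T. \<forall>n::nat. nrm X (\<zeta> t) \<le> sqrt (?K + 1 / (real n + 1))"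
    unfolding AE_all_countable by (intro allI AE_e) simp
  then show ?thesis
    using inX
  proof eventually_elim
    case (elim t)
    have "(nrm X (\<zeta> t))\<^sup>2 \<le> ?K + 0 + 1 / (real n + 1)" for n :: nat
    proof -
      have "(nrm X (\<zeta> t))\<^sup>2 \<le> (sqrt (?K + 1 / (real n + 1)))\<^sup>2"
        using elim(1) nrm_nonneg[OF elim(2)] by (intro power_mono) auto
      also have "\<dots> = ?K + 1 / (real n + 1)" using state_bound_nonneg by (intro real_sqrt_pow2) simp
      finally show ?thesis by simp
    qed
    moreover have "(\<lambda>n. 1 / (real n + 1)) \<longlonglongrightarrow> 0"
      using LIMSEQ_inverse_real_of_nat by (simp add: inverse_eq_divide add.commute)
    then have "(\<lambda>n. ?K + 0 + 1 / (real n + 1)) \<longlonglongrightarrow> ?K + 0 + 0" by (intro tendsto_intros)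
    ultimately show ?case using LIMSEQ_le_const by fastforce
  qed
qed

end

section \<open>The Cattaneo equation and the heat equation\<close>

lemma L2_Bochner_mono:
  assumes f: "f \<in> L2_Bochner T X" and Y: "inner_fun_space Y B" and sub: "elems X \<subseteq> elems Y"
    and le: "\<And>f. f \<in> elems X \<Longrightarrow> nrm Y f \<le> nrm X f" and diff: "\<And>f g. f \<in> elems X \<Longrightarrow> g \<in> elems X \<Longrightarrow> (\<lambda>x. f x - g x) \<in> elems X"
  shows "f \<in> L2_Bochner T Y" "L2_Bochner_norm T Y f \<le> L2_Bochner_norm T X f"
proof -
  interpret Y: inner_fun_space Y B by fact
  obtain s where s: "\<And>n. simple_valued T X (s n)" "AE t in time_measure T. (\<lambda>n::nat. nrm X (\<lambda>x. f t x - s n t x)) \<longlonglongrightarrow> 0"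
    and inX: "AE t in time_measure T. f t \<in> elems X"
    using f by (auto simp: strongly_measurable_def L2_Bochner_def)
  have int: "integrable (time_measure T) (\<lambda>t. (nrm X (f t))\<^sup>2)" using f by (simp add: L2_Bochner_def)
  have "AE t in time_measure T. (\<lambda>n. nrm Y (\<lambda>x. f t x - s n t x)) \<longlonglongrightarrow> 0"
    using s(2) inX AE_space
  proof eventually_elim
    case (elim t)
    have d: "(\<lambda>x. f t x - s n t x) \<in> elems X" for n
      using s(1)[of n] elim(2,3) by (intro diff) (auto simp: simple_valued_def)
    have "norm (nrm Y (\<lambda>x. f t x - s n t x)) \<le> nrm X (\<lambda>x. f t x - s n t x)" for n
      using le[OF d[of n]] Y.nrm_nonneg[OF subsetD[OF sub d[of n]]] by simp
    then show ?case by (intro Lim_null_comparison[OF always_eventually elim(1)] allI)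
  qed
  moreover have "simple_valued T Y (s n)" for n using s(1)[of n] sub by (auto simp: simple_valued_def)
  moreover have inY: "AE t in time_measure T. f t \<in> elems Y" using inX by eventually_elim (use sub in blast)
  ultimately have sm: "strongly_measurable T Y f" unfolding strongly_measurable_def by blast
  have AE_le: "AE t in time_measure T. (nrm Y (f t))\<^sup>2 \<le> (nrm X (f t))\<^sup>2"
    using inX inY by eventually_elim (intro power_mono le Y.nrm_nonneg)
  have intY: "integrable (time_measure T) (\<lambda>t. (nrm Y (f t))\<^sup>2)"
  proof (rule Bochner_Integration.integrable_bound[OF int])
    show "(\<lambda>t. (nrm Y (f t))\<^sup>2) \<in> borel_measurable (time_measure T)" using Y.measurable_nrm[OF sm] by measurable
    show "AE t in time_measure T. norm ((nrm Y (f t))\<^sup>2) \<le> norm ((nrm X (f t))\<^sup>2)" using AE_le by eventually_elim simp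
  qed
  then show "f \<in> L2_Bochner T Y" using sm by (simp add: L2_Bochner_def)
  show "L2_Bochner_norm T Y f \<le> L2_Bochner_norm T X f"
    unfolding L2_Bochner_norm_def by (intro real_sqrt_le_mono integral_mono_AE intY int AE_le)
qed

lemma deriv_vanishes:
  fixes \<phi> :: "real \<Rightarrow> real"
  assumes "\<And>t. t > c \<Longrightarrow> \<phi> t = 0" "t > c"
  shows "deriv \<phi> t = 0"
  by (rule DERIV_imp_deriv, rule DERIV_locally_const[where S = "{c<..}" and c = 0]) (use assms in auto)

lemma smooth_time_integrals:
  assumes \<phi>: "smooth \<phi>" "\<And>t. t > c \<Longrightarrow> \<phi> t = 0" "c < T" and T: "0 < T"
  shows "(\<integral>t. deriv \<phi> t \<partial>time_measure T) = - \<phi> 0"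
    "(\<integral>t. deriv \<phi> t * t \<partial>time_measure T) = - (\<integral>t. \<phi> t \<partial>time_measure T)"
proof -
  have c: "continuous_on UNIV \<phi>" "continuous_on UNIV (deriv \<phi>)"
    using \<phi>(1) by (auto intro: smooth_continuous smooth_deriv)
  have zT: "\<phi> T = 0" using \<phi>(2,3) by blast
  show "(\<integral>t. deriv \<phi> t \<partial>time_measure T) = - \<phi> 0"
    using time_integral_FTC_full[OF smooth_deriv(1)[OF \<phi>(1)] c(2), of T] T zT by simp
  have d: "((\<lambda>t. \<phi> t * t) has_real_derivative \<phi> t + deriv \<phi> t * t) (at t)" for t
    using DERIV_mult[OF smooth_deriv(1)[OF \<phi>(1)] DERIV_ident, of t] by (simp add: add.commute)
  have "(\<integral>t. \<phi> t + deriv \<phi> t * t \<partial>time_measure T) = \<phi> T * T - \<phi> 0 * 0"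
    by (rule time_integral_FTC_full[OF d]) (use T in \<open>intro continuous_intros c, simp\<close>)
  moreover have "integrable (time_measure T) \<phi>" "integrable (time_measure T) (\<lambda>t. deriv \<phi> t * t)"
    by (intro continuous_time_integrable continuous_intros c)+
  ultimately show "(\<integral>t. deriv \<phi> t * t \<partial>time_measure T) = - (\<integral>t. \<phi> t \<partial>time_measure T)"
    using zT by simp
qed

text \<open>Unlike in \<open>integral_cong_AE\<close>, the measurability of \<open>f\<close> follows from that of \<open>f'\<close>, because the
  Lebesgue measure is complete.\<close>

lemma time_integral_cong_AE:
  fixes f f' :: "real \<Rightarrow> real"
  assumes "f' \<in> borel_measurable (time_measure T)" "AE t in time_measure T. f t = f' t"
  shows "(\<integral>t. f t \<partial>time_measure T) = (\<integral>t. f' t \<partial>time_measure T)"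
proof (rule integral_cong_AE[OF _ assms])
  have "AE t in time_measure T. (\<lambda>n::nat. f' t) \<longlonglongrightarrow> f t" using assms(2) by eventually_elim simp
  then show "f \<in> borel_measurable (time_measure T)"
    by (rule borel_measurable_AE_limit[rotated 2]) (use assms(1) in auto)
qed

lemma L2_inner_scale_right: "L2_inner \<Omega> f (\<lambda>x. c * g x) = c * L2_inner \<Omega> f g"
  by (simp add: L2_inner_def mult.left_commute)

context bounded_open
begin

sublocale HL: inner_fun_space "L2_space \<Omega>" "L2_inner \<Omega>"
  by (simp add: inner_fun_space_def inner_fun_space_axioms_def L2_space_def L2_norm_eq L2.semi_inner_axioms)

sublocale HV: energy_space "H10_space \<Omega>" "form_a \<Omega>" "L2_inner \<Omega>"
  using semi_inner_H10 by (simp add: energy_space_def H10_space_def H1_norm_eq h1_inner_def[abs_def])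

sublocale HH: inner_fun_space "H1_space \<Omega>" "h1_inner \<Omega>"
  using h1.semi_inner_axioms by (simp add: inner_fun_space_def inner_fun_space_axioms_def H1_space_def H1_norm_eq)

lemma L2_norm_le_H1_norm:
  assumes "f \<in> sobolev_H 1 \<Omega>" shows "L2_norm \<Omega> f \<le> H1_norm \<Omega> f"
  using a.nonneg[OF assms] by (simp add: L2_norm_def H1_norm_def)

lemma H1_space_L2_Bochner:
  assumes "f \<in> L2_Bochner T (H1_space \<Omega>)"
  shows "f \<in> L2_Bochner T (L2_space \<Omega>)" "L2_Bochner_norm T (L2_space \<Omega>) f \<le> L2_Bochner_norm T (H1_space \<Omega>) f"
  by (rule L2_Bochner_mono[OF assms HL.inner_fun_space_axioms];
      use sobolev_H_subset_L2 L2_norm_le_H1_norm h1.diff_in in \<open>auto simp: L2_space_def H1_space_def\<close>)+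

lemma L2_functional:
  "g \<in> H10 \<Omega> \<Longrightarrow> bounded_functional (L2_space \<Omega>) (\<lambda>f. L2_inner \<Omega> f g) (L2_norm \<Omega> g)"
  using HL.inner_functional[of g] by (simp add: L2_space_def L2_norm_eq H10_L2)

lemma H1_functional:
  assumes "g \<in> H10 \<Omega>"
  shows "bounded_functional (H1_space \<Omega>) (\<lambda>f. L2_inner \<Omega> f g) (L2_norm \<Omega> g)"
proof
  have gL: "g \<in> L2 \<Omega>" by (rule H10_L2[OF assms])
  fix f assume "f \<in> elems (H1_space \<Omega>)"
  then have f: "f \<in> sobolev_H 1 \<Omega>" by (simp add: H1_space_def)
  have "\<bar>L2_inner \<Omega> f g\<bar> \<le> L2_norm \<Omega> f * L2_norm \<Omega> g"
    using L2.cauchy_schwarz[OF sobolev_1D(1)[OF f] gL] by (simp add: L2_norm_eq)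
  also have "\<dots> \<le> H1_norm \<Omega> f * L2_norm \<Omega> g"
    using L2.norm_nonneg[OF gL] by (intro mult_right_mono L2_norm_le_H1_norm f) (simp add: L2_norm_eq)
  finally show "\<bar>L2_inner \<Omega> f g\<bar> \<le> L2_norm \<Omega> g * nrm (H1_space \<Omega>) f" by (simp add: H1_space_def mult.commute)
qed (use assms in \<open>auto simp: H1_space_def L2_norm_eq intro: a.zero_in a.add_in a.scale_in L2.add_left L2.scale_left
      L2.norm_nonneg sobolev_1D(1) H10_L2\<close>)

lemma Hm1_functional:
  assumes "g \<in> H10 \<Omega>"
  shows "bounded_functional (Hm1_space \<Omega>) (\<lambda>F. F g) (H1_norm \<Omega> g)"
proof
  fix F assume "F \<in> elems (Hm1_space \<Omega>)"
  then show "\<bar>F g\<bar> \<le> H1_norm \<Omega> g * nrm (Hm1_space \<Omega>) F"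
    using Hm1_bound[OF _ assms] by (simp add: Hm1_space_def mult.commute)
qed (use assms H10_subset in \<open>auto simp: Hm1_space_def H1_norm_eq intro: Hm1_zero Hm1_add Hm1_scale h1.norm_nonneg\<close>)

lemma test_with_product:
  assumes "smooth \<phi>" "g \<in> H10 \<Omega>"
  shows "(\<lambda>t x. \<phi> t * g x) \<in> L2_Bochner T (H10_space \<Omega>)"
  using assms
  by (intro HV.L2_Bochner_mult continuous_time_measurable continuous_time_integrable continuous_intros smooth_continuous)
    (auto simp: H10_space_def)

lemma form_functional_integrable:
  assumes "y \<in> L2_Bochner T (H10_space \<Omega>)" "g \<in> H10 \<Omega>"
  shows "integrable (time_measure T) (\<lambda>t. form_a \<Omega> (y t) g)" "integrable (time_measure T) (\<lambda>t. L2_inner \<Omega> (y t) g)"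
  using bounded_functional.L2_Bochner_functional(2)[OF HV.fa.form_functional assms(1)]
    bounded_functional.L2_Bochner_functional(2)[OF HV.fb.form_functional assms(1)] assms(2)
  by (auto simp: H10_space_def)

lemma L2_functional_integrable:
  assumes "f \<in> L2_Bochner T (L2_space \<Omega>)" "g \<in> H10 \<Omega>"
  shows "integrable (time_measure T) (\<lambda>t. L2_inner \<Omega> (f t) g)"
  by (rule bounded_functional.L2_Bochner_functional(2)[OF L2_functional[OF assms(2)] assms(1)])

lemma form_a_test:
  assumes y: "y \<in> L2_Bochner T (H10_space \<Omega>)" and g: "g \<in> H10 \<Omega>"
  shows "AE t in time_measure T. form_a \<Omega> (y t) (\<lambda>x. \<phi> t * g x) = \<phi> t * form_a \<Omega> (y t) g"
proof -
  have "AE t in time_measure T. y t \<in> H10 \<Omega>"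
    using y by (simp add: L2_Bochner_def strongly_measurable_def H10_space_def)
  then show ?thesis by eventually_elim (use g H10_subset in \<open>auto intro: a.scale_right\<close>)
qed

text \<open>Testing the derivative \<open>w\<close> of \<open>v\<close> with \<open>\<phi>\<close>: the initial value enters when \<open>\<phi>\<close> does not
  vanish at 0.\<close>

lemma functional_initial:
  assumes \<Lambda>: "bounded_functional X \<Lambda> K" and T: "0 < T" and vw: "is_time_deriv T X v w"
    and v0: "has_initial_value T X v v0" "v0 \<in> elems X"
    and \<phi>: "smooth \<phi>" "\<And>t. t > c \<Longrightarrow> \<phi> t = 0" "c < T"
  shows "(\<integral>t. deriv \<phi> t * \<Lambda> (v t) \<partial>time_measure T) = - (\<integral>t. \<phi> t * \<Lambda> (w t) \<partial>time_measure T) - \<Lambda> v0 * \<phi> 0"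
proof -
  interpret bounded_functional X \<Lambda> K by fact
  have L: "v \<in> L2_Bochner T X" "w \<in> L2_Bochner T X" using vw by (auto simp: is_time_deriv_def)
  then have "AE t in time_measure T. v t \<in> elems X" by (simp add: L2_Bochner_def strongly_measurable_def)
  from initial_value_functional[OF v0(1) this v0(2) T] obtain p where
    p: "AE t in time_measure T. \<Lambda> (v t) = p t" "(p \<longlongrightarrow> \<Lambda> v0) (at_right 0)" by blast
  show ?thesis
    by (rule weak_deriv_initial[OF T L2_Bochner_functional(2)[OF L(1)] L2_Bochner_functional(2)[OF L(2)]
          time_deriv_functional(3)[OF vw] p \<phi>])
qed

lemma heat_tested:
  assumes T: "0 < T" and heat: "heat_weak_solution \<Omega> T u y0 y" and u: "u \<in> L2_Bochner T (L2_space \<Omega>)"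
    and y0: "y0 \<in> H10 \<Omega>" and g: "g \<in> H10 \<Omega>"
    and \<phi>: "smooth \<phi>" "\<And>t. t > c \<Longrightarrow> \<phi> t = 0" "c < T"
  shows "(\<integral>t. \<phi> t * L2_inner \<Omega> (u t) g \<partial>time_measure T)
    = - (\<integral>t. deriv \<phi> t * L2_inner \<Omega> (y t) g \<partial>time_measure T) - L2_inner \<Omega> y0 g * \<phi> 0
      + (\<integral>t. \<phi> t * form_a \<Omega> (y t) g \<partial>time_measure T)"
proof -
  obtain dy where dy: "is_time_deriv T (L2_space \<Omega>) y dy" "has_initial_value T (L2_space \<Omega>) y y0"
    and y: "y \<in> L2_Bochner T (H10_space \<Omega>)"
    and eq: "\<And>v. v \<in> L2_Bochner T (H10_space \<Omega>) \<Longrightarrow>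
       (\<integral>t. L2_inner \<Omega> (dy t) (v t) + form_a \<Omega> (y t) (v t) \<partial>time_measure T) = (\<integral>t. L2_inner \<Omega> (u t) (v t) \<partial>time_measure T)"
    using heat unfolding heat_weak_solution_def by blast
  have c: "continuous_on UNIV \<phi>" by (rule smooth_continuous[OF \<phi>(1)])
  have dyL: "dy \<in> L2_Bochner T (L2_space \<Omega>)" using dy by (simp add: is_time_deriv_def)
  note i = continuous_mult_integrable[OF c L2_functional_integrable[OF dyL g]]
    continuous_mult_integrable[OF c form_functional_integrable(1)[OF y g]]
  have "(\<integral>t. \<phi> t * L2_inner \<Omega> (u t) g \<partial>time_measure T)
      = (\<integral>t. L2_inner \<Omega> (dy t) (\<lambda>x. \<phi> t * g x) + form_a \<Omega> (y t) (\<lambda>x. \<phi> t * g x) \<partial>time_measure T)"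
    using eq[OF test_with_product[OF \<phi>(1) g]] by (simp add: L2_inner_scale_right)
  also have "\<dots> = (\<integral>t. \<phi> t * L2_inner \<Omega> (dy t) g + \<phi> t * form_a \<Omega> (y t) g \<partial>time_measure T)"
  proof (rule time_integral_cong_AE)
    show "(\<lambda>t. \<phi> t * L2_inner \<Omega> (dy t) g + \<phi> t * form_a \<Omega> (y t) g) \<in> borel_measurable (time_measure T)"
      using i by (intro borel_measurable_add borel_measurable_integrable)
    show "AE t in time_measure T. L2_inner \<Omega> (dy t) (\<lambda>x. \<phi> t * g x) + form_a \<Omega> (y t) (\<lambda>x. \<phi> t * g x)
        = \<phi> t * L2_inner \<Omega> (dy t) g + \<phi> t * form_a \<Omega> (y t) g"
      using form_a_test[OF y g, of \<phi>] by eventually_elim (simp add: L2_inner_scale_right)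
  qed
  also have "\<dots> = (\<integral>t. \<phi> t * L2_inner \<Omega> (dy t) g \<partial>time_measure T) + (\<integral>t. \<phi> t * form_a \<Omega> (y t) g \<partial>time_measure T)"
    by (rule Bochner_Integration.integral_add[OF i])
  finally show ?thesis
    using functional_initial[OF L2_functional[OF g] T dy _ \<phi>] H10_L2[OF y0] by (simp add: L2_space_def)
qed

text \<open>Both time derivatives are moved to \<open>\<phi>\<close>. The initial value of the first derivative is attained
  in \<open>H\<^sup>-\<^sup>1\<close>, where evaluation at \<open>g\<close> is a bounded functional.\<close>

lemma cattaneo_tested:
  assumes T: "0 < T" and sol: "cattaneo_weak_solution \<Omega> T \<tau> u y0 y1 y" and u: "u \<in> L2_Bochner T (L2_space \<Omega>)"
    and y0: "y0 \<in> H10 \<Omega>" and y1: "y1 \<in> H10 \<Omega>" and g: "g \<in> H10 \<Omega>"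
    and \<phi>: "smooth \<phi>" "\<And>t. t > c \<Longrightarrow> \<phi> t = 0" "c < T"
  shows "(\<integral>t. \<phi> t * L2_inner \<Omega> (u t) g \<partial>time_measure T)
    = \<tau> * ((\<integral>t. deriv (deriv \<phi>) t * L2_inner \<Omega> (y t) g \<partial>time_measure T)
        + L2_inner \<Omega> y0 g * deriv \<phi> 0 - L2_inner \<Omega> y1 g * \<phi> 0)
      - (\<integral>t. deriv \<phi> t * L2_inner \<Omega> (y t) g \<partial>time_measure T) - L2_inner \<Omega> y0 g * \<phi> 0
      + (\<integral>t. \<phi> t * form_a \<Omega> (y t) g \<partial>time_measure T)"
proof -
  obtain dy ddy where dy: "is_time_deriv T (L2_space \<Omega>) y dy" "has_initial_value T (L2_space \<Omega>) y y0"
    and ddy: "is_time_deriv T (Hm1_space \<Omega>) (\<lambda>t. L2_inner \<Omega> (dy t)) ddy"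
      "has_initial_value T (Hm1_space \<Omega>) (\<lambda>t. L2_inner \<Omega> (dy t)) (L2_inner \<Omega> y1)"
    and y: "y \<in> L2_Bochner T (H10_space \<Omega>)"
    and eq: "\<And>v. v \<in> L2_Bochner T (H10_space \<Omega>) \<Longrightarrow>
       (\<integral>t. \<tau> * ddy t (v t) + L2_inner \<Omega> (dy t) (v t) + form_a \<Omega> (y t) (v t) \<partial>time_measure T)
       = (\<integral>t. L2_inner \<Omega> (u t) (v t) \<partial>time_measure T)"
    using sol unfolding cattaneo_weak_solution_def by blast
  have c: "continuous_on UNIV \<phi>" by (rule smooth_continuous[OF \<phi>(1)])
  have dyL: "dy \<in> L2_Bochner T (L2_space \<Omega>)" and ddyL: "ddy \<in> L2_Bochner T (Hm1_space \<Omega>)"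
    using dy ddy by (auto simp: is_time_deriv_def)
  have ddy_in: "AE t in time_measure T. ddy t \<in> Hm1 \<Omega>"
    using ddyL by (simp add: L2_Bochner_def strongly_measurable_def Hm1_space_def)
  note i = continuous_mult_integrable[OF c bounded_functional.L2_Bochner_functional(2)[OF Hm1_functional[OF g] ddyL]]
    continuous_mult_integrable[OF c L2_functional_integrable[OF dyL g]]
    continuous_mult_integrable[OF c form_functional_integrable(1)[OF y g]]
  have "(\<integral>t. \<phi> t * L2_inner \<Omega> (u t) g \<partial>time_measure T)
      = (\<integral>t. \<tau> * ddy t (\<lambda>x. \<phi> t * g x) + L2_inner \<Omega> (dy t) (\<lambda>x. \<phi> t * g x) + form_a \<Omega> (y t) (\<lambda>x. \<phi> t * g x) \<partial>time_measure T)"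
    using eq[OF test_with_product[OF \<phi>(1) g]] by (simp add: L2_inner_scale_right)
  also have "\<dots> = (\<integral>t. \<tau> * (\<phi> t * ddy t g) + \<phi> t * L2_inner \<Omega> (dy t) g + \<phi> t * form_a \<Omega> (y t) g \<partial>time_measure T)"
  proof (rule time_integral_cong_AE)
    show "(\<lambda>t. \<tau> * (\<phi> t * ddy t g) + \<phi> t * L2_inner \<Omega> (dy t) g + \<phi> t * form_a \<Omega> (y t) g) \<in> borel_measurable (time_measure T)"
      using i by (intro borel_measurable_add borel_measurable_integrable integrable_mult_right)
    show "AE t in time_measure T. \<tau> * ddy t (\<lambda>x. \<phi> t * g x) + L2_inner \<Omega> (dy t) (\<lambda>x. \<phi> t * g x) + form_a \<Omega> (y t) (\<lambda>x. \<phi> t * g x)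
        = \<tau> * (\<phi> t * ddy t g) + \<phi> t * L2_inner \<Omega> (dy t) g + \<phi> t * form_a \<Omega> (y t) g"
      using form_a_test[OF y g, of \<phi>] ddy_in
    proof eventually_elim
      case (elim t)
      have "ddy t (\<lambda>x. \<phi> t * g x) = \<phi> t * ddy t g" using elim(2) g unfolding Hm1_def by blast
      then show ?case using elim(1) by (simp add: L2_inner_scale_right)
    qed
  qed
  also have "\<dots> = \<tau> * (\<integral>t. \<phi> t * ddy t g \<partial>time_measure T) + (\<integral>t. \<phi> t * L2_inner \<Omega> (dy t) g \<partial>time_measure T)
      + (\<integral>t. \<phi> t * form_a \<Omega> (y t) g \<partial>time_measure T)"
    using i by simp
  finally have main: "(\<integral>t. \<phi> t * L2_inner \<Omega> (u t) g \<partial>time_measure T) = \<dots>" .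
  have y0L: "y0 \<in> elems (L2_space \<Omega>)" using H10_L2[OF y0] by (simp add: L2_space_def)
  have y1m: "L2_inner \<Omega> y1 \<in> elems (Hm1_space \<Omega>)" using L2_inner_Hm1[OF H10_L2[OF y1]] by (simp add: Hm1_space_def)
  have d0: "deriv \<phi> t = 0" if "t > c" for t using deriv_vanishes[OF \<phi>(2) that] .
  have "(\<integral>t. deriv \<phi> t * L2_inner \<Omega> (dy t) g \<partial>time_measure T) = - (\<integral>t. \<phi> t * ddy t g \<partial>time_measure T) - L2_inner \<Omega> y1 g * \<phi> 0"
    by (rule functional_initial[OF Hm1_functional[OF g] T ddy y1m \<phi>])
  moreover have "(\<integral>t. deriv (deriv \<phi>) t * L2_inner \<Omega> (y t) g \<partial>time_measure T)
      = - (\<integral>t. deriv \<phi> t * L2_inner \<Omega> (dy t) g \<partial>time_measure T) - L2_inner \<Omega> y0 g * deriv \<phi> 0"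
    by (rule functional_initial[OF L2_functional[OF g] T dy y0L smooth_deriv(2)[OF \<phi>(1)] d0 \<phi>(3)])
  ultimately have "(\<integral>t. \<phi> t * ddy t g \<partial>time_measure T) = (\<integral>t. deriv (deriv \<phi>) t * L2_inner \<Omega> (y t) g \<partial>time_measure T)
        + L2_inner \<Omega> y0 g * deriv \<phi> 0 - L2_inner \<Omega> y1 g * \<phi> 0" by linarith
  moreover have "(\<integral>t. \<phi> t * L2_inner \<Omega> (dy t) g \<partial>time_measure T)
      = - (\<integral>t. deriv \<phi> t * L2_inner \<Omega> (y t) g \<partial>time_measure T) - L2_inner \<Omega> y0 g * \<phi> 0"
    using functional_initial[OF L2_functional[OF g] T dy y0L \<phi>] by simp
  ultimately show ?thesis using main by simp
qed

text \<open>Subtracting \<open>y0 + t y1\<close> makes the initial values homogeneous. By the compatibility condition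
  \<open>y1 = \<Delta> y0 + ubar\<close>, the source \<open>u - ubar - t A y1\<close> that remains in the heat equation vanishes at
  time 0, so that its derivative has no singular part there.\<close>

lemma evolution_pair_solutions:
  assumes T: "0 < T" and \<tau>: "0 < \<tau>"
    and y0: "y0 \<in> sobolev_H 3 \<Omega> \<inter> H10 \<Omega>" and ubar: "ubar \<in> sobolev_H 1 \<Omega>"
    and y1: "y1 = (\<lambda>x. weak_laplacian \<Omega> y0 x + ubar x)" "y1 \<in> H10 \<Omega>"
    and u: "is_time_deriv T (H1_space \<Omega>) u u'" "has_initial_value T (H1_space \<Omega>) u ubar"
    and u\<tau>: "u\<tau> \<in> L2_Bochner T (H1_space \<Omega>)"
    and y\<tau>: "cattaneo_weak_solution \<Omega> T \<tau> u\<tau> y0 y1 y\<tau>"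
    and y: "heat_weak_solution \<Omega> T u y0 y"
  shows "evolution_pair (H10_space \<Omega>) (form_a \<Omega>) (L2_inner \<Omega>) T \<tau>
    (\<lambda>t x. y\<tau> t x - y t x) (\<lambda>t x. y t x - (y0 x + t * y1 x)) y1
    (\<lambda>t. L2_inner \<Omega> (\<lambda>x. u\<tau> t x - u t x)) (\<lambda>t. L2_inner \<Omega> (u' t))
    (\<lambda>t. L2_norm \<Omega> (\<lambda>x. u\<tau> t x - u t x)) (\<lambda>t. L2_norm \<Omega> (u' t))"
proof -
  let ?b = "L2_inner \<Omega>" and ?a = "form_a \<Omega>" and ?I = "\<lambda>f. integral\<^sup>L (time_measure T) f"
  let ?\<zeta> = "\<lambda>t x. y\<tau> t x - y t x" and ?\<gamma> = "\<lambda>t x. y t x - (y0 x + t * y1 x)" and ?d = "\<lambda>t x. u\<tau> t x - u t x"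
  have y0V: "y0 \<in> H10 \<Omega>" and y0H: "y0 \<in> sobolev_H 3 \<Omega>" using y0 by auto
  have u_H: "u \<in> L2_Bochner T (H1_space \<Omega>)" "u' \<in> L2_Bochner T (H1_space \<Omega>)" using u(1) by (auto simp: is_time_deriv_def)
  note uL = H1_space_L2_Bochner(1)[OF u_H(1)] and u'L = H1_space_L2_Bochner(1)[OF u_H(2)] and u\<tau>L = H1_space_L2_Bochner(1)[OF u\<tau>]
  have dL: "?d \<in> L2_Bochner T (L2_space \<Omega>)" by (rule HL.L2_Bochner_diff[OF u\<tau>L uL])
  have yV: "y \<in> L2_Bochner T (H10_space \<Omega>)" "y\<tau> \<in> L2_Bochner T (H10_space \<Omega>)"
    using y y\<tau> by (auto simp: heat_weak_solution_def cattaneo_weak_solution_def)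
  have \<zeta>V: "?\<zeta> \<in> L2_Bochner T (H10_space \<Omega>)" by (rule HV.L2_Bochner_diff[OF yV(2,1)])
  have \<gamma>V: "?\<gamma> \<in> L2_Bochner T (H10_space \<Omega>)"
  proof -
    have c: "(\<lambda>t x. \<phi> t * g x) \<in> L2_Bochner T (H10_space \<Omega>)" if "continuous_on UNIV \<phi>" "g \<in> H10 \<Omega>" for \<phi> g
      using that by (intro HV.L2_Bochner_mult continuous_time_measurable continuous_time_integrable continuous_intros)
        (auto simp: H10_space_def)
    have "(\<lambda>t x. (y t x - 1 * y0 x) - t * y1 x) \<in> L2_Bochner T (H10_space \<Omega>)"
      by (intro HV.L2_Bochner_diff yV(1) c y0V y1(2) continuous_intros)
    then show ?thesis by (simp add: diff_diff_eq)
  qed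
  have AE_y: "AE t in time_measure T. y t \<in> H10 \<Omega>" "AE t in time_measure T. y\<tau> t \<in> H10 \<Omega>"
    using yV by (auto simp: L2_Bochner_def strongly_measurable_def H10_space_def)
  have AE_u: "AE t in time_measure T. u t \<in> L2 \<Omega>" "AE t in time_measure T. u\<tau> t \<in> L2 \<Omega>" "AE t in time_measure T. u' t \<in> L2 \<Omega>"
    using uL u\<tau>L u'L by (auto simp: L2_Bochner_def strongly_measurable_def L2_space_def)
  have compat: "?b y1 g + ?a y0 g = ?b ubar g" if g: "g \<in> H10 \<Omega>" for g
  proof -
    have s3: "y0 \<in> sobolev_H (Suc (Suc 1)) \<Omega>" using y0H by (simp add: numeral_3_eq_3 One_nat_def)
    show ?thesis
      using form_a_laplacian[OF s3 g] L2.add_left[OF form_a_laplacian(1)[OF s3 g] sobolev_1D(1)[OF ubar] H10_L2[OF g]]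
      by (simp add: y1(1))
  qed
  have \<zeta>_int: "?I (\<lambda>t. k t * ?b (?\<zeta> t) g) = ?I (\<lambda>t. k t * ?b (y\<tau> t) g) - ?I (\<lambda>t. k t * ?b (y t) g)"
    "?I (\<lambda>t. k t * ?a (?\<zeta> t) g) = ?I (\<lambda>t. k t * ?a (y\<tau> t) g) - ?I (\<lambda>t. k t * ?a (y t) g)"
    if k: "continuous_on UNIV k" and g: "g \<in> H10 \<Omega>" for k g
  proof -
    note i = continuous_mult_integrable[OF k form_functional_integrable(2)[OF yV(1) g]] continuous_mult_integrable[OF k form_functional_integrable(2)[OF yV(2) g]]
      continuous_mult_integrable[OF k form_functional_integrable(1)[OF yV(1) g]] continuous_mult_integrable[OF k form_functional_integrable(1)[OF yV(2) g]]
    have "?I (\<lambda>t. k t * ?b (?\<zeta> t) g) = ?I (\<lambda>t. k t * ?b (y\<tau> t) g - k t * ?b (y t) g)"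
    proof (rule time_integral_cong_AE)
      show "AE t in time_measure T. k t * ?b (?\<zeta> t) g = k t * ?b (y\<tau> t) g - k t * ?b (y t) g"
        using AE_y by eventually_elim (use g in \<open>simp add: L2.diff_left H10_L2 right_diff_distrib\<close>)
    qed (use i in auto)
    then show "?I (\<lambda>t. k t * ?b (?\<zeta> t) g) = ?I (\<lambda>t. k t * ?b (y\<tau> t) g) - ?I (\<lambda>t. k t * ?b (y t) g)"
      using i by simp
    have "?I (\<lambda>t. k t * ?a (?\<zeta> t) g) = ?I (\<lambda>t. k t * ?a (y\<tau> t) g - k t * ?a (y t) g)"
    proof (rule time_integral_cong_AE)
      show "AE t in time_measure T. k t * ?a (?\<zeta> t) g = k t * ?a (y\<tau> t) g - k t * ?a (y t) g"
        using AE_y by eventually_elim (use g H10_subset in \<open>simp add: a.diff_left subset_iff right_diff_distrib\<close>)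
    qed (use i in auto)
    then show "?I (\<lambda>t. k t * ?a (?\<zeta> t) g) = ?I (\<lambda>t. k t * ?a (y\<tau> t) g) - ?I (\<lambda>t. k t * ?a (y t) g)"
      using i by simp
  qed
  have \<gamma>_int: "?I (\<lambda>t. k t * ?b (?\<gamma> t) g) = ?I (\<lambda>t. k t * ?b (y t) g) - ?b y0 g * ?I k - ?b y1 g * ?I (\<lambda>t. k t * t)"
    "?I (\<lambda>t. k t * ?a (?\<gamma> t) g) = ?I (\<lambda>t. k t * ?a (y t) g) - ?a y0 g * ?I k - ?a y1 g * ?I (\<lambda>t. k t * t)"
    if k: "continuous_on UNIV k" and g: "g \<in> H10 \<Omega>" for k g
  proof -
    note i = continuous_mult_integrable[OF k form_functional_integrable(2)[OF yV(1) g]]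
      continuous_mult_integrable[OF k form_functional_integrable(1)[OF yV(1) g]]
    have ik: "integrable (time_measure T) k" "integrable (time_measure T) (\<lambda>t. k t * t)"
      by (intro continuous_time_integrable continuous_intros k)+
    have "?I (\<lambda>t. k t * ?b (?\<gamma> t) g) = ?I (\<lambda>t. k t * ?b (y t) g - ?b y0 g * k t - ?b y1 g * (k t * t))"
    proof (rule time_integral_cong_AE)
      show "AE t in time_measure T. k t * ?b (?\<gamma> t) g = k t * ?b (y t) g - ?b y0 g * k t - ?b y1 g * (k t * t)"
        using AE_y(1)
      proof eventually_elim
        case (elim t)
        have eq: "?b (?\<gamma> t) g = ?b (y t) g - (?b y0 g + t * ?b y1 g)"
          using H10_L2[OF elim] H10_L2[OF y0V] H10_L2[OF y1(2)] H10_L2[OF g]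
          by (simp add: L2.diff_left L2.add_left L2.scale_left L2.add_in L2.scale_in)
        show ?case unfolding eq by (simp add: algebra_simps)
      qed
    qed (use i ik in auto)
    then show "?I (\<lambda>t. k t * ?b (?\<gamma> t) g) = ?I (\<lambda>t. k t * ?b (y t) g) - ?b y0 g * ?I k - ?b y1 g * ?I (\<lambda>t. k t * t)"
      using i ik by simp
    have "?I (\<lambda>t. k t * ?a (?\<gamma> t) g) = ?I (\<lambda>t. k t * ?a (y t) g - ?a y0 g * k t - ?a y1 g * (k t * t))"
    proof (rule time_integral_cong_AE)
      show "AE t in time_measure T. k t * ?a (?\<gamma> t) g = k t * ?a (y t) g - ?a y0 g * k t - ?a y1 g * (k t * t)"
        using AE_y(1)
      proof eventually_elim
        case (elim t)
        have eq: "?a (?\<gamma> t) g = ?a (y t) g - (?a y0 g + t * ?a y1 g)"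
          using subsetD[OF H10_subset elim] subsetD[OF H10_subset y0V] subsetD[OF H10_subset y1(2)] subsetD[OF H10_subset g]
          by (simp add: a.diff_left a.add_left a.scale_left a.add_in a.scale_in)
        show ?case unfolding eq by (simp add: algebra_simps)
      qed
    qed (use i ik in auto)
    then show "?I (\<lambda>t. k t * ?a (?\<gamma> t) g) = ?I (\<lambda>t. k t * ?a (y t) g) - ?a y0 g * ?I k - ?a y1 g * ?I (\<lambda>t. k t * t)"
      using i ik by simp
  qed
  show ?thesis
  proof (intro evolution_pair.intro HV.energy_space_axioms evolution_pair_axioms.intro T \<tau> \<zeta>V \<gamma>V)
    show "y1 \<in> elems (H10_space \<Omega>)" using y1(2) by (simp add: H10_space_def)
    show "integrable (time_measure T) (\<lambda>t. L2_norm \<Omega> (?d t))" "integrable (time_measure T) (\<lambda>t. (L2_norm \<Omega> (?d t))\<^sup>2)"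
      "integrable (time_measure T) (\<lambda>t. L2_norm \<Omega> (u' t))" "integrable (time_measure T) (\<lambda>t. (L2_norm \<Omega> (u' t))\<^sup>2)"
      using HL.L2_Bochner_nrm[OF dL] dL HL.L2_Bochner_nrm[OF u'L] u'L by (auto simp: L2_space_def L2_Bochner_def)
  next
    fix g assume "g \<in> elems (H10_space \<Omega>)"
    then have g: "g \<in> H10 \<Omega>" by (simp add: H10_space_def)
    show "integrable (time_measure T) (\<lambda>t. ?b (?d t) g)" "integrable (time_measure T) (\<lambda>t. ?b (u' t) g)"
      by (intro L2_functional_integrable dL u'L g)+
    show "AE t in time_measure T. \<bar>?b (?d t) g\<bar> \<le> L2_norm \<Omega> (?d t) * form_norm ?b g"
      using AE_u(1,2) unfolding L2_norm_eq by eventually_elim (intro L2.cauchy_schwarz L2.diff_in H10_L2[OF g])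
    show "AE t in time_measure T. \<bar>?b (u' t) g\<bar> \<le> L2_norm \<Omega> (u' t) * form_norm ?b g"
      using AE_u(3) unfolding L2_norm_eq by eventually_elim (intro L2.cauchy_schwarz H10_L2[OF g])
    fix \<phi> :: "real \<Rightarrow> real" and c
    assume \<phi>: "smooth \<phi>" "c < T" "\<And>t. t > c \<Longrightarrow> \<phi> t = 0"
    have s: "smooth (deriv \<phi>)" "smooth (deriv (deriv \<phi>))" by (intro smooth_deriv \<phi>)+
    note k = smooth_continuous[OF \<phi>(1)] smooth_continuous[OF s(1)] smooth_continuous[OF s(2)]
    have d0: "deriv \<phi> t = 0" if "t > c" for t using deriv_vanishes[OF \<phi>(3) that] .
    have J: "?I (deriv \<phi>) = - \<phi> 0" "?I (\<lambda>t. deriv \<phi> t * t) = - ?I \<phi>"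
      "?I (deriv (deriv \<phi>)) = - deriv \<phi> 0" "?I (\<lambda>t. deriv (deriv \<phi>) t * t) = - ?I (deriv \<phi>)"
      by (rule smooth_time_integrals[OF \<phi>(1,3,2) T] smooth_time_integrals[OF s(1) d0 \<phi>(2) T]; assumption)+
    have ubarH: "ubar \<in> elems (H1_space \<Omega>)" using ubar by (simp add: H1_space_def)
    have H1: "?I (\<lambda>t. deriv \<phi> t * ?b (u t) g) = - ?I (\<lambda>t. deriv (deriv \<phi>) t * ?b (y t) g) - ?b y0 g * deriv \<phi> 0
        + ?I (\<lambda>t. deriv \<phi> t * ?a (y t) g)"
      by (rule heat_tested[OF T y uL y0V g s(1) d0 \<phi>(2)])
    have H0: "?I (\<lambda>t. \<phi> t * ?b (u t) g) = - ?I (\<lambda>t. deriv \<phi> t * ?b (y t) g) - ?b y0 g * \<phi> 0 + ?I (\<lambda>t. \<phi> t * ?a (y t) g)"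
      by (rule heat_tested[OF T y uL y0V g \<phi>(1,3,2)])
    have U: "?I (\<lambda>t. deriv \<phi> t * ?b (u t) g) = - ?I (\<lambda>t. \<phi> t * ?b (u' t) g) - ?b ubar g * \<phi> 0"
      by (rule functional_initial[OF H1_functional[OF g] T u(1,2) ubarH \<phi>(1,3,2)])
    have W: "?I (\<lambda>t. \<phi> t * ?b (u\<tau> t) g) = \<tau> * (?I (\<lambda>t. deriv (deriv \<phi>) t * ?b (y\<tau> t) g) + ?b y0 g * deriv \<phi> 0 - ?b y1 g * \<phi> 0)
        - ?I (\<lambda>t. deriv \<phi> t * ?b (y\<tau> t) g) - ?b y0 g * \<phi> 0 + ?I (\<lambda>t. \<phi> t * ?a (y\<tau> t) g)"
      by (rule cattaneo_tested[OF T y\<tau> u\<tau>L y0V y1(2) g \<phi>(1,3,2)])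
    have D: "?I (\<lambda>t. \<phi> t * ?b (?d t) g) = ?I (\<lambda>t. \<phi> t * ?b (u\<tau> t) g) - ?I (\<lambda>t. \<phi> t * ?b (u t) g)"
    proof -
      note i = continuous_mult_integrable[OF k(1) L2_functional_integrable[OF u\<tau>L g]] continuous_mult_integrable[OF k(1) L2_functional_integrable[OF uL g]]
      have "?I (\<lambda>t. \<phi> t * ?b (?d t) g) = ?I (\<lambda>t. \<phi> t * ?b (u\<tau> t) g - \<phi> t * ?b (u t) g)"
      proof (rule time_integral_cong_AE)
        show "AE t in time_measure T. \<phi> t * ?b (?d t) g = \<phi> t * ?b (u\<tau> t) g - \<phi> t * ?b (u t) g"
          using AE_u(1,2) by eventually_elim (use g in \<open>simp add: L2.diff_left H10_L2 right_diff_distrib\<close>)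
      qed (use i in auto)
      then show ?thesis using i by simp
    qed
    have a0: "?a y0 g = ?b ubar g - ?b y1 g" using compat[OF g] by simp
    show "?I (\<lambda>t. deriv (deriv \<phi>) t * ?b (?\<gamma> t) g) - ?I (\<lambda>t. deriv \<phi> t * ?a (?\<gamma> t) g)
        = ?I (\<lambda>t. \<phi> t * ?b (u' t) g) - ?a y1 g * ?I \<phi>"
      unfolding \<gamma>_int[OF k(3) g] \<gamma>_int[OF k(2) g] J a0 using H1 U by (simp add: algebra_simps)
    show "\<tau> * ?I (\<lambda>t. deriv (deriv \<phi>) t * ?b (?\<zeta> t) g) - ?I (\<lambda>t. deriv \<phi> t * ?b (?\<zeta> t) g) + ?I (\<lambda>t. \<phi> t * ?a (?\<zeta> t) g)
        = ?I (\<lambda>t. \<phi> t * ?b (?d t) g) - \<tau> * ?I (\<lambda>t. deriv (deriv \<phi>) t * ?b (?\<gamma> t) g)"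
      unfolding \<gamma>_int[OF k(3) g] J \<zeta>_int[OF k(3) g] \<zeta>_int[OF k(2) g] \<zeta>_int[OF k(1) g] D W H0
      by (simp add: algebra_simps)
  qed
qed

end

context bounded_open
begin

text \<open>The square root of the energy bound, integrated over time. The constants are those of the heat
  equation and of \<open>T\<close>, and independent of \<open>\<tau>\<close>.\<close>

lemma state_error_estimate:
  assumes T: "0 < T"
    and y0: "y0 \<in> sobolev_H 3 \<Omega> \<inter> H10 \<Omega>" and ubar: "ubar \<in> sobolev_H 1 \<Omega>"
    and y1: "y1 = (\<lambda>x. weak_laplacian \<Omega> y0 x + ubar x)" "y1 \<in> H10 \<Omega>"
    and u: "u \<in> U_hat \<Omega> T M ubar" and y: "heat_weak_solution \<Omega> T u y0 y"
  obtains A B where "A \<ge> 0" "B \<ge> 0"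
    "\<And>\<tau> u\<tau> y\<tau>. 0 < \<tau> \<Longrightarrow> u\<tau> \<in> L2_Bochner T (H1_space \<Omega>) \<Longrightarrow> cattaneo_weak_solution \<Omega> T \<tau> u\<tau> y0 y1 y\<tau> \<Longrightarrow>
      L2_Bochner_norm T (H10_space \<Omega>) (\<lambda>t x. y\<tau> t x - y t x)
      \<le> A * L2_Bochner_norm T (L2_space \<Omega>) (\<lambda>t x. u\<tau> t x - u t x) + B * \<tau>"
proof -
  obtain u' where u': "is_time_deriv T (H1_space \<Omega>) u u'" "has_initial_value T (H1_space \<Omega>) u ubar"
    using u by (auto simp: U_hat_def H1_Bochner_def)
  define q where "q = exp 1 * ((\<integral>t. (L2_norm \<Omega> (u' t))\<^sup>2 \<partial>time_measure T) + form_a \<Omega> y1 y1)"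
  have q: "q \<ge> 0" unfolding q_def
    using subsetD[OF H10_subset y1(2)]
    by (intro mult_nonneg_nonneg add_nonneg_nonneg integral_nonneg_AE AE_I2 a.nonneg) auto
  define A where "A = sqrt (T * exp T * 2)"
  define B where "B = A * sqrt q"
  show ?thesis
  proof (rule that[of A B])
    show "A \<ge> 0" "B \<ge> 0" using T q by (simp_all add: A_def B_def)
    fix \<tau> u\<tau> y\<tau>
    assume \<tau>: "0 < \<tau>" and u\<tau>: "u\<tau> \<in> L2_Bochner T (H1_space \<Omega>)" and y\<tau>: "cattaneo_weak_solution \<Omega> T \<tau> u\<tau> y0 y1 y\<tau>"
    let ?d = "\<lambda>t x. u\<tau> t x - u t x" and ?\<zeta> = "\<lambda>t x. y\<tau> t x - y t x"
    let ?N = "L2_Bochner_norm T (L2_space \<Omega>) ?d"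
    interpret evolution_pair "H10_space \<Omega>" "form_a \<Omega>" "L2_inner \<Omega>" T \<tau> ?\<zeta> "\<lambda>t x. y t x - (y0 x + t * y1 x)" y1
      "\<lambda>t. L2_inner \<Omega> (?d t)" "\<lambda>t. L2_inner \<Omega> (u' t)" "\<lambda>t. L2_norm \<Omega> (?d t)" "\<lambda>t. L2_norm \<Omega> (u' t)"
      by (rule evolution_pair_solutions[OF T \<tau> y0 ubar y1 u' u\<tau> y\<tau> y])
    have N2: "?N\<^sup>2 = (\<integral>t. (L2_norm \<Omega> (?d t))\<^sup>2 \<partial>time_measure T)"
      unfolding L2_Bochner_norm_def L2_space_def by (simp add: integral_nonneg_AE)
    have N0: "?N \<ge> 0" unfolding L2_Bochner_norm_def by (intro real_sqrt_ge_zero integral_nonneg_AE) auto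
    have "L2_Bochner_norm T (H10_space \<Omega>) ?\<zeta> \<le> sqrt (\<integral>t. state_bound \<partial>time_measure T)"
      unfolding L2_Bochner_norm_def
      using \<zeta> by (intro real_sqrt_le_mono integral_mono_AE state_le_bound integrable_time_const) (simp add: L2_Bochner_def)
    also have "(\<integral>t. state_bound \<partial>time_measure T) = T * state_bound" using T by (intro time_integral_const) simp
    also have "\<dots> = (T * exp T * 2) * (?N\<^sup>2 + \<tau>\<^sup>2 * q)"
      unfolding state_bound_def N2 q_def by (simp add: algebra_simps)
    also have "sqrt \<dots> = A * sqrt (?N\<^sup>2 + \<tau>\<^sup>2 * q)" unfolding A_def by (rule real_sqrt_mult)
    also have "\<dots> \<le> A * (?N + \<tau> * sqrt q)"
    proof (intro mult_left_mono real_le_lsqrt)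
      show "0 \<le> ?N + \<tau> * sqrt q" using N0 \<tau> q by simp
      have "?N\<^sup>2 + \<tau>\<^sup>2 * q \<le> ?N\<^sup>2 + (\<tau> * sqrt q)\<^sup>2 + 2 * ?N * (\<tau> * sqrt q)"
        using N0 \<tau> q by (simp add: power_mult_distrib)
      then show "?N\<^sup>2 + \<tau>\<^sup>2 * q \<le> (?N + \<tau> * sqrt q)\<^sup>2" by (simp add: power2_sum)
      show "0 \<le> A" using T by (simp add: A_def)
    qed
    also have "\<dots> = A * ?N + B * \<tau>" by (simp add: B_def algebra_simps)
    finally show "L2_Bochner_norm T (H10_space \<Omega>) ?\<zeta> \<le> A * ?N + B * \<tau>" .
  qed
qed

end

theorem corollary3p6:
  fixes \<Omega> :: "'a::euclidean_space set" and T M :: real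
    and y0 y1 ubar :: "'a \<Rightarrow> real"
    and u y :: "real \<Rightarrow> 'a \<Rightarrow> real"
    and u\<^sub>\<tau> y\<^sub>\<tau> :: "real \<Rightarrow> real \<Rightarrow> 'a \<Rightarrow> real"
  assumes "bounded_lipschitz_domain \<Omega>" and "0 < T" and "0 < M"
    and "y0 \<in> sobolev_H 3 \<Omega> \<inter> H10 \<Omega>"
    and "ubar \<in> sobolev_H 1 \<Omega>"
    and "y1 = (\<lambda>x. weak_laplacian \<Omega> y0 x + ubar x)" and "y1 \<in> H10 \<Omega>"
    and "u \<in> U_hat \<Omega> T M ubar"
    and "\<And>\<tau>. \<tau> > 0 \<Longrightarrow> u\<^sub>\<tau> \<tau> \<in> U_hat \<Omega> T M ubar"
    and "\<And>\<tau>. \<tau> > 0 \<Longrightarrow> cattaneo_weak_solution \<Omega> T \<tau> (u\<^sub>\<tau> \<tau>) y0 y1 (y\<^sub>\<tau> \<tau>)"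
    and "heat_weak_solution \<Omega> T u y0 y"
    and "((\<lambda>\<tau>. H1_Bochner_norm T (H1_space \<Omega>) (\<lambda>t x. u\<^sub>\<tau> \<tau> t x - u t x)) \<longlongrightarrow> 0) (at_right 0)"
  shows "((\<lambda>\<tau>. L2_Bochner_norm T (H10_space \<Omega>) (\<lambda>t x. y\<^sub>\<tau> \<tau> t x - y t x)) \<longlongrightarrow> 0) (at_right 0) \<and>
    ((\<exists>K>0. \<forall>\<^sub>F \<tau> in at_right 0.
        L2_Bochner_norm T (L2_space \<Omega>) (\<lambda>t x. u\<^sub>\<tau> \<tau> t x - u t x) \<le> \<tau> * K) \<longrightarrow>
     (\<exists>C>0. \<forall>\<^sub>F \<tau> in at_right 0.
        L2_Bochner_norm T (H10_space \<Omega>) (\<lambda>t x. y\<^sub>\<tau> \<tau> t x - y t x) \<le> C * \<tau>))"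
proof -
  interpret bounded_open \<Omega> using assms(1) by unfold_locales (auto simp: bounded_lipschitz_domain_def)
  let ?z = "\<lambda>\<tau>. L2_Bochner_norm T (H10_space \<Omega>) (\<lambda>t x. y\<^sub>\<tau> \<tau> t x - y t x)"
  let ?f = "\<lambda>\<tau>. L2_Bochner_norm T (L2_space \<Omega>) (\<lambda>t x. u\<^sub>\<tau> \<tau> t x - u t x)"
  let ?h = "\<lambda>\<tau>. H1_Bochner_norm T (H1_space \<Omega>) (\<lambda>t x. u\<^sub>\<tau> \<tau> t x - u t x)"
  obtain A B where A: "A \<ge> 0" and B: "B \<ge> 0" and est: "\<And>\<tau> u\<tau> y\<tau>. 0 < \<tau> \<Longrightarrow> u\<tau> \<in> L2_Bochner T (H1_space \<Omega>) \<Longrightarrow>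
      cattaneo_weak_solution \<Omega> T \<tau> u\<tau> y0 y1 y\<tau> \<Longrightarrow> L2_Bochner_norm T (H10_space \<Omega>) (\<lambda>t x. y\<tau> t x - y t x)
      \<le> A * L2_Bochner_norm T (L2_space \<Omega>) (\<lambda>t x. u\<tau> t x - u t x) + B * \<tau>"
    using state_error_estimate[OF assms(2,4-8,11)] by blast
  have u: "u \<in> L2_Bochner T (H1_space \<Omega>)" and u\<tau>: "u\<^sub>\<tau> \<tau> \<in> L2_Bochner T (H1_space \<Omega>)" if "\<tau> > 0" for \<tau>
    using assms(8) assms(9)[OF that] by (auto simp: U_hat_def H1_Bochner_def)
  have z_le: "?z \<tau> \<le> A * ?f \<tau> + B * \<tau>" if "\<tau> > 0" for \<tau> by (rule est[OF that u\<tau>[OF that] assms(10)[OF that]])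
  have z0: "0 \<le> ?z \<tau>" for \<tau> unfolding L2_Bochner_norm_def by (intro real_sqrt_ge_zero integral_nonneg_AE) auto
  have f_le: "?f \<tau> \<le> ?h \<tau>" if "\<tau> > 0" for \<tau>
  proof -
    have "?f \<tau> \<le> L2_Bochner_norm T (H1_space \<Omega>) (\<lambda>t x. u\<^sub>\<tau> \<tau> t x - u t x)"
      by (rule H1_space_L2_Bochner(2)[OF HH.L2_Bochner_diff[OF u\<tau>[OF that] u[OF that]]])
    also have "\<dots> \<le> ?h \<tau>" unfolding H1_Bochner_norm_def by (rule real_le_rsqrt) simp
    finally show ?thesis .
  qed
  have "(?z \<longlongrightarrow> 0) (at_right 0)"
  proof (rule tendsto_sandwich[OF always_eventually[OF allI[OF z0]] _ tendsto_const])
    show "eventually (\<lambda>\<tau>. ?z \<tau> \<le> A * ?h \<tau> + B * \<tau>) (at_right 0)"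
      using eventually_at_right_less[of "0::real"]
    proof eventually_elim
      case (elim \<tau>)
      have "A * ?f \<tau> \<le> A * ?h \<tau>" by (rule mult_left_mono[OF f_le[OF elim] A])
      then show ?case using z_le[OF elim] by simp
    qed
    have "((\<lambda>\<tau>. A * ?h \<tau> + B * \<tau>) \<longlongrightarrow> A * 0 + B * 0) (at_right 0)"
      by (intro tendsto_intros assms(12))
    then show "((\<lambda>\<tau>. A * ?h \<tau> + B * \<tau>) \<longlongrightarrow> 0) (at_right 0)" by simp
  qed
  moreover have "\<exists>C>0. \<forall>\<^sub>F \<tau> in at_right 0. ?z \<tau> \<le> C * \<tau>"
    if ex: "\<exists>K>0. \<forall>\<^sub>F \<tau> in at_right 0. ?f \<tau> \<le> \<tau> * K"
  proof -
    obtain K where K: "K > 0" "\<forall>\<^sub>F \<tau> in at_right 0. ?f \<tau> \<le> \<tau> * K" using ex by (elim exE conjE)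
    show ?thesis
    proof (intro exI conjI)
      show "0 < A * K + B + 1" using A B K(1) by (simp add: add_nonneg_pos)
      from K(2) eventually_at_right_less[of "0::real"]
      show "\<forall>\<^sub>F \<tau> in at_right 0. ?z \<tau> \<le> (A * K + B + 1) * \<tau>"
      proof eventually_elim
        case (elim \<tau>)
        have "?z \<tau> \<le> A * ?f \<tau> + B * \<tau>" by (rule z_le[OF elim(2)])
        also have "\<dots> \<le> A * (\<tau> * K) + B * \<tau>" using elim(1) A by (intro add_right_mono mult_left_mono)
        also have "\<dots> \<le> (A * K + B + 1) * \<tau>" using elim(2) by (simp add: algebra_simps)
        finally show ?case .
      qed
    qed
  qed
  ultimately show ?thesis by blast
qed

end
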